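(* Let $(A,\mu,\Delta,\alpha,r)$ be a coboundary $\epsilon$-Hom-bialgebra with $r=\sum u_i\otimes v_i$. Then the following statements, in which the last two only apply when $A$ is finite dimensional, are equivalent. (1) $A$ is a quasi-triangular $\epsilon$-Hom-bialgebra, i.e., $A(r)=0$. (2) $(\alpha\otimes\Delta)(r)=r_{13}r_{12}$. (3) $(\Delta\otimes\alpha)(r)=-r_{23}r_{13}$. (4) $\lambda_2\circ\Delta^*=-\mu^{op}\circ\lambda_1^{\otimes 2}$ as maps $A^*\otimes A^*\to A$. (5) $\rho_2\circ\Delta^*=\mu^{op}\circ\rho_1^{\otimes 2}$ as maps $A^*\otimes A^*\to A$. (6) $\Delta\circ\lambda_1=\lambda_2^{\otimes 2}\circ\mu^{*op}$ as maps $A^*\to A\otimes A$. (7) $-\Delta\circ\rho_1=\rho_2^{\otimes 2}\circ\mu^{*op}$ as maps $A^*\to A\otimes A$.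
   Context: Throughout, $\mathbf{k}$ is a fixed field of characteristic $0$; vector spaces, linear maps and tensor products are over $\mathbf{k}$. $\tau$ denotes the twist $\tau(x\otimes y)=y\otimes x$. An $\epsilon$-Hom-bialgebra $(A,\mu,\Delta,\alpha)$ is a $\mathbf{k}$-vector space $A$ with linear maps $\mu\colon A^{\otimes 2}\to A$, $\Delta\colon A\to A^{\otimes 2}$, $\alpha\colon A\to A$ such that: $\alpha\circ\mu=\mu\circ\alpha^{\otimes 2}$; $\mu\circ(\alpha\otimes\mu)=\mu\circ(\mu\otimes\alpha)$; $\alpha^{\otimes 2}\circ\Delta=\Delta\circ\alpha$; $(\alpha\otimes\Delta)\circ\Delta=(\Delta\otimes\alpha)\circ\Delta$; and $\Delta\circ\mu=(\mu\otimes\alpha)\circ(\alpha\otimes\Delta)+(\alpha\otimes\mu)\circ(\Delta\otimes\alpha)$. For $a\in A$ and $r=\sum u_i\otimes v_i\in A^{\otimes 2}$, set $[a,r]_*=\sum\mu(a,u_i)\otimes\alpha(v_i)-\alpha(u_i)\otimes\mu(v_i,a)$. A coboundary $\epsilon$-Hom-bialgebra $(A,\mu,\Delta,\alpha,r)$ is an $\epsilon$-Hom-bialgebra $(A,\mu,\Delta,\alpha)$ together with an element $r\in A^{\otimes 2}$ with $\alpha^{\otimes 2}(r)=r$ such that $\Delta=[-,r]_*$. For $r=\sum u_i\otimes v_i$, set $$r_{13}r_{12}=\sum_{i,j}\mu(u_i,u_j)\otimes\alpha(v_j)\otimes\alpha(v_i),\quad r_{12}r_{23}=\sum_{i,j}\alpha(u_i)\otimes\mu(v_i,u_j)\otimes\alpha(v_j),\quad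 r_{23}r_{13}=\sum_{i,j}\alpha(u_j)\otimes\alpha(u_i)\otimes\mu(v_i,v_j),$$ and $A(r)=r_{13}r_{12}-r_{12}r_{23}+r_{23}r_{13}$. A quasi-triangular $\epsilon$-Hom-bialgebra is a coboundary $\epsilon$-Hom-bialgebra with $A(r)=0$. $A^*=\mathrm{Hom}(A,\mathbf{k})$ is the linear dual and $\langle\phi,a\rangle=\phi(a)$. The map $\Delta^*\colon A^*\otimes A^*\to A^*$ is $\langle\Delta^*(\phi\otimes\psi),a\rangle=\langle\phi\otimes\psi,\Delta(a)\rangle$. When $A$ is finite dimensional, $\mu^*\colon A^*\to A^*\otimes A^*\cong(A\otimes A)^*$ is $\langle\mu^*(\phi),a\otimes b\rangle=\langle\phi,\mu(a\otimes b)\rangle$. Put $\mu^{op}=\mu\circ\tau$ and $\mu^{*op}=\tau\circ\mu^*$. The linear maps $\lambda_1,\lambda_2,\rho_1,\rho_2\colon A^*\to A$ are defined by $$\lambda_1(\phi)=\sum\langle\phi,\alpha(u_i)\rangle v_i,\quad\lambda_2(\phi)=\sum\langle\phi,u_i\rangle\alpha(v_i),\quad\rho_1(\phi)=\sum u_i\langle\phi,\alpha(v_i)\rangle,\quad\rho_2(\phi)=\sum\alpha(u_i)\langle\phi,v_i\rangle.$$ *)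

theory Defs
  imports
    "HOL-Algebra.AbelCoset"
    "Jordan_Normal_Form.Missing_VectorSpace"
begin

section \<open>Linear algebra over a field with explicit carriers\<close>

text \<open>
  Vector spaces and linear maps are those of the locales \<^locale>\<open>vectorspace\<close> and
  \<^locale>\<open>linear_map\<close>.  The multiplicative fields of a module record play no role.
\<close>

definition char_zero :: "('k, 'r) ring_scheme \<Rightarrow> bool" where
  "char_zero K \<longleftrightarrow> (\<forall>n::nat. 0 < n \<longrightarrow> [n] \<cdot>\<^bsub>K\<^esub> \<one>\<^bsub>K\<^esub> \<noteq> \<zero>\<^bsub>K\<^esub>)"

definition field_space :: "('k, 'r) ring_scheme \<Rightarrow> ('k, 'k) module" where
  "field_space K =
     \<lparr>carrier = carrier K, mult = mult K, one = one K, zero = zero K, add = add K,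
      smult = mult K\<rparr>"

definition dual_space ::
  "('k, 'r) ring_scheme \<Rightarrow> ('k, 'v, 'm) module_scheme \<Rightarrow> ('k, 'v \<Rightarrow> 'k) module" where
  "dual_space K V = (ring.func_space K (carrier V))
     \<lparr>carrier := {\<phi> \<in> carrier V \<rightarrow>\<^sub>E carrier K. linear_map K V (field_space K) \<phi>}\<rparr>"

definition free_space :: "('k, 'r) ring_scheme \<Rightarrow> 'x set \<Rightarrow> ('k, 'x \<Rightarrow> 'k) module" where
  "free_space K X = (ring.func_space K X)
     \<lparr>carrier := {f \<in> X \<rightarrow>\<^sub>E carrier K. finite {x \<in> X. f x \<noteq> \<zero>\<^bsub>K\<^esub>}}\<rparr>"

definition free_gen :: "('k, 'r) ring_scheme \<Rightarrow> 'x set \<Rightarrow> 'x \<Rightarrow> 'x \<Rightarrow> 'k" where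
  "free_gen K X x = (\<lambda>y\<in>X. if y = x then \<one>\<^bsub>K\<^esub> else \<zero>\<^bsub>K\<^esub>)"

text \<open>
  In the scalar multiplication, adding \<open>W\<close> turns the set \<open>c X\<close> into a full coset also for \<open>c = 0\<close>.
\<close>

definition quotient_space :: "('k, 'v, 'm) module_scheme \<Rightarrow> 'v set \<Rightarrow> ('k, 'v set) module" where
  "quotient_space V W =
     \<lparr>carrier = a_rcosets\<^bsub>V\<^esub> W, mult = undefined, one = undefined, zero = W,
      add = (\<lambda>X Y. X <+>\<^bsub>V\<^esub> Y), smult = (\<lambda>c X. W <+>\<^bsub>V\<^esub> (\<lambda>x. c \<odot>\<^bsub>V\<^esub> x) ` X)\<rparr>"


section \<open>Tensor products\<close>

text \<open>
  \<open>V \<otimes> W\<close> is the free space on \<open>V \<times> W\<close> modulo the span of the bilinearity relations.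
\<close>

definition tensor_relations ::
  "('k, 'r) ring_scheme \<Rightarrow> ('k, 'v, 'm) module_scheme \<Rightarrow> ('k, 'w, 'n) module_scheme
    \<Rightarrow> ('v \<times> 'w \<Rightarrow> 'k) set" where
  "tensor_relations K V W =
    (let F = free_space K (carrier V \<times> carrier W);
         e = (\<lambda>v w. free_gen K (carrier V \<times> carrier W) (v, w))
     in {e (v \<oplus>\<^bsub>V\<^esub> v') w \<ominus>\<^bsub>F\<^esub> (e v w \<oplus>\<^bsub>F\<^esub> e v' w) | v v' w.
           v \<in> carrier V \<and> v' \<in> carrier V \<and> w \<in> carrier W}
      \<union> {e v (w \<oplus>\<^bsub>W\<^esub> w') \<ominus>\<^bsub>F\<^esub> (e v w \<oplus>\<^bsub>F\<^esub> e v w') | v w w'.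
           v \<in> carrier V \<and> w \<in> carrier W \<and> w' \<in> carrier W}
      \<union> {e (c \<odot>\<^bsub>V\<^esub> v) w \<ominus>\<^bsub>F\<^esub> (c \<odot>\<^bsub>F\<^esub> e v w) | c v w.
           c \<in> carrier K \<and> v \<in> carrier V \<and> w \<in> carrier W}
      \<union> {e v (c \<odot>\<^bsub>W\<^esub> w) \<ominus>\<^bsub>F\<^esub> (c \<odot>\<^bsub>F\<^esub> e v w) | c v w.
           c \<in> carrier K \<and> v \<in> carrier V \<and> w \<in> carrier W})"

definition tensor_kernel ::
  "('k, 'r) ring_scheme \<Rightarrow> ('k, 'v, 'm) module_scheme \<Rightarrow> ('k, 'w, 'n) module_scheme
    \<Rightarrow> ('v \<times> 'w \<Rightarrow> 'k) set" where
  "tensor_kernel K V W =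
    module.span K (free_space K (carrier V \<times> carrier W)) (tensor_relations K V W)"

definition tensor ::
  "('k, 'r) ring_scheme \<Rightarrow> ('k, 'v, 'm) module_scheme \<Rightarrow> ('k, 'w, 'n) module_scheme
    \<Rightarrow> ('k, ('v \<times> 'w \<Rightarrow> 'k) set) module" where
  "tensor K V W = quotient_space (free_space K (carrier V \<times> carrier W)) (tensor_kernel K V W)"

definition pure_tensor ::
  "('k, 'r) ring_scheme \<Rightarrow> ('k, 'v, 'm) module_scheme \<Rightarrow> ('k, 'w, 'n) module_scheme
    \<Rightarrow> 'v \<Rightarrow> 'w \<Rightarrow> ('v \<times> 'w \<Rightarrow> 'k) set" where
  "pure_tensor K V W v w =
    tensor_kernel K V W
      +>\<^bsub>free_space K (carrier V \<times> carrier W)\<^esub> free_gen K (carrier V \<times> carrier W) (v, w)"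

definition bilinear_map ::
  "('k, 'r) ring_scheme \<Rightarrow> ('k, 'v, 'm) module_scheme \<Rightarrow> ('k, 'w, 'n) module_scheme
    \<Rightarrow> ('k, 'u, 'o) module_scheme \<Rightarrow> ('v \<Rightarrow> 'w \<Rightarrow> 'u) \<Rightarrow> bool" where
  "bilinear_map K V W U \<beta> \<longleftrightarrow>
     (\<forall>v\<in>carrier V. linear_map K W U (\<beta> v)) \<and>
     (\<forall>w\<in>carrier W. linear_map K V U (\<lambda>v. \<beta> v w))"

text \<open>
  The linear map \<open>V \<otimes> W \<rightarrow> U\<close> determined by \<open>v \<otimes> w \<mapsto> \<beta> v w\<close>, for bilinear \<open>\<beta>\<close>;
  existence and uniqueness are \<open>tensor_lift_ex1\<close> below.
\<close>

definition is_tensor_lift ::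
  "('k, 'r) ring_scheme \<Rightarrow> ('k, 'v, 'm) module_scheme \<Rightarrow> ('k, 'w, 'n) module_scheme
    \<Rightarrow> ('k, 'u, 'o) module_scheme \<Rightarrow> ('v \<Rightarrow> 'w \<Rightarrow> 'u) \<Rightarrow> (('v \<times> 'w \<Rightarrow> 'k) set \<Rightarrow> 'u) \<Rightarrow> bool" where
  "is_tensor_lift K V W U \<beta> f \<longleftrightarrow>
     linear_map K (tensor K V W) U f \<and> f \<in> extensional (carrier (tensor K V W)) \<and>
     (\<forall>v\<in>carrier V. \<forall>w\<in>carrier W. f (pure_tensor K V W v w) = \<beta> v w)"

definition tensor_lift ::
  "('k, 'r) ring_scheme \<Rightarrow> ('k, 'v, 'm) module_scheme \<Rightarrow> ('k, 'w, 'n) module_scheme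
    \<Rightarrow> ('k, 'u, 'o) module_scheme \<Rightarrow> ('v \<Rightarrow> 'w \<Rightarrow> 'u) \<Rightarrow> ('v \<times> 'w \<Rightarrow> 'k) set \<Rightarrow> 'u" where
  "tensor_lift K V W U \<beta> = (THE f. is_tensor_lift K V W U \<beta> f)"

subsection \<open>The universal property\<close>

lemma vectorspace_free_space:
  assumes "field K"
  shows "vectorspace K (free_space K X)"
proof -
  interpret K: field K by fact
  have fs: "vectorspace K (K.func_space X)"
    by (auto simp: vectorspace_def K.func_space_is_module K.field_axioms)
  have "submodule K {f \<in> X \<rightarrow>\<^sub>E carrier K. finite {x \<in> X. f x \<noteq> \<zero>\<^bsub>K\<^esub>}} (K.func_space X)"
    unfolding submodule_def using fs
    apply (auto simp: K.func_space_def vectorspace_def)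
    subgoal for f g
      by (rule finite_subset[of _ "{x \<in> X. f x \<noteq> \<zero>\<^bsub>K\<^esub>} \<union> {x \<in> X. g x \<noteq> \<zero>\<^bsub>K\<^esub>}"]) auto
    subgoal for c f
      by (rule finite_subset[of _ "{x \<in> X. f x \<noteq> \<zero>\<^bsub>K\<^esub>}"]) auto
    done
  then have "subspace K {f \<in> X \<rightarrow>\<^sub>E carrier K. finite {x \<in> X. f x \<noteq> \<zero>\<^bsub>K\<^esub>}} (K.func_space X)"
    using fs by (simp add: subspace_def)
  then show ?thesis
    unfolding free_space_def by (rule vectorspace.subspace_is_vs[OF fs])
qed

lemma abelian_subgroup_submodule:
  assumes "submodule K W V"
  shows "abelian_subgroup W V"
proof -
  interpret V: module K V using assms by (simp add: submodule_def)
  show ?thesis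
  proof (rule abelian_subgroupI3)
    show "additive_subgroup W V"
    proof (rule additive_subgroupI, rule subgroup.intro)
      fix x assume x: "x \<in> W"
      then have "x \<in> carrier V" using assms by (auto simp: submodule_def)
      moreover have "(\<ominus>\<^bsub>K\<^esub> \<one>\<^bsub>K\<^esub>) \<odot>\<^bsub>V\<^esub> x \<in> W" using assms x by (auto simp: submodule_def)
      ultimately show "inv\<^bsub>add_monoid V\<^esub> x \<in> W" 
        by (simp add: V.smult_minus_1 a_inv_def[symmetric])
    qed (use assms in \<open>auto simp: submodule_def\<close>)
    show "abelian_group V" ..
  qed
qed

lemma quotient_smult:
  assumes "submodule K W V" "c \<in> carrier K" "x \<in> carrier V"
  shows "c \<odot>\<^bsub>quotient_space V W\<^esub> (W +>\<^bsub>V\<^esub> x) = W +>\<^bsub>V\<^esub> (c \<odot>\<^bsub>V\<^esub> x)"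
proof -
  interpret V: module K V using assms by (simp add: submodule_def)
  interpret W: abelian_subgroup W V by (rule abelian_subgroup_submodule[OF assms(1)])
  interpret S: submodule K W V by fact
  have sub: "w \<in> W \<Longrightarrow> w \<in> carrier V" for w using S.subset by auto
  have "W <+>\<^bsub>V\<^esub> ((\<lambda>x. c \<odot>\<^bsub>V\<^esub> x) ` (W +>\<^bsub>V\<^esub> x)) = W +>\<^bsub>V\<^esub> (c \<odot>\<^bsub>V\<^esub> x)"
  proof (intro equalityI subsetI)
    fix y assume "y \<in> W <+>\<^bsub>V\<^esub> ((\<lambda>x. c \<odot>\<^bsub>V\<^esub> x) ` (W +>\<^bsub>V\<^esub> x))"
    then obtain w w' where w: "w \<in> W" "w' \<in> W" "y = w \<oplus>\<^bsub>V\<^esub> c \<odot>\<^bsub>V\<^esub> (w' \<oplus>\<^bsub>V\<^esub> x)"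
      by (auto simp: set_add_def' a_r_coset_def')
    then have "y = (w \<oplus>\<^bsub>V\<^esub> c \<odot>\<^bsub>V\<^esub> w') \<oplus>\<^bsub>V\<^esub> c \<odot>\<^bsub>V\<^esub> x"
      using assms sub by (simp add: V.smult_r_distr V.M.a_assoc)
    moreover have "w \<oplus>\<^bsub>V\<^esub> c \<odot>\<^bsub>V\<^esub> w' \<in> W" using w assms by simp
    ultimately show "y \<in> W +>\<^bsub>V\<^esub> (c \<odot>\<^bsub>V\<^esub> x)" by (auto simp: a_r_coset_def')
  next
    fix y assume "y \<in> W +>\<^bsub>V\<^esub> (c \<odot>\<^bsub>V\<^esub> x)"
    then obtain w where w: "w \<in> W" "y = w \<oplus>\<^bsub>V\<^esub> c \<odot>\<^bsub>V\<^esub> x" by (auto simp: a_r_coset_def')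
    moreover have "x \<in> W +>\<^bsub>V\<^esub> x" using assms(3) by (rule W.a_rcos_self)
    ultimately show "y \<in> W <+>\<^bsub>V\<^esub> ((\<lambda>x. c \<odot>\<^bsub>V\<^esub> x) ` (W +>\<^bsub>V\<^esub> x))"
      by (auto simp: set_add_def')
  qed
  then show ?thesis by (simp add: quotient_space_def)
qed

lemma quotient_add:
  assumes "submodule K W V" "x \<in> carrier V" "y \<in> carrier V"
  shows "(W +>\<^bsub>V\<^esub> x) \<oplus>\<^bsub>quotient_space V W\<^esub> (W +>\<^bsub>V\<^esub> y) = W +>\<^bsub>V\<^esub> (x \<oplus>\<^bsub>V\<^esub> y)"
proof -
  interpret W: abelian_subgroup W V by (rule abelian_subgroup_submodule[OF assms(1)])
  show ?thesis using assms by (simp add: quotient_space_def W.a_rcos_sum)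
qed

lemma quotient_carrier: "carrier (quotient_space V W) = (\<lambda>x. W +>\<^bsub>V\<^esub> x) ` carrier V"
  by (auto simp: quotient_space_def A_RCOSETS_def')

lemma quotient_zero:
  assumes "submodule K W V"
  shows "\<zero>\<^bsub>quotient_space V W\<^esub> = W +>\<^bsub>V\<^esub> \<zero>\<^bsub>V\<^esub>"
proof -
  interpret W: abelian_subgroup W V by (rule abelian_subgroup_submodule[OF assms(1)])
  show ?thesis by (simp add: quotient_space_def W.a_subset)
qed

lemma vectorspace_field_space:
  assumes "field K"
  shows "vectorspace K (field_space K)"
proof -
  interpret K: field K by fact
  show ?thesis
  proof (rule vs_criteria)
    show "\<forall>v\<in>carrier (field_space K). \<exists>w\<in>carrier (field_space K).
        v \<oplus>\<^bsub>field_space K\<^esub> w = \<zero>\<^bsub>field_space K\<^esub>"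
      using K.r_neg by (auto simp: field_space_def)
  qed (auto simp: field_space_def K.l_distr K.r_distr K.m_assoc K.a_ac K.field_axioms)
qed

lemma vectorspace_quotient_space:
  assumes "vectorspace K V" "submodule K W V"
  shows "vectorspace K (quotient_space V W)"
proof -
  interpret V: vectorspace K V by fact
  note simps = quotient_add[OF assms(2)] quotient_smult[OF assms(2)] quotient_zero[OF assms(2)]
    quotient_carrier
  show ?thesis
  proof (rule vs_criteria)
    show "\<forall>v\<in>carrier (quotient_space V W). \<exists>w\<in>carrier (quotient_space V W).
        v \<oplus>\<^bsub>quotient_space V W\<^esub> w = \<zero>\<^bsub>quotient_space V W\<^esub>"
    proof
      fix v assume "v \<in> carrier (quotient_space V W)"
      then obtain x where x: "x \<in> carrier V" "v = W +>\<^bsub>V\<^esub> x" by (auto simp: simps)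
      then have "v \<oplus>\<^bsub>quotient_space V W\<^esub> (W +>\<^bsub>V\<^esub> (\<ominus>\<^bsub>V\<^esub> x)) = \<zero>\<^bsub>quotient_space V W\<^esub>"
        by (simp add: simps V.M.r_neg)
      moreover have "W +>\<^bsub>V\<^esub> (\<ominus>\<^bsub>V\<^esub> x) \<in> carrier (quotient_space V W)" using x by (simp add: simps)
      ultimately show "\<exists>w\<in>carrier (quotient_space V W).
        v \<oplus>\<^bsub>quotient_space V W\<^esub> w = \<zero>\<^bsub>quotient_space V W\<^esub>" by blast
    qed
  qed (auto simp: simps V.field_axioms V.M.a_ac V.smult_l_distr V.smult_r_distr V.smult_assoc1)
qed

lemma linear_map_iff:
  assumes "vectorspace K V" "vectorspace K W"
  shows "linear_map K V W f \<longleftrightarrow> f \<in> module_hom K V W"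
  using assms by (auto simp: linear_map_def mod_hom_def mod_hom_axioms_def vectorspace_def)

lemma linear_mapI:
  assumes "vectorspace K V" "vectorspace K W"
    and "\<And>v. v \<in> carrier V \<Longrightarrow> f v \<in> carrier W"
    and "\<And>v v'. v \<in> carrier V \<Longrightarrow> v' \<in> carrier V \<Longrightarrow> f (v \<oplus>\<^bsub>V\<^esub> v') = f v \<oplus>\<^bsub>W\<^esub> f v'"
    and "\<And>c v. c \<in> carrier K \<Longrightarrow> v \<in> carrier V \<Longrightarrow> f (c \<odot>\<^bsub>V\<^esub> v) = c \<odot>\<^bsub>W\<^esub> f v"
  shows "linear_map K V W f"
  using assms by (simp add: linear_map_iff module_hom_def)

lemma linear_mapD:
  assumes "linear_map K V W f"
  shows "v \<in> carrier V \<Longrightarrow> f v \<in> carrier W"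
    and "v \<in> carrier V \<Longrightarrow> v' \<in> carrier V \<Longrightarrow> f (v \<oplus>\<^bsub>V\<^esub> v') = f v \<oplus>\<^bsub>W\<^esub> f v'"
    and "c \<in> carrier K \<Longrightarrow> v \<in> carrier V \<Longrightarrow> f (c \<odot>\<^bsub>V\<^esub> v) = c \<odot>\<^bsub>W\<^esub> f v"
proof -
  interpret linear_map K V W f by fact
  show "v \<in> carrier V \<Longrightarrow> f v \<in> carrier W"
    and "v \<in> carrier V \<Longrightarrow> v' \<in> carrier V \<Longrightarrow> f (v \<oplus>\<^bsub>V\<^esub> v') = f v \<oplus>\<^bsub>W\<^esub> f v'"
    and "c \<in> carrier K \<Longrightarrow> v \<in> carrier V \<Longrightarrow> f (c \<odot>\<^bsub>V\<^esub> v) = c \<odot>\<^bsub>W\<^esub> f v"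
    using f_hom by (auto simp: module_hom_def)
qed

lemma vectorspace_dual_space:
  assumes "vectorspace K V"
  shows "vectorspace K (dual_space K V)"
proof -
  interpret V: vectorspace K V by fact
  let ?F = "V.func_space (carrier V)"
  have F: "vectorspace K ?F" by (rule V.func_space_is_vs)
  have fs: "vectorspace K (field_space K)"
    by (rule vectorspace_field_space) (rule V.field_axioms)
  let ?N = "{\<phi> \<in> carrier V \<rightarrow>\<^sub>E carrier K. linear_map K V (field_space K) \<phi>}"
  have k: "carrier (field_space K) = carrier K" "add (field_space K) = add K"
    "smult (field_space K) = mult K" by (auto simp: field_space_def)
  have "submodule K ?N ?F"
  proof (unfold submodule_def, intro conjI allI impI)
    show "module K ?F" using F by (simp add: vectorspace_def)
    show "?N \<subseteq> carrier ?F" by (auto simp: V.func_space_def)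
    show "\<zero>\<^bsub>?F\<^esub> \<in> ?N"
      by (auto simp: V.func_space_def k intro!: linear_mapI[OF assms fs])
  next
    fix f g assume f: "f \<in> ?N" and g: "g \<in> ?N"
    have cl: "v \<in> carrier V \<Longrightarrow> f v \<in> carrier K" "v \<in> carrier V \<Longrightarrow> g v \<in> carrier K" for v
      using f g by auto
    have lf: "linear_map K V (field_space K) f" and lg: "linear_map K V (field_space K) g"
      using f g by auto
    have "linear_map K V (field_space K) (\<lambda>v\<in>carrier V. f v \<oplus>\<^bsub>K\<^esub> g v)"
      using linear_mapD[OF lf] linear_mapD[OF lg]
      by (intro linear_mapI[OF assms fs]) (auto simp: k cl V.R.r_distr V.R.a_ac)
    then show "f \<oplus>\<^bsub>?F\<^esub> g \<in> ?N" using cl by (auto simp: V.func_space_def)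
  next
    fix c f assume c: "c \<in> carrier K" and f: "f \<in> ?N"
    have cl: "v \<in> carrier V \<Longrightarrow> f v \<in> carrier K" for v using f by auto
    have lf: "linear_map K V (field_space K) f" using f by auto
    have "linear_map K V (field_space K) (\<lambda>v\<in>carrier V. c \<otimes>\<^bsub>K\<^esub> f v)"
      using linear_mapD[OF lf]
      by (intro linear_mapI[OF assms fs]) (auto simp: k cl c V.R.r_distr V.R.m_ac)
    then show "c \<odot>\<^bsub>?F\<^esub> f \<in> ?N" using cl c by (auto simp: V.func_space_def)
  qed
  then have "subspace K ?N ?F" using F by (simp add: subspace_def)
  then show ?thesis
    unfolding dual_space_def by (rule vectorspace.subspace_is_vs[OF F])
qed

lemma free_gen_closed:
  assumes "field K" "x \<in> X"
  shows "free_gen K X x \<in> carrier (free_space K X)"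
proof -
  interpret K: field K by fact
  have "finite {y \<in> X. free_gen K X x y \<noteq> \<zero>\<^bsub>K\<^esub>}"
    by (rule finite_subset[of _ "{x}"]) (auto simp: free_gen_def)
  then show ?thesis by (auto simp: free_gen_def free_space_def)
qed

lemma tensor_relations_subset:
  assumes "vectorspace K V" "vectorspace K W"
  shows "tensor_relations K V W \<subseteq> carrier (free_space K (carrier V \<times> carrier W))"
proof -
  interpret V: vectorspace K V by fact
  interpret W: vectorspace K W by fact
  interpret F: vectorspace K "free_space K (carrier V \<times> carrier W)"
    by (rule vectorspace_free_space) (rule V.field_axioms)
  note g = free_gen_closed[OF V.field_axioms, of _ "carrier V \<times> carrier W"]
  show ?thesis
    by (auto simp: tensor_relations_def Let_def intro!: F.M.minus_closed g F.M.a_closed F.smult_closed)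
qed

lemma submodule_tensor_kernel:
  assumes "vectorspace K V" "vectorspace K W"
  shows "submodule K (tensor_kernel K V W) (free_space K (carrier V \<times> carrier W))"
proof -
  interpret V: vectorspace K V by fact
  interpret F: vectorspace K "free_space K (carrier V \<times> carrier W)"
    by (rule vectorspace_free_space) (rule V.field_axioms)
  show ?thesis
    unfolding tensor_kernel_def by (rule F.span_is_submodule[OF tensor_relations_subset[OF assms]])
qed

lemma vectorspace_tensor:
  assumes "vectorspace K V" "vectorspace K W"
  shows "vectorspace K (tensor K V W)"
  unfolding tensor_def
  using assms
  by (intro vectorspace_quotient_space vectorspace_free_space submodule_tensor_kernel)
    (auto simp: vectorspace_def)

lemma free_space_ops:
  assumes "field K"
  shows "\<zero>\<^bsub>free_space K X\<^esub> = (\<lambda>x\<in>X. \<zero>\<^bsub>K\<^esub>)"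
    and "f \<oplus>\<^bsub>free_space K X\<^esub> g = (\<lambda>x\<in>X. f x \<oplus>\<^bsub>K\<^esub> g x)"
    and "c \<odot>\<^bsub>free_space K X\<^esub> f = (\<lambda>x\<in>X. c \<otimes>\<^bsub>K\<^esub> f x)"
proof -
  interpret K: field K by fact
  show "\<zero>\<^bsub>free_space K X\<^esub> = (\<lambda>x\<in>X. \<zero>\<^bsub>K\<^esub>)"
    and "f \<oplus>\<^bsub>free_space K X\<^esub> g = (\<lambda>x\<in>X. f x \<oplus>\<^bsub>K\<^esub> g x)"
    and "c \<odot>\<^bsub>free_space K X\<^esub> f = (\<lambda>x\<in>X. c \<otimes>\<^bsub>K\<^esub> f x)"
    by (auto simp: free_space_def K.func_space_def)
qed

lemma free_lift:
  assumes "vectorspace K U" and b: "\<And>x. x \<in> X \<Longrightarrow> b x \<in> carrier U"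
  obtains L where "linear_map K (free_space K X) U L"
    and "\<And>x. x \<in> X \<Longrightarrow> L (free_gen K X x) = b x"
proof -
  interpret U: vectorspace K U by fact
  have F: "vectorspace K (free_space K X)" by (rule vectorspace_free_space) (rule U.field_axioms)
  note ops = free_space_ops[OF U.field_axioms, of X]
  define S where "S f = {x \<in> X. f x \<noteq> \<zero>\<^bsub>K\<^esub>}" for f
  define L where "L f = (\<Oplus>\<^bsub>U\<^esub>x\<in>S f. f x \<odot>\<^bsub>U\<^esub> b x)" for f
  have clF: "f x \<in> carrier K" if "f \<in> carrier (free_space K X)" "x \<in> X" for f x
    using that by (auto simp: free_space_def)
  have finS: "finite (S f)" if "f \<in> carrier (free_space K X)" for f
    using that by (auto simp: free_space_def S_def)
  have L: "L f = (\<Oplus>\<^bsub>U\<^esub>x\<in>T. f x \<odot>\<^bsub>U\<^esub> b x)"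
    if "f \<in> carrier (free_space K X)" "finite T" "S f \<subseteq> T" "T \<subseteq> X" for f T
    unfolding L_def
  proof (rule U.M.add.finprod_mono_neutral_cong_left)
    show "\<And>i. i \<in> T - S f \<Longrightarrow> f i \<odot>\<^bsub>U\<^esub> b i = \<zero>\<^bsub>U\<^esub>" using that b by (auto simp: S_def)
  qed (use that b clF in auto)
  show thesis
  proof
    show "linear_map K (free_space K X) U L"
    proof (rule linear_mapI[OF F assms(1)])
      fix f assume f: "f \<in> carrier (free_space K X)"
      show "L f \<in> carrier U" unfolding L_def
        by (rule U.M.finsum_closed) (use b clF[OF f] in \<open>auto simp: S_def\<close>)
    next
      fix f g assume fg: "f \<in> carrier (free_space K X)" "g \<in> carrier (free_space K X)"
      interpret F: vectorspace K "free_space K X" by (rule F)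
      let ?T = "S f \<union> S g"
      have T: "finite ?T" "?T \<subseteq> X" using finS fg by (auto simp: S_def)
      have "S (f \<oplus>\<^bsub>free_space K X\<^esub> g) \<subseteq> ?T" by (auto simp: S_def ops)
      then have "L (f \<oplus>\<^bsub>free_space K X\<^esub> g) = (\<Oplus>\<^bsub>U\<^esub>x\<in>?T. (f \<oplus>\<^bsub>free_space K X\<^esub> g) x \<odot>\<^bsub>U\<^esub> b x)"
        using T fg by (intro L) auto
      also have "\<dots> = (\<Oplus>\<^bsub>U\<^esub>x\<in>?T. (f x \<odot>\<^bsub>U\<^esub> b x) \<oplus>\<^bsub>U\<^esub> (g x \<odot>\<^bsub>U\<^esub> b x))"
        using T(2) clF fg b
        by (intro U.M.finsum_cong') (auto simp: ops U.smult_l_distr subset_iff)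
      also have "\<dots> = (\<Oplus>\<^bsub>U\<^esub>x\<in>?T. f x \<odot>\<^bsub>U\<^esub> b x) \<oplus>\<^bsub>U\<^esub> (\<Oplus>\<^bsub>U\<^esub>x\<in>?T. g x \<odot>\<^bsub>U\<^esub> b x)"
        using T(2) clF fg b by (intro U.M.finsum_addf) auto
      also have "\<dots> = L f \<oplus>\<^bsub>U\<^esub> L g" using L[OF fg(1) T(1)] L[OF fg(2) T(1)] T(2) by simp
      finally show "L (f \<oplus>\<^bsub>free_space K X\<^esub> g) = L f \<oplus>\<^bsub>U\<^esub> L g" .
    next
      fix c f assume c: "c \<in> carrier K" and f: "f \<in> carrier (free_space K X)"
      interpret F: vectorspace K "free_space K X" by (rule F)
      have T: "finite (S f)" "S f \<subseteq> X" using finS f by (auto simp: S_def)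
      have "S (c \<odot>\<^bsub>free_space K X\<^esub> f) \<subseteq> S f" using c by (auto simp: S_def ops)
      then have "L (c \<odot>\<^bsub>free_space K X\<^esub> f) = (\<Oplus>\<^bsub>U\<^esub>x\<in>S f. (c \<odot>\<^bsub>free_space K X\<^esub> f) x \<odot>\<^bsub>U\<^esub> b x)"
        using T f c by (intro L) auto
      also have "\<dots> = (\<Oplus>\<^bsub>U\<^esub>x\<in>S f. c \<odot>\<^bsub>U\<^esub> (f x \<odot>\<^bsub>U\<^esub> b x))"
        using T(2) clF f b c
        by (intro U.M.finsum_cong') (auto simp: ops U.smult_assoc1 subset_iff)
      also have "\<dots> = c \<odot>\<^bsub>U\<^esub> L f"
        unfolding L_def
        by (rule U.finsum_smult_ldistr[symmetric]) (use T clF f b c in auto)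
      finally show "L (c \<odot>\<^bsub>free_space K X\<^esub> f) = c \<odot>\<^bsub>U\<^esub> L f" .
    qed
  next
    fix x assume x: "x \<in> X"
    have "S (free_gen K X x) = {x}" using x by (auto simp: S_def free_gen_def)
    then show "L (free_gen K X x) = b x" using b[OF x] x by (simp add: L_def free_gen_def)
  qed
qed

lemma linear_map_eq_free:
  assumes "linear_map K (free_space K X) U G" "linear_map K (free_space K X) U H"
    and eq: "\<And>x. x \<in> X \<Longrightarrow> G (free_gen K X x) = H (free_gen K X x)"
    and f: "f \<in> carrier (free_space K X)"
  shows "G f = H f"
proof -
  have K: "field K" using assms(1) by (simp add: linear_map_def vectorspace_def)
  interpret K: field K by (rule K)
  interpret G: linear_map K "free_space K X" U G by fact
  interpret H: linear_map K "free_space K X" U H by fact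
  note ops = free_space_ops[OF K, of X]
  show ?thesis using f
  proof (induction "card {x \<in> X. f x \<noteq> \<zero>\<^bsub>K\<^esub>}" arbitrary: f rule: less_induct)
    case less
    have fin: "finite {x \<in> X. f x \<noteq> \<zero>\<^bsub>K\<^esub>}" and fE: "f \<in> X \<rightarrow>\<^sub>E carrier K"
      using less.prems by (auto simp: free_space_def)
    show ?case
    proof (cases "{x \<in> X. f x \<noteq> \<zero>\<^bsub>K\<^esub>} = {}")
      case True
      then have "f = \<zero>\<^bsub>free_space K X\<^esub>"
        unfolding ops using fE by (auto intro!: ext simp: PiE_def extensional_def)
      then show ?thesis by simp
    next
      case False
      then obtain x where x: "x \<in> X" "f x \<noteq> \<zero>\<^bsub>K\<^esub>" by auto
      define g where "g = f(x := \<zero>\<^bsub>K\<^esub>)"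
      have sub: "{y \<in> X. g y \<noteq> \<zero>\<^bsub>K\<^esub>} \<subset> {x \<in> X. f x \<noteq> \<zero>\<^bsub>K\<^esub>}" using x by (auto simp: g_def)
      have gE: "g \<in> X \<rightarrow>\<^sub>E carrier K"
        using fE x K.zero_closed by (auto simp: g_def PiE_def extensional_def Pi_def)
      have g: "g \<in> carrier (free_space K X)"
        using finite_subset[OF _ fin, of "{y \<in> X. g y \<noteq> \<zero>\<^bsub>K\<^esub>}"] sub gE
        by (auto simp: free_space_def)
      have fx: "f x \<in> carrier K" using fE x by auto
      have e: "free_gen K X x \<in> carrier (free_space K X)" by (rule free_gen_closed[OF K x(1)])
      have dec: "f = g \<oplus>\<^bsub>free_space K X\<^esub> (f x \<odot>\<^bsub>free_space K X\<^esub> free_gen K X x)"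
      proof
        fix y
        show "f y = (g \<oplus>\<^bsub>free_space K X\<^esub> (f x \<odot>\<^bsub>free_space K X\<^esub> free_gen K X x)) y"
          using fE fx x(1) by (cases "y \<in> X") (auto simp: ops g_def free_gen_def PiE_def extensional_def Pi_def)
      qed
      have IH: "G g = H g" using psubset_card_mono[OF fin sub] g by (rule less.hyps)
      have ce: "f x \<odot>\<^bsub>free_space K X\<^esub> free_gen K X x \<in> carrier (free_space K X)"
        using fx e by simp
      have "G f = G g \<oplus>\<^bsub>U\<^esub> f x \<odot>\<^bsub>U\<^esub> G (free_gen K X x)"
        by (subst dec) (use fx e g ce in \<open>simp add: linear_mapD[OF assms(1)]\<close>)
      moreover have "H f = H g \<oplus>\<^bsub>U\<^esub> f x \<odot>\<^bsub>U\<^esub> H (free_gen K X x)"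
        by (subst dec) (use fx e g ce in \<open>simp add: linear_mapD[OF assms(2)]\<close>)
      ultimately show ?thesis by (simp add: IH eq[OF x(1)])
    qed
  qed
qed

lemma linear_map_proj:
  assumes "vectorspace K V" "submodule K N V"
  shows "linear_map K V (quotient_space V N) (\<lambda>x. N +>\<^bsub>V\<^esub> x)"
  using assms
  by (intro linear_mapI vectorspace_quotient_space)
    (auto simp: quotient_carrier quotient_add quotient_smult)

lemma linear_map_comp:
  assumes "linear_map K V W f" "linear_map K W U g"
  shows "linear_map K V U (\<lambda>x. g (f x))"
  by (rule linear_mapI[OF linear_map.axioms(1)[OF assms(1)] linear_map.axioms(2)[OF assms(2)]])
    (simp_all add: linear_mapD[OF assms(1)] linear_mapD[OF assms(2)])

lemma quotient_lift:
  assumes V: "vectorspace K V" and N: "submodule K N V" and L: "linear_map K V U L"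
    and ker: "\<And>x. x \<in> N \<Longrightarrow> L x = \<zero>\<^bsub>U\<^esub>"
  obtains h where "linear_map K (quotient_space V N) U h"
    and "\<And>x. x \<in> carrier V \<Longrightarrow> h (N +>\<^bsub>V\<^esub> x) = L x"
proof -
  interpret L: linear_map K V U L by fact
  interpret N: abelian_subgroup N V by (rule abelian_subgroup_submodule[OF N])
  interpret NS: submodule K N V by fact
  define h where "h X = L (SOME x. x \<in> X)" for X
  have h: "h (N +>\<^bsub>V\<^esub> x) = L x" if x: "x \<in> carrier V" for x
  proof -
    have "(SOME y. y \<in> N +>\<^bsub>V\<^esub> x) \<in> N +>\<^bsub>V\<^esub> x" by (rule someI) (rule N.a_rcos_self[OF x])
    then obtain n where n: "n \<in> N" "(SOME y. y \<in> N +>\<^bsub>V\<^esub> x) = n \<oplus>\<^bsub>V\<^esub> x"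
      by (auto simp: a_r_coset_def')
    have "n \<in> carrier V" using n NS.subset by auto
    then have "L (n \<oplus>\<^bsub>V\<^esub> x) = L x" using x n by (simp add: linear_mapD[OF L] ker)
    then show ?thesis by (simp add: h_def n)
  qed
  have "linear_map K (quotient_space V N) U h"
  proof (rule linear_mapI[OF vectorspace_quotient_space[OF V N] linear_map.axioms(2)[OF L]])
    show "\<And>v. v \<in> carrier (quotient_space V N) \<Longrightarrow> h v \<in> carrier U"
      by (auto simp: quotient_carrier h linear_mapD[OF L])
    show "\<And>v v'. v \<in> carrier (quotient_space V N) \<Longrightarrow> v' \<in> carrier (quotient_space V N) \<Longrightarrow>
       h (v \<oplus>\<^bsub>quotient_space V N\<^esub> v') = h v \<oplus>\<^bsub>U\<^esub> h v'"
      by (auto simp: quotient_carrier h quotient_add[OF N] linear_mapD[OF L])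
    show "\<And>c v. c \<in> carrier K \<Longrightarrow> v \<in> carrier (quotient_space V N) \<Longrightarrow>
       h (c \<odot>\<^bsub>quotient_space V N\<^esub> v) = c \<odot>\<^bsub>U\<^esub> h v"
      by (auto simp: quotient_carrier h quotient_smult[OF N] linear_mapD[OF L])
  qed
  then show thesis using h that by blast
qed

lemma bilinear_mapD:
  assumes "bilinear_map K V W U \<beta>"
  shows "v \<in> carrier V \<Longrightarrow> linear_map K W U (\<beta> v)"
    and "w \<in> carrier W \<Longrightarrow> linear_map K V U (\<lambda>v. \<beta> v w)"
  using assms by (auto simp: bilinear_map_def)

theorem tensor_lift_ex1:
  assumes "vectorspace K V" "vectorspace K W" "vectorspace K U" and \<beta>: "bilinear_map K V W U \<beta>"
  shows "\<exists>!f. is_tensor_lift K V W U \<beta> f"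
proof -
  interpret V: vectorspace K V by fact
  interpret W: vectorspace K W by fact
  interpret U: vectorspace K U by fact
  let ?X = "carrier V \<times> carrier W"
  let ?F = "free_space K ?X"
  let ?N = "tensor_kernel K V W"
  let ?e = "\<lambda>v w. free_gen K ?X (v, w)"
  have F: "vectorspace K ?F" by (rule vectorspace_free_space) (rule V.field_axioms)
  interpret F: vectorspace K ?F by (rule F)
  have N: "submodule K ?N ?F" by (rule submodule_tensor_kernel[OF assms(1,2)])
  have e: "?e v w \<in> carrier ?F" if "v \<in> carrier V" "w \<in> carrier W" for v w
    using that by (intro free_gen_closed V.field_axioms) auto
  have T: "tensor K V W = quotient_space ?F ?N" by (simp add: tensor_def)
  have P: "pure_tensor K V W v w = ?N +>\<^bsub>?F\<^esub> ?e v w" for v w by (simp add: pure_tensor_def)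
  note \<beta>1 = linear_mapD[OF bilinear_mapD(1)[OF \<beta>]]
  note \<beta>2 = linear_mapD[OF bilinear_mapD(2)[OF \<beta>]]
  obtain L where L: "linear_map K ?F U L" and Lg: "\<And>x. x \<in> ?X \<Longrightarrow> L (free_gen K ?X x) = case_prod \<beta> x"
    by (rule free_lift[OF assms(3), of ?X "case_prod \<beta>"]) (use \<beta>1(1) in auto)
  interpret L: linear_map K ?F U L by (rule L)
  have Le: "L (?e v w) = \<beta> v w" if "v \<in> carrier V" "w \<in> carrier W" for v w
    using Lg[of "(v, w)"] that by simp
  have "?N \<subseteq> L.ker"
    unfolding tensor_kernel_def
  proof (rule F.span_is_subset)
    show "submodule K L.ker ?F" by (rule L.ker_is_submodule)
    have eq: "x \<ominus>\<^bsub>?F\<^esub> y \<in> L.ker" if "x \<in> carrier ?F" "y \<in> carrier ?F" "L x = L y" for x y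
      using that by (auto simp: L.ker_def)
    show "tensor_relations K V W \<subseteq> L.ker"
      by (auto simp: tensor_relations_def Let_def Le e \<beta>1 \<beta>2 linear_mapD[OF L] intro!: eq)
  qed
  then have ker: "L x = \<zero>\<^bsub>U\<^esub>" if "x \<in> ?N" for x using that by (auto simp: L.ker_def)
  obtain h where h: "linear_map K (tensor K V W) U h"
    and hL: "\<And>x. x \<in> carrier ?F \<Longrightarrow> h (?N +>\<^bsub>?F\<^esub> x) = L x"
    unfolding T using quotient_lift[OF F N L ker] by blast
  let ?h = "restrict h (carrier (tensor K V W))"
  have TV: "vectorspace K (tensor K V W)" by (rule vectorspace_tensor[OF assms(1,2)])
  interpret T: vectorspace K "tensor K V W" by (rule TV)
  have pc: "pure_tensor K V W v w \<in> carrier (tensor K V W)" if "v \<in> carrier V" "w \<in> carrier W" for v w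
    unfolding P T quotient_carrier using e[OF that] by blast
  show ?thesis
  proof (rule ex1I)
    show "is_tensor_lift K V W U \<beta> ?h"
      unfolding is_tensor_lift_def
    proof (intro conjI ballI)
      show "linear_map K (tensor K V W) U ?h"
        by (rule linear_mapI[OF TV assms(3)]) (simp_all add: linear_mapD[OF h])
    next
      fix v w assume "v \<in> carrier V" "w \<in> carrier W"
      then show "?h (pure_tensor K V W v w) = \<beta> v w"
        using pc by (simp add: P hL e Le)
    qed auto
  next
    fix g assume g: "is_tensor_lift K V W U \<beta> g"
    have gl: "linear_map K ?F U (\<lambda>x. g (?N +>\<^bsub>?F\<^esub> x))"
      using g linear_map_comp[OF linear_map_proj[OF F N]] by (auto simp: is_tensor_lift_def T)
    have "g (?N +>\<^bsub>?F\<^esub> x) = L x" if "x \<in> carrier ?F" for x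
    proof (rule linear_map_eq_free[OF gl L _ that])
      fix p assume "p \<in> ?X"
      then obtain v w where p: "p = (v, w)" "v \<in> carrier V" "w \<in> carrier W" by auto
      then show "g (?N +>\<^bsub>?F\<^esub> free_gen K ?X p) = L (free_gen K ?X p)"
        using g by (simp add: is_tensor_lift_def P Le)
    qed
    then have "g X = h X" if "X \<in> carrier (tensor K V W)" for X
      using that hL by (auto simp: T quotient_carrier)
    then show "g = ?h"
      using g by (auto simp: is_tensor_lift_def intro!: extensionalityI[of _ "carrier (tensor K V W)"])
  qed
qed

lemma tensor_lift:
  assumes "vectorspace K V" "vectorspace K W" "vectorspace K U" "bilinear_map K V W U \<beta>"
  shows "linear_map K (tensor K V W) U (tensor_lift K V W U \<beta>)"
    and "tensor_lift K V W U \<beta> \<in> extensional (carrier (tensor K V W))"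
    and "v \<in> carrier V \<Longrightarrow> w \<in> carrier W \<Longrightarrow>
      tensor_lift K V W U \<beta> (pure_tensor K V W v w) = \<beta> v w"
  using theI'[OF tensor_lift_ex1[OF assms]]
  by (auto simp: tensor_lift_def is_tensor_lift_def)


subsection \<open>Canonical maps\<close>

definition tensor_map ::
  "('k, 'r) ring_scheme \<Rightarrow> ('k, 'v, 'm) module_scheme \<Rightarrow> ('k, 'w, 'n) module_scheme
    \<Rightarrow> ('k, 'v', 'm') module_scheme \<Rightarrow> ('k, 'w', 'n') module_scheme
    \<Rightarrow> ('v \<Rightarrow> 'v') \<Rightarrow> ('w \<Rightarrow> 'w')
    \<Rightarrow> ('v \<times> 'w \<Rightarrow> 'k) set \<Rightarrow> ('v' \<times> 'w' \<Rightarrow> 'k) set" where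
  "tensor_map K V W V' W' f g =
     tensor_lift K V W (tensor K V' W') (\<lambda>v w. pure_tensor K V' W' (f v) (g w))"

definition twist ::
  "('k, 'r) ring_scheme \<Rightarrow> ('k, 'v, 'm) module_scheme \<Rightarrow> ('k, 'w, 'n) module_scheme
    \<Rightarrow> ('v \<times> 'w \<Rightarrow> 'k) set \<Rightarrow> ('w \<times> 'v \<Rightarrow> 'k) set" where
  "twist K V W = tensor_lift K V W (tensor K W V) (\<lambda>v w. pure_tensor K W V w v)"

text \<open>The canonical isomorphism \<open>U \<otimes> (V \<otimes> W) \<rightarrow> (U \<otimes> V) \<otimes> W\<close> and its inverse.\<close>

definition assoc_left ::
  "('k, 'r) ring_scheme \<Rightarrow> ('k, 'u, 'l) module_scheme \<Rightarrow> ('k, 'v, 'm) module_scheme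
    \<Rightarrow> ('k, 'w, 'n) module_scheme
    \<Rightarrow> ('u \<times> ('v \<times> 'w \<Rightarrow> 'k) set \<Rightarrow> 'k) set \<Rightarrow> (('u \<times> 'v \<Rightarrow> 'k) set \<times> 'w \<Rightarrow> 'k) set" where
  "assoc_left K U V W =
     tensor_lift K U (tensor K V W) (tensor K (tensor K U V) W)
       (\<lambda>u. tensor_lift K V W (tensor K (tensor K U V) W)
         (\<lambda>v w. pure_tensor K (tensor K U V) W (pure_tensor K U V u v) w))"

definition assoc_right ::
  "('k, 'r) ring_scheme \<Rightarrow> ('k, 'u, 'l) module_scheme \<Rightarrow> ('k, 'v, 'm) module_scheme
    \<Rightarrow> ('k, 'w, 'n) module_scheme
    \<Rightarrow> (('u \<times> 'v \<Rightarrow> 'k) set \<times> 'w \<Rightarrow> 'k) set \<Rightarrow> ('u \<times> ('v \<times> 'w \<Rightarrow> 'k) set \<Rightarrow> 'k) set" where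
  "assoc_right K U V W =
     tensor_lift K (tensor K U V) W (tensor K U (tensor K V W))
       (\<lambda>x w. tensor_lift K U V (tensor K U (tensor K V W))
         (\<lambda>u v. pure_tensor K U (tensor K V W) u (pure_tensor K V W v w)) x)"

text \<open>The canonical map \<open>V* \<otimes> W* \<rightarrow> (V \<otimes> W)*\<close>, \<open>\<langle>\<phi> \<otimes> \<psi>, v \<otimes> w\<rangle> = \<langle>\<phi>, v\<rangle> \<langle>\<psi>, w\<rangle>\<close>.\<close>

definition dual_tensor ::
  "('k, 'r) ring_scheme \<Rightarrow> ('k, 'v, 'm) module_scheme \<Rightarrow> ('k, 'w, 'n) module_scheme
    \<Rightarrow> (('v \<Rightarrow> 'k) \<times> ('w \<Rightarrow> 'k) \<Rightarrow> 'k) set \<Rightarrow> ('v \<times> 'w \<Rightarrow> 'k) set \<Rightarrow> 'k" where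
  "dual_tensor K V W =
     tensor_lift K (dual_space K V) (dual_space K W) (dual_space K (tensor K V W))
       (\<lambda>\<phi> \<psi>. tensor_lift K V W (field_space K) (\<lambda>v w. \<phi> v \<otimes>\<^bsub>K\<^esub> \<psi> w))"


section \<open>Quasi-triangular \<open>\<epsilon>\<close>-Hom-bialgebras\<close>

text \<open>
  \<open>A\<^sup>\<otimes>\<^sup>3\<close> is taken to be \<open>(A \<otimes> A) \<otimes> A\<close>; a map to or from \<open>A \<otimes> (A \<otimes> A)\<close> is composed with
  \<^const>\<open>assoc_left\<close> or \<^const>\<open>assoc_right\<close>.
\<close>

abbreviation tensor2 ::
  "('k, 'r) ring_scheme \<Rightarrow> ('k, 'a, 'm) module_scheme \<Rightarrow> ('k, ('a \<times> 'a \<Rightarrow> 'k) set) module" where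
  "tensor2 K A \<equiv> tensor K A A"

abbreviation tensor3 ::
  "('k, 'r) ring_scheme \<Rightarrow> ('k, 'a, 'm) module_scheme
    \<Rightarrow> ('k, (('a \<times> 'a \<Rightarrow> 'k) set \<times> 'a \<Rightarrow> 'k) set) module" where
  "tensor3 K A \<equiv> tensor K (tensor2 K A) A"

abbreviation pure2 ::
  "('k, 'r) ring_scheme \<Rightarrow> ('k, 'a, 'm) module_scheme \<Rightarrow> 'a \<Rightarrow> 'a \<Rightarrow> ('a \<times> 'a \<Rightarrow> 'k) set" where
  "pure2 K A a b \<equiv> pure_tensor K A A a b"

abbreviation pure3 ::
  "('k, 'r) ring_scheme \<Rightarrow> ('k, 'a, 'm) module_scheme \<Rightarrow> 'a \<Rightarrow> 'a \<Rightarrow> 'a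
    \<Rightarrow> (('a \<times> 'a \<Rightarrow> 'k) set \<times> 'a \<Rightarrow> 'k) set" where
  "pure3 K A a b c \<equiv> pure_tensor K (tensor2 K A) A (pure2 K A a b) c"

text \<open>
  The maps \<open>f \<otimes> g : A \<otimes> A \<rightarrow> A \<otimes> A\<close>; \<open>\<Delta> \<otimes> f\<close> and \<open>f \<otimes> \<Delta> : A \<otimes> A \<rightarrow> A\<^sup>\<otimes>\<^sup>3\<close>;
  \<open>\<mu> \<otimes> f\<close> and \<open>f \<otimes> \<mu> : A\<^sup>\<otimes>\<^sup>3 \<rightarrow> A \<otimes> A\<close>.
\<close>

definition endo_tensor2 where
  "endo_tensor2 K A f g = tensor_map K A A A A f g"

definition comul_left where
  "comul_left K A \<Delta> f = tensor_map K A A (tensor2 K A) A \<Delta> f"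

definition comul_right where
  "comul_right K A f \<Delta> = (\<lambda>x. assoc_left K A A A (tensor_map K A A A (tensor2 K A) f \<Delta> x))"

definition mul_left where
  "mul_left K A \<mu> f = tensor_map K (tensor2 K A) A A A \<mu> f"

definition mul_right where
  "mul_right K A f \<mu> = (\<lambda>x. tensor_map K A (tensor2 K A) A A f \<mu> (assoc_right K A A A x))"

locale eps_hom_bialgebra = vectorspace K A
  for K :: "('k, 'r) ring_scheme" (structure)
    and A :: "('k, 'a, 'm) module_scheme" (structure) +
  fixes \<mu> :: "('a \<times> 'a \<Rightarrow> 'k) set \<Rightarrow> 'a"
    and \<Delta> :: "'a \<Rightarrow> ('a \<times> 'a \<Rightarrow> 'k) set"
    and \<alpha> :: "'a \<Rightarrow> 'a"
  assumes mul_linear: "linear_map K (tensor2 K A) A \<mu>"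
    and comul_linear: "linear_map K A (tensor2 K A) \<Delta>"
    and alpha_linear: "linear_map K A A \<alpha>"
    and alpha_mul: "x \<in> carrier (tensor2 K A) \<Longrightarrow> \<alpha> (\<mu> x) = \<mu> (endo_tensor2 K A \<alpha> \<alpha> x)"
    and hom_assoc:
      "t \<in> carrier (tensor3 K A) \<Longrightarrow> \<mu> (mul_right K A \<alpha> \<mu> t) = \<mu> (mul_left K A \<mu> \<alpha> t)"
    and alpha_comul: "a \<in> carrier A \<Longrightarrow> endo_tensor2 K A \<alpha> \<alpha> (\<Delta> a) = \<Delta> (\<alpha> a)"
    and hom_coassoc:
      "a \<in> carrier A \<Longrightarrow> comul_right K A \<alpha> \<Delta> (\<Delta> a) = comul_left K A \<Delta> \<alpha> (\<Delta> a)"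
    and comul_mul:
      "x \<in> carrier (tensor2 K A) \<Longrightarrow>
        \<Delta> (\<mu> x) = mul_left K A \<mu> \<alpha> (comul_right K A \<alpha> \<Delta> x)
          \<oplus>\<^bsub>tensor2 K A\<^esub> mul_right K A \<alpha> \<mu> (comul_left K A \<Delta> \<alpha> x)"

text \<open>
  Expressions in \<open>r = \<Sum>\<^sub>i u\<^sub>i \<otimes> v\<^sub>i\<close> are defined by linear extension, so that they do not depend on
  the chosen presentation of \<open>r\<close>; a sum over \<open>i, j\<close> is an iterated extension, with \<open>u, v\<close> for
  the index \<open>i\<close> and \<open>u', v'\<close> for the index \<open>j\<close>.
\<close>

definition star_bracket ::
  "('k, 'r) ring_scheme \<Rightarrow> ('k, 'a, 'm) module_scheme \<Rightarrow> (('a \<times> 'a \<Rightarrow> 'k) set \<Rightarrow> 'a)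
    \<Rightarrow> ('a \<Rightarrow> 'a) \<Rightarrow> 'a \<Rightarrow> ('a \<times> 'a \<Rightarrow> 'k) set \<Rightarrow> ('a \<times> 'a \<Rightarrow> 'k) set" where
  "star_bracket K A \<mu> \<alpha> a r =
     tensor_lift K A A (tensor2 K A)
       (\<lambda>u v. pure2 K A (\<mu> (pure2 K A a u)) (\<alpha> v)
          \<ominus>\<^bsub>tensor2 K A\<^esub> pure2 K A (\<alpha> u) (\<mu> (pure2 K A v a))) r"

locale coboundary_eps_hom_bialgebra = eps_hom_bialgebra K A \<mu> \<Delta> \<alpha>
  for K :: "('k, 'r) ring_scheme" (structure)
    and A :: "('k, 'a, 'm) module_scheme" (structure)
    and \<mu> \<Delta> \<alpha> +
  fixes r :: "('a \<times> 'a \<Rightarrow> 'k) set"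
  assumes r_closed: "r \<in> carrier (tensor2 K A)"
    and alpha_r: "endo_tensor2 K A \<alpha> \<alpha> r = r"
    and comul_eq: "a \<in> carrier A \<Longrightarrow> \<Delta> a = star_bracket K A \<mu> \<alpha> a r"

definition r13_r12 ::
  "('k, 'r) ring_scheme \<Rightarrow> ('k, 'a, 'm) module_scheme \<Rightarrow> (('a \<times> 'a \<Rightarrow> 'k) set \<Rightarrow> 'a)
    \<Rightarrow> ('a \<Rightarrow> 'a) \<Rightarrow> ('a \<times> 'a \<Rightarrow> 'k) set \<Rightarrow> (('a \<times> 'a \<Rightarrow> 'k) set \<times> 'a \<Rightarrow> 'k) set" where
  "r13_r12 K A \<mu> \<alpha> r =
     tensor_lift K A A (tensor3 K A) (\<lambda>u v.
       tensor_lift K A A (tensor3 K A) (\<lambda>u' v'.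
         pure3 K A (\<mu> (pure2 K A u u')) (\<alpha> v') (\<alpha> v)) r) r"

definition r12_r23 ::
  "('k, 'r) ring_scheme \<Rightarrow> ('k, 'a, 'm) module_scheme \<Rightarrow> (('a \<times> 'a \<Rightarrow> 'k) set \<Rightarrow> 'a)
    \<Rightarrow> ('a \<Rightarrow> 'a) \<Rightarrow> ('a \<times> 'a \<Rightarrow> 'k) set \<Rightarrow> (('a \<times> 'a \<Rightarrow> 'k) set \<times> 'a \<Rightarrow> 'k) set" where
  "r12_r23 K A \<mu> \<alpha> r =
     tensor_lift K A A (tensor3 K A) (\<lambda>u v.
       tensor_lift K A A (tensor3 K A) (\<lambda>u' v'.
         pure3 K A (\<alpha> u) (\<mu> (pure2 K A v u')) (\<alpha> v')) r) r"

definition r23_r13 ::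
  "('k, 'r) ring_scheme \<Rightarrow> ('k, 'a, 'm) module_scheme \<Rightarrow> (('a \<times> 'a \<Rightarrow> 'k) set \<Rightarrow> 'a)
    \<Rightarrow> ('a \<Rightarrow> 'a) \<Rightarrow> ('a \<times> 'a \<Rightarrow> 'k) set \<Rightarrow> (('a \<times> 'a \<Rightarrow> 'k) set \<times> 'a \<Rightarrow> 'k) set" where
  "r23_r13 K A \<mu> \<alpha> r =
     tensor_lift K A A (tensor3 K A) (\<lambda>u v.
       tensor_lift K A A (tensor3 K A) (\<lambda>u' v'.
         pure3 K A (\<alpha> u') (\<alpha> u) (\<mu> (pure2 K A v v'))) r) r"

text \<open>The element \<open>A(r)\<close>.\<close>

definition yang_baxter ::
  "('k, 'r) ring_scheme \<Rightarrow> ('k, 'a, 'm) module_scheme \<Rightarrow> (('a \<times> 'a \<Rightarrow> 'k) set \<Rightarrow> 'a)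
    \<Rightarrow> ('a \<Rightarrow> 'a) \<Rightarrow> ('a \<times> 'a \<Rightarrow> 'k) set \<Rightarrow> (('a \<times> 'a \<Rightarrow> 'k) set \<times> 'a \<Rightarrow> 'k) set" where
  "yang_baxter K A \<mu> \<alpha> r =
     (r13_r12 K A \<mu> \<alpha> r \<ominus>\<^bsub>tensor3 K A\<^esub> r12_r23 K A \<mu> \<alpha> r) \<oplus>\<^bsub>tensor3 K A\<^esub> r23_r13 K A \<mu> \<alpha> r"

locale quasi_triangular_eps_hom_bialgebra = coboundary_eps_hom_bialgebra K A \<mu> \<Delta> \<alpha> r
  for K :: "('k, 'r) ring_scheme" (structure)
    and A :: "('k, 'a, 'm) module_scheme" (structure)
    and \<mu> \<Delta> \<alpha> r +
  assumes yang_baxter_zero: "yang_baxter K A \<mu> \<alpha> r = \<zero>\<^bsub>tensor3 K A\<^esub>"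


section \<open>Dual maps\<close>

definition mul_op ::
  "('k, 'r) ring_scheme \<Rightarrow> ('k, 'a, 'm) module_scheme \<Rightarrow> (('a \<times> 'a \<Rightarrow> 'k) set \<Rightarrow> 'a)
    \<Rightarrow> ('a \<times> 'a \<Rightarrow> 'k) set \<Rightarrow> 'a" where
  "mul_op K A \<mu> = (\<lambda>x. \<mu> (twist K A A x))"

definition comul_dual ::
  "('k, 'r) ring_scheme \<Rightarrow> ('k, 'a, 'm) module_scheme \<Rightarrow> ('a \<Rightarrow> ('a \<times> 'a \<Rightarrow> 'k) set)
    \<Rightarrow> (('a \<Rightarrow> 'k) \<times> ('a \<Rightarrow> 'k) \<Rightarrow> 'k) set \<Rightarrow> 'a \<Rightarrow> 'k" where
  "comul_dual K A \<Delta> x = (\<lambda>a\<in>carrier A. dual_tensor K A A x (\<Delta> a))"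

text \<open>
  For finite-dimensional \<open>A\<close> the map \<^const>\<open>dual_tensor\<close> is an isomorphism, and \<open>\<mu>*(\<phi>)\<close> is the
  preimage of \<open>\<phi> \<circ> \<mu>\<close>.
\<close>

definition mul_dual ::
  "('k, 'r) ring_scheme \<Rightarrow> ('k, 'a, 'm) module_scheme \<Rightarrow> (('a \<times> 'a \<Rightarrow> 'k) set \<Rightarrow> 'a)
    \<Rightarrow> ('a \<Rightarrow> 'k) \<Rightarrow> (('a \<Rightarrow> 'k) \<times> ('a \<Rightarrow> 'k) \<Rightarrow> 'k) set" where
  "mul_dual K A \<mu> \<phi> =
     (THE t. t \<in> carrier (tensor2 K (dual_space K A)) \<and>
        dual_tensor K A A t = (\<lambda>x\<in>carrier (tensor2 K A). \<phi> (\<mu> x)))"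

definition mul_dual_op ::
  "('k, 'r) ring_scheme \<Rightarrow> ('k, 'a, 'm) module_scheme \<Rightarrow> (('a \<times> 'a \<Rightarrow> 'k) set \<Rightarrow> 'a)
    \<Rightarrow> ('a \<Rightarrow> 'k) \<Rightarrow> (('a \<Rightarrow> 'k) \<times> ('a \<Rightarrow> 'k) \<Rightarrow> 'k) set" where
  "mul_dual_op K A \<mu> = (\<lambda>\<phi>. twist K (dual_space K A) (dual_space K A) (mul_dual K A \<mu> \<phi>))"

definition lambda1 ::
  "('k, 'r) ring_scheme \<Rightarrow> ('k, 'a, 'm) module_scheme \<Rightarrow> ('a \<Rightarrow> 'a) \<Rightarrow> ('a \<times> 'a \<Rightarrow> 'k) set
    \<Rightarrow> ('a \<Rightarrow> 'k) \<Rightarrow> 'a" where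
  "lambda1 K A \<alpha> r \<phi> = tensor_lift K A A A (\<lambda>u v. \<phi> (\<alpha> u) \<odot>\<^bsub>A\<^esub> v) r"

definition lambda2 ::
  "('k, 'r) ring_scheme \<Rightarrow> ('k, 'a, 'm) module_scheme \<Rightarrow> ('a \<Rightarrow> 'a) \<Rightarrow> ('a \<times> 'a \<Rightarrow> 'k) set
    \<Rightarrow> ('a \<Rightarrow> 'k) \<Rightarrow> 'a" where
  "lambda2 K A \<alpha> r \<phi> = tensor_lift K A A A (\<lambda>u v. \<phi> u \<odot>\<^bsub>A\<^esub> \<alpha> v) r"

definition rho1 ::
  "('k, 'r) ring_scheme \<Rightarrow> ('k, 'a, 'm) module_scheme \<Rightarrow> ('a \<Rightarrow> 'a) \<Rightarrow> ('a \<times> 'a \<Rightarrow> 'k) set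
    \<Rightarrow> ('a \<Rightarrow> 'k) \<Rightarrow> 'a" where
  "rho1 K A \<alpha> r \<phi> = tensor_lift K A A A (\<lambda>u v. \<phi> (\<alpha> v) \<odot>\<^bsub>A\<^esub> u) r"

definition rho2 ::
  "('k, 'r) ring_scheme \<Rightarrow> ('k, 'a, 'm) module_scheme \<Rightarrow> ('a \<Rightarrow> 'a) \<Rightarrow> ('a \<times> 'a \<Rightarrow> 'k) set
    \<Rightarrow> ('a \<Rightarrow> 'k) \<Rightarrow> 'a" where
  "rho2 K A \<alpha> r \<phi> = tensor_lift K A A A (\<lambda>u v. \<phi> v \<odot>\<^bsub>A\<^esub> \<alpha> u) r"

text \<open>The map \<open>f \<otimes> f : A* \<otimes> A* \<rightarrow> A \<otimes> A\<close>.\<close>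

definition dual_map2 ::
  "('k, 'r) ring_scheme \<Rightarrow> ('k, 'a, 'm) module_scheme \<Rightarrow> (('a \<Rightarrow> 'k) \<Rightarrow> 'a)
    \<Rightarrow> (('a \<Rightarrow> 'k) \<times> ('a \<Rightarrow> 'k) \<Rightarrow> 'k) set \<Rightarrow> ('a \<times> 'a \<Rightarrow> 'k) set" where
  "dual_map2 K A f = tensor_map K (dual_space K A) (dual_space K A) A A f f"

end

(*
  Writing r as a finite sum of pure tensors, the coboundary formula for Delta gives
  (alpha (x) Delta)(r) = r12 r23 - r23 r13 and (Delta (x) alpha)(r) = r13 r12 - r12 r23, which
  settles (2) and (3).  Elements of A (x) A (x) A are separated by the product functionals
  phi (x) psi (x) chi, also in infinite dimension (by Zorn's lemma).  Evaluated at functionals,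
  (4) and (7) become the identity (3) tested against product functionals, and (5) and (6) become
  (2) tested in the same way.  For (6) and (7), a basis of A with its dual basis shows that mu* is
  well defined.
*)
theory Submission
  imports Defs
begin

section \<open>Finite sums and linear maps\<close>

text \<open>The obstacle is infinite dimension: product functionals must separate tensors although
  no dual basis is available. A tensor has only finitely many left factors, so a finite-rank
  operator that fixes those is enough. It splits the tensor into vectors b j tensored with slices,
  and vanishing slices force the tensor to vanish. In finite dimension the same operator, built for
  a spanning set, also inverts the map from the tensor product of the duals to the dual of the
  tensor product. The leg of r that receives \<Delta> decides which form an equation takes. All four
  maps send \<phi> to a sum of terms \<phi> (p i) q i. Precomposing with the dual of \<Delta>
  applies \<Delta> to the legs p i, and composing with \<Delta> afterwards applies it to the legs q
  i. These are the legs u i for \<open>lambda2\<close> and \<open>rho1\<close>, hence (\<Delta>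
  \<otimes> \<alpha>)(r), and the legs v i for \<open>rho2\<close> and \<open>lambda1\<close>, hence
  (\<alpha> \<otimes> \<Delta>)(r).\<close>

lemma (in abelian_monoid) finsum_swap:
  assumes "finite I" "finite J" "\<And>i j. i \<in> I \<Longrightarrow> j \<in> J \<Longrightarrow> f i j \<in> carrier G"
  shows "(\<Oplus>i\<in>I. \<Oplus>j\<in>J. f i j) = (\<Oplus>j\<in>J. \<Oplus>i\<in>I. f i j)"
  using assms(1,3)
proof (induction I rule: finite_induct)
  case (insert i I)
  have "(\<Oplus>i\<in>insert i I. \<Oplus>j\<in>J. f i j) = (\<Oplus>j\<in>J. f i j) \<oplus> (\<Oplus>i\<in>I. \<Oplus>j\<in>J. f i j)"
    using insert by (intro finsum_insert) auto
  also have "\<dots> = (\<Oplus>j\<in>J. f i j) \<oplus> (\<Oplus>j\<in>J. \<Oplus>i\<in>I. f i j)" using insert by simp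
  also have "\<dots> = (\<Oplus>j\<in>J. f i j \<oplus> (\<Oplus>i\<in>I. f i j))"
    using insert by (intro finsum_addf[symmetric]) (auto intro!: finsum_closed)
  also have "\<dots> = (\<Oplus>j\<in>J. \<Oplus>i\<in>insert i I. f i j)"
    using insert by (intro finsum_cong') (auto intro!: finsum_closed)
  finally show ?case .
qed simp

lemma (in abelian_group) a_inv_zero [simp]: "\<ominus> \<zero> = \<zero>"
  by (simp add: a_inv_def)

lemma linear_map_finsum:
  assumes "linear_map K V W f" "\<And>i. i \<in> I \<Longrightarrow> g i \<in> carrier V"
  shows "f (\<Oplus>\<^bsub>V\<^esub>i\<in>I. g i) = (\<Oplus>\<^bsub>W\<^esub>i\<in>I. f (g i))"
  using assms(2)
proof (induction I rule: infinite_finite_induct)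
  case (insert i I)
  interpret linear_map K V W f by fact
  show ?case using insert by (simp add: linear_mapD[OF assms(1)] Pi_def)
next
  \<comment> \<open>Over an infinite index set both sums are zero by convention, and f sends zero to
    zero.\<close>
  case (infinite A)
  interpret linear_map K V W f by fact
  show ?case using infinite by simp
next
  case empty
  interpret linear_map K V W f by fact
  show ?case by simp
qed

lemma linear_map_minus:
  assumes "linear_map K V W f" "x \<in> carrier V" "y \<in> carrier V"
  shows "f (x \<ominus>\<^bsub>V\<^esub> y) = f x \<ominus>\<^bsub>W\<^esub> f y"
proof -
  interpret linear_map K V W f by fact
  show ?thesis using assms by simp
qed

lemma linear_map_uminus:
  assumes "linear_map K V W f" "x \<in> carrier V"
  shows "f (\<ominus>\<^bsub>V\<^esub> x) = \<ominus>\<^bsub>W\<^esub> f x"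
proof -
  interpret linear_map K V W f by fact
  show ?thesis using assms by simp
qed

lemma linear_map_zero:
  assumes "linear_map K V W f"
  shows "f \<zero>\<^bsub>V\<^esub> = \<zero>\<^bsub>W\<^esub>"
proof -
  interpret linear_map K V W f by fact
  show ?thesis by simp
qed

section \<open>Linear functionals\<close>

lemma field_space_simps [simp]:
  "carrier (field_space K) = carrier K" "add (field_space K) = add K"
  "zero (field_space K) = zero K" "smult (field_space K) = mult K"
  by (auto simp: field_space_def)

text \<open>Functionals are extensional, so agreement on the carrier is equality. That their values
  lie in K is already part of linearity into \<open>field_space K\<close>.\<close>

lemma dual_space_iff:
  "\<phi> \<in> carrier (dual_space K V) \<longleftrightarrow>
    linear_map K V (field_space K) \<phi> \<and> \<phi> \<in> extensional (carrier V)"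
  using linear_mapD(1)[of K V "field_space K" \<phi>] by (auto simp: dual_space_def PiE_def)

text \<open>Linearity constrains a map only on the carrier of its domain, so a map and its
  restriction may be exchanged.\<close>

lemma linear_map_cong:
  assumes "linear_map K V W f" "\<And>x. x \<in> carrier V \<Longrightarrow> f x = g x"
  shows "linear_map K V W g"
proof -
  interpret linear_map K V W f by fact
  have vs: "vectorspace K V" "vectorspace K W" ..
  show ?thesis
    using linear_mapD[OF assms(1)] by (intro linear_mapI vs) (auto simp: assms(2)[symmetric])
qed

lemma restrict_in_dual_space:
  "linear_map K V (field_space K) f \<Longrightarrow> (\<lambda>x\<in>carrier V. f x) \<in> carrier (dual_space K V)"
  by (auto simp: dual_space_iff elim: linear_map_cong)

lemma dual_space_add:
  assumes "vectorspace K V" "v \<in> carrier V"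
  shows "(\<phi> \<oplus>\<^bsub>dual_space K V\<^esub> \<psi>) v = \<phi> v \<oplus>\<^bsub>K\<^esub> \<psi> v"
proof -
  interpret V: vectorspace K V by fact
  show ?thesis using assms(2) by (simp add: dual_space_def V.func_space_def)
qed

lemma dual_space_smult:
  assumes "vectorspace K V" "v \<in> carrier V"
  shows "(c \<odot>\<^bsub>dual_space K V\<^esub> \<phi>) v = c \<otimes>\<^bsub>K\<^esub> \<phi> v"
proof -
  interpret V: vectorspace K V by fact
  show ?thesis using assms(2) by (simp add: dual_space_def V.func_space_def)
qed

text \<open>Zorn's lemma gives a submodule M that contains N and is maximal among those avoiding v.
  Every x is then m + c v with m in M for exactly one c, and this c is \<phi> x. The hyperplane M
  takes the place of an extension to a basis.\<close>

lemma exists_functional: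
  assumes V: "vectorspace K V" and N: "submodule K N V"
    and v: "v \<in> carrier V" "v \<notin> N"
  obtains \<phi> where "\<phi> \<in> carrier (dual_space K V)" "\<phi> v = \<one>\<^bsub>K\<^esub>" "\<And>x. x \<in> N \<Longrightarrow> \<phi> x = \<zero>\<^bsub>K\<^esub>"
proof -
  interpret V: vectorspace K V by fact
  define S where "S = {M. submodule K M V \<and> N \<subseteq> M \<and> v \<notin> M}"
  have "\<exists>M\<in>S. \<forall>X\<in>S. M \<subseteq> X \<longrightarrow> X = M"
  proof (rule subset_Zorn_nonempty)
    show "S \<noteq> {}" using N v by (auto simp: S_def)
  next
    fix C assume C: "C \<noteq> {}" "subset.chain S C"
    have "submodule K (\<Union>C) V"
    proof (rule V.nested_union_vs[of C "\<lambda>x. x"])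
      fix i j assume "i \<in> C" "j \<in> C"
      then have "i \<subseteq> j \<or> j \<subseteq> i" using C(2) by (auto simp: subset_chain_def)
      then show "\<exists>k. k \<in> C \<and> i \<subseteq> k \<and> j \<subseteq> k" using \<open>i \<in> C\<close> \<open>j \<in> C\<close> by blast
    qed (use C in \<open>auto simp: S_def subset_chain_def\<close>)
    then show "\<Union>C \<in> S" using C by (fastforce simp: S_def subset_chain_def)
  qed
  then obtain M where M: "submodule K M V" "N \<subseteq> M" "v \<notin> M"
    and max: "\<And>X. X \<in> S \<Longrightarrow> M \<subseteq> X \<Longrightarrow> X = M" by (auto simp: S_def)
  interpret M: submodule K M V by (rule M(1))
  have Mc: "m \<in> carrier V" if "m \<in> M" for m using that M.subset by auto
  have Mneg: "\<ominus>\<^bsub>V\<^esub> m \<in> M" if "m \<in> M" for m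
    using M.smult_closed[of "\<ominus>\<^bsub>K\<^esub> \<one>\<^bsub>K\<^esub>" m] that Mc by (simp add: V.smult_minus_1)
  \<comment> \<open>Two distinct admissible scalars would put (c - d) v into M. As c - d is
    invertible, v itself would lie in M.\<close>
  have uniq: "c = d" if c: "c \<in> carrier K" "d \<in> carrier K" and x: "x \<in> carrier V"
    "x \<ominus>\<^bsub>V\<^esub> c \<odot>\<^bsub>V\<^esub> v \<in> M" "x \<ominus>\<^bsub>V\<^esub> d \<odot>\<^bsub>V\<^esub> v \<in> M" for x c d
  proof (rule ccontr)
    assume "c \<noteq> d"
    have "(x \<ominus>\<^bsub>V\<^esub> d \<odot>\<^bsub>V\<^esub> v) \<oplus>\<^bsub>V\<^esub> \<ominus>\<^bsub>V\<^esub> (x \<ominus>\<^bsub>V\<^esub> c \<odot>\<^bsub>V\<^esub> v) \<in> M"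
      using x by (intro M.m_closed Mneg)
    also have "(x \<ominus>\<^bsub>V\<^esub> d \<odot>\<^bsub>V\<^esub> v) \<oplus>\<^bsub>V\<^esub> \<ominus>\<^bsub>V\<^esub> (x \<ominus>\<^bsub>V\<^esub> c \<odot>\<^bsub>V\<^esub> v)
        = c \<odot>\<^bsub>V\<^esub> v \<ominus>\<^bsub>V\<^esub> d \<odot>\<^bsub>V\<^esub> v"
      using c x(1) v(1)
      by (simp add: V.M.minus_eq V.M.minus_add V.M.a_assoc V.M.a_lcomm V.M.r_neg1 V.M.r_neg2 V.M.a_comm)
    also have "\<dots> = (c \<ominus>\<^bsub>K\<^esub> d) \<odot>\<^bsub>V\<^esub> v"
      using c v(1) by (simp add: V.R.minus_eq V.M.minus_eq V.smult_l_distr V.smult_l_minus)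
    finally have "inv\<^bsub>K\<^esub> (c \<ominus>\<^bsub>K\<^esub> d) \<odot>\<^bsub>V\<^esub> ((c \<ominus>\<^bsub>K\<^esub> d) \<odot>\<^bsub>V\<^esub> v) \<in> M"
      using c \<open>c \<noteq> d\<close> by (intro M.smult_closed[of _ "(c \<ominus>\<^bsub>K\<^esub> d) \<odot>\<^bsub>V\<^esub> v"]) (auto simp: V.field_Units)
    moreover have "c \<ominus>\<^bsub>K\<^esub> d \<noteq> \<zero>\<^bsub>K\<^esub>" using c \<open>c \<noteq> d\<close> by simp
    ultimately have "v \<in> M" using c v(1)
      by (simp add: V.smult_assoc1[symmetric] V.field_Units)
    then show False using M(3) by simp
  qed
  have ex: "\<exists>c\<in>carrier K. x \<ominus>\<^bsub>V\<^esub> c \<odot>\<^bsub>V\<^esub> v \<in> M" if x: "x \<in> carrier V" for x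
  proof (cases "x \<in> M")
    case True
    then have "x \<ominus>\<^bsub>V\<^esub> \<zero>\<^bsub>K\<^esub> \<odot>\<^bsub>V\<^esub> v \<in> M" using x v(1) by (simp add: V.M.minus_eq)
    then show ?thesis by blast
  next
    case False
    \<comment> \<open>M' = M + K x properly contains M, so by maximality it contains v. From v = m +
      c x one solves for x. The scalar c is nonzero, because c = 0 would put v = m into M.\<close>
    define M' where "M' = {m \<oplus>\<^bsub>V\<^esub> c \<odot>\<^bsub>V\<^esub> x | m c. m \<in> M \<and> c \<in> carrier K}"
    have in_M': "m \<oplus>\<^bsub>V\<^esub> c \<odot>\<^bsub>V\<^esub> x \<in> M'" if "m \<in> M" "c \<in> carrier K" for m c
      using that by (auto simp: M'_def)
    have sub: "M \<subseteq> M'"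
    proof
      fix m assume "m \<in> M"
      then show "m \<in> M'" using in_M'[of m "\<zero>\<^bsub>K\<^esub>"] x Mc by simp
    qed
    have "x \<in> M'" using in_M'[of "\<zero>\<^bsub>V\<^esub>" "\<one>\<^bsub>K\<^esub>"] x by simp
    then have "M' \<noteq> M" using False by auto
    have "submodule K M' V"
    proof (unfold submodule_def, intro conjI allI impI)
      show "module K V" ..
      show "M' \<subseteq> carrier V" using x Mc by (auto simp: M'_def)
      show "\<zero>\<^bsub>V\<^esub> \<in> M'" using sub by auto
    next
      fix a b assume "a \<in> M'" "b \<in> M'"
      then obtain m c m' c' where *: "m \<in> M" "c \<in> carrier K" "a = m \<oplus>\<^bsub>V\<^esub> c \<odot>\<^bsub>V\<^esub> x"
        "m' \<in> M" "c' \<in> carrier K" "b = m' \<oplus>\<^bsub>V\<^esub> c' \<odot>\<^bsub>V\<^esub> x" by (auto simp: M'_def)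
      then have "a \<oplus>\<^bsub>V\<^esub> b = (m \<oplus>\<^bsub>V\<^esub> m') \<oplus>\<^bsub>V\<^esub> (c \<oplus>\<^bsub>K\<^esub> c') \<odot>\<^bsub>V\<^esub> x"
        using x Mc by (simp add: V.smult_l_distr V.M.a_ac)
      then show "a \<oplus>\<^bsub>V\<^esub> b \<in> M'" using * by (simp add: in_M')
    next
      fix d a assume "d \<in> carrier K" "a \<in> M'"
      then obtain m c where *: "m \<in> M" "c \<in> carrier K" "a = m \<oplus>\<^bsub>V\<^esub> c \<odot>\<^bsub>V\<^esub> x"
        by (auto simp: M'_def)
      then have "d \<odot>\<^bsub>V\<^esub> a = d \<odot>\<^bsub>V\<^esub> m \<oplus>\<^bsub>V\<^esub> (d \<otimes>\<^bsub>K\<^esub> c) \<odot>\<^bsub>V\<^esub> x"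
        using x Mc \<open>d \<in> carrier K\<close> by (simp add: V.smult_r_distr V.smult_assoc1)
      then show "d \<odot>\<^bsub>V\<^esub> a \<in> M'" using * \<open>d \<in> carrier K\<close> by (simp add: in_M')
    qed
    then have "v \<in> M'" using max[of M'] sub \<open>M' \<noteq> M\<close> M(2) by (auto simp: S_def)
    then obtain m c where c: "m \<in> M" "c \<in> carrier K" "v = m \<oplus>\<^bsub>V\<^esub> c \<odot>\<^bsub>V\<^esub> x"
      by (auto simp: M'_def)
    then have c0: "c \<noteq> \<zero>\<^bsub>K\<^esub>" using M(3) x Mc by auto
    define d where "d = inv\<^bsub>K\<^esub> c"
    have d: "d \<in> carrier K" "d \<otimes>\<^bsub>K\<^esub> c = \<one>\<^bsub>K\<^esub>" using c(2) c0 by (auto simp: d_def V.field_Units)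
    have "d \<odot>\<^bsub>V\<^esub> v = d \<odot>\<^bsub>V\<^esub> m \<oplus>\<^bsub>V\<^esub> x"
      unfolding c(3) using c d x Mc by (simp add: V.smult_r_distr V.smult_assoc1[symmetric])
    then have "x \<ominus>\<^bsub>V\<^esub> d \<odot>\<^bsub>V\<^esub> v = \<ominus>\<^bsub>V\<^esub> (d \<odot>\<^bsub>V\<^esub> m)"
      using x c(1) d Mc by (simp add: V.M.minus_eq V.M.minus_add V.M.r_neg2 V.M.a_comm[of "\<ominus>\<^bsub>V\<^esub> (d \<odot>\<^bsub>V\<^esub> m)"])
    then have "x \<ominus>\<^bsub>V\<^esub> d \<odot>\<^bsub>V\<^esub> v \<in> M" using c d by (simp add: Mneg)
    then show ?thesis using d by blast
  qed
  define \<phi> where "\<phi> x = (THE c. c \<in> carrier K \<and> x \<ominus>\<^bsub>V\<^esub> c \<odot>\<^bsub>V\<^esub> v \<in> M)" for x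
  have \<phi>: "\<phi> x \<in> carrier K" "x \<ominus>\<^bsub>V\<^esub> \<phi> x \<odot>\<^bsub>V\<^esub> v \<in> M" if x: "x \<in> carrier V" for x
  proof -
    have "\<exists>!c. c \<in> carrier K \<and> x \<ominus>\<^bsub>V\<^esub> c \<odot>\<^bsub>V\<^esub> v \<in> M" using ex[OF x] uniq[OF _ _ x] by blast
    from theI'[OF this] show "\<phi> x \<in> carrier K" "x \<ominus>\<^bsub>V\<^esub> \<phi> x \<odot>\<^bsub>V\<^esub> v \<in> M" by (simp_all add: \<phi>_def)
  qed
  have \<phi>_eqI: "\<phi> x = c" if "x \<in> carrier V" "c \<in> carrier K" "x \<ominus>\<^bsub>V\<^esub> c \<odot>\<^bsub>V\<^esub> v \<in> M" for x c
    using uniq[OF \<phi>(1)[OF that(1)] that(2) that(1) \<phi>(2)[OF that(1)] that(3)] .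
  have lin: "linear_map K V (field_space K) \<phi>"
  proof (rule linear_mapI[OF V vectorspace_field_space[OF V.field_axioms]])
    fix x y assume xy: "x \<in> carrier V" "y \<in> carrier V"
    have "(x \<oplus>\<^bsub>V\<^esub> y) \<ominus>\<^bsub>V\<^esub> (\<phi> x \<oplus>\<^bsub>K\<^esub> \<phi> y) \<odot>\<^bsub>V\<^esub> v
      = (x \<ominus>\<^bsub>V\<^esub> \<phi> x \<odot>\<^bsub>V\<^esub> v) \<oplus>\<^bsub>V\<^esub> (y \<ominus>\<^bsub>V\<^esub> \<phi> y \<odot>\<^bsub>V\<^esub> v)"
      using xy v(1) \<phi>(1)[of x] \<phi>(1)[of y]
      by (simp add: V.M.minus_eq V.smult_l_distr V.M.minus_add V.M.a_ac)
    then have "(x \<oplus>\<^bsub>V\<^esub> y) \<ominus>\<^bsub>V\<^esub> (\<phi> x \<oplus>\<^bsub>K\<^esub> \<phi> y) \<odot>\<^bsub>V\<^esub> v \<in> M"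
      using \<phi>[OF xy(1)] \<phi>[OF xy(2)] M.m_closed by auto
    then show "\<phi> (x \<oplus>\<^bsub>V\<^esub> y) = \<phi> x \<oplus>\<^bsub>field_space K\<^esub> \<phi> y"
      using xy \<phi>(1) by (simp add: \<phi>_eqI)
  next
    fix c x assume c: "c \<in> carrier K" "x \<in> carrier V"
    have "c \<odot>\<^bsub>V\<^esub> x \<ominus>\<^bsub>V\<^esub> (c \<otimes>\<^bsub>K\<^esub> \<phi> x) \<odot>\<^bsub>V\<^esub> v = c \<odot>\<^bsub>V\<^esub> (x \<ominus>\<^bsub>V\<^esub> \<phi> x \<odot>\<^bsub>V\<^esub> v)"
      using c v(1) \<phi>(1)[of x]
      by (simp add: V.M.minus_eq V.smult_r_distr V.smult_r_minus V.smult_assoc1)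
    then have "c \<odot>\<^bsub>V\<^esub> x \<ominus>\<^bsub>V\<^esub> (c \<otimes>\<^bsub>K\<^esub> \<phi> x) \<odot>\<^bsub>V\<^esub> v \<in> M" using \<phi>[OF c(2)] c by simp
    then show "\<phi> (c \<odot>\<^bsub>V\<^esub> x) = c \<odot>\<^bsub>field_space K\<^esub> \<phi> x" using c \<phi>(1) by (simp add: \<phi>_eqI)
  qed (simp add: \<phi>(1))
  have "\<phi> v = \<one>\<^bsub>K\<^esub>" using v by (intro \<phi>_eqI) (auto simp: V.M.minus_eq V.M.r_neg)
  moreover have "\<phi> x = \<zero>\<^bsub>K\<^esub>" if "x \<in> N" for x
    using that M Mc[of x] v by (intro \<phi>_eqI) (auto simp: V.M.minus_eq)
  ultimately show thesis
    using that[OF restrict_in_dual_space[OF lin]] v M(2) Mc by (auto simp: subset_iff)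
qed

section \<open>Constructions that preserve linearity, used as introduction rules\<close>

lemma linear_map_id: "vectorspace K V \<Longrightarrow> linear_map K V V (\<lambda>x. x)"
  by (rule linear_mapI) auto

lemma linear_map_add:
  assumes f: "linear_map K V W f" and g: "linear_map K V W g"
  shows "linear_map K V W (\<lambda>x. f x \<oplus>\<^bsub>W\<^esub> g x)"
proof -
  note vs = linear_map.axioms(1,2)[OF f]
  interpret W: vectorspace K W by (rule vs)
  show ?thesis
    by (intro linear_mapI vs)
      (simp_all add: linear_mapD[OF f] linear_mapD[OF g] W.M.a_ac W.smult_r_distr)
qed

lemma linear_map_smult_const:
  assumes f: "linear_map K V W f" and c: "c \<in> carrier K"
  shows "linear_map K V W (\<lambda>x. c \<odot>\<^bsub>W\<^esub> f x)"
proof -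
  note vs = linear_map.axioms(1,2)[OF f]
  interpret W: vectorspace K W by (rule vs)
  show ?thesis using c
    by (intro linear_mapI vs)
      (simp_all add: linear_mapD[OF f] W.smult_r_distr W.smult_assoc1[symmetric] W.R.m_comm)
qed

lemma linear_map_neg:
  assumes f: "linear_map K V W f"
  shows "linear_map K V W (\<lambda>x. \<ominus>\<^bsub>W\<^esub> f x)"
proof -
  interpret W: vectorspace K W by (rule linear_map.axioms(2)[OF f])
  show ?thesis
    by (rule linear_map_cong[OF linear_map_smult_const[OF f, of "\<ominus>\<^bsub>K\<^esub> \<one>\<^bsub>K\<^esub>"]])
      (simp_all add: W.smult_minus_1 linear_mapD[OF f])
qed

lemma linear_map_diff:
  assumes f: "linear_map K V W f" and g: "linear_map K V W g"
  shows "linear_map K V W (\<lambda>x. f x \<ominus>\<^bsub>W\<^esub> g x)"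
  unfolding a_minus_def by (rule linear_map_add[OF f linear_map_neg[OF g]])

lemma linear_map_smult_left:
  assumes f: "linear_map K V (field_space K) f" and W: "vectorspace K W" and a: "a \<in> carrier W"
  shows "linear_map K V W (\<lambda>x. f x \<odot>\<^bsub>W\<^esub> a)"
proof -
  note vs = linear_map.axioms(1)[OF f]
  interpret W: vectorspace K W by fact
  show ?thesis using a
    using linear_mapD[OF f]
    by (intro linear_mapI vs W.vectorspace_axioms)
      (auto simp: W.smult_l_distr W.smult_assoc1)
qed

lemma linear_map_mult_const:
  assumes f: "linear_map K V (field_space K) f" and c: "c \<in> carrier K"
  shows "linear_map K V (field_space K) (\<lambda>x. c \<otimes>\<^bsub>K\<^esub> f x)"
  using linear_map_smult_const[OF f c] by simp

lemma linear_map_mult_left: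
  assumes f: "linear_map K V (field_space K) f" and c: "c \<in> carrier K"
  shows "linear_map K V (field_space K) (\<lambda>x. f x \<otimes>\<^bsub>K\<^esub> c)"
proof -
  have "vectorspace K (field_space K)" by (rule linear_map.axioms(2)[OF f])
  then show ?thesis using linear_map_smult_left[OF f, of "field_space K" c] c by simp
qed

lemma linear_map_zero_fun:
  assumes "vectorspace K V" "vectorspace K W"
  shows "linear_map K V W (\<lambda>x. \<zero>\<^bsub>W\<^esub>)"
proof -
  interpret W: vectorspace K W by fact
  show ?thesis by (intro linear_mapI assms) simp_all
qed

lemma linear_map_sum:
  assumes "vectorspace K V" "vectorspace K W" "finite I"
    "\<And>i. i \<in> I \<Longrightarrow> linear_map K V W (f i)"
  shows "linear_map K V W (\<lambda>x. \<Oplus>\<^bsub>W\<^esub>i\<in>I. f i x)"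
  using assms(3,4)
proof (induction I rule: finite_induct)
  case empty
  interpret W: vectorspace K W by fact
  show ?case using linear_map_zero_fun[OF assms(1,2)] by simp
next
  case (insert i I)
  interpret W: vectorspace K W by fact
  have "linear_map K V W (\<lambda>x. f i x \<oplus>\<^bsub>W\<^esub> (\<Oplus>\<^bsub>W\<^esub>i\<in>I. f i x))"
    using insert by (intro linear_map_add) auto
  then show ?case
  proof (rule linear_map_cong)
    fix x assume "x \<in> carrier V"
    then show "f i x \<oplus>\<^bsub>W\<^esub> (\<Oplus>\<^bsub>W\<^esub>i\<in>I. f i x) = (\<Oplus>\<^bsub>W\<^esub>i\<in>insert i I. f i x)"
      using insert linear_mapD(1)[of K V W "f _" x]
      by (intro W.M.finsum_insert[symmetric]) auto
  qed
qed

text \<open>The operations of the dual space are pointwise and its elements are extensional, so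
  linearity of a map into it can be checked after evaluation at each v.\<close>

lemma linear_map_dualI:
  assumes "vectorspace K X" "vectorspace K V"
    and "\<And>x. x \<in> carrier X \<Longrightarrow> f x \<in> carrier (dual_space K V)"
    and "\<And>v. v \<in> carrier V \<Longrightarrow> linear_map K X (field_space K) (\<lambda>x. f x v)"
  shows "linear_map K X (dual_space K V) f"
proof (rule linear_mapI[OF assms(1) vectorspace_dual_space[OF assms(2)] assms(3)])
  interpret X: vectorspace K X by fact
  interpret D: vectorspace K "dual_space K V" by (rule vectorspace_dual_space[OF assms(2)])
  have ext: "a = b" if "a \<in> carrier (dual_space K V)" "b \<in> carrier (dual_space K V)"
    "\<And>v. v \<in> carrier V \<Longrightarrow> a v = b v" for a b
    using that by (auto simp: dual_space_iff intro: extensionalityI[of _ "carrier V"])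
  { fix x y assume xy: "x \<in> carrier X" "y \<in> carrier X"
    show "f (x \<oplus>\<^bsub>X\<^esub> y) = f x \<oplus>\<^bsub>dual_space K V\<^esub> f y"
    proof (rule ext)
      fix v assume v: "v \<in> carrier V"
      then show "f (x \<oplus>\<^bsub>X\<^esub> y) v = (f x \<oplus>\<^bsub>dual_space K V\<^esub> f y) v"
        using linear_mapD(2)[OF assms(4)[OF v] xy] by (simp add: dual_space_add assms(2))
    qed (use xy assms(3) in auto) }
  { fix c x assume cx: "c \<in> carrier K" "x \<in> carrier X"
    show "f (c \<odot>\<^bsub>X\<^esub> x) = c \<odot>\<^bsub>dual_space K V\<^esub> f x"
    proof (rule ext)
      fix v assume v: "v \<in> carrier V"
      then show "f (c \<odot>\<^bsub>X\<^esub> x) v = (c \<odot>\<^bsub>dual_space K V\<^esub> f x) v"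
        using linear_mapD(3)[OF assms(4)[OF v] cx] by (simp add: dual_space_smult assms(2))
    qed (use cx assms(3) in auto) }
qed

lemma linear_map_eval:
  assumes "vectorspace K V" "v \<in> carrier V"
  shows "linear_map K (dual_space K V) (field_space K) (\<lambda>\<phi>. \<phi> v)"
proof -
  interpret V: vectorspace K V by fact
  show ?thesis
    using assms
    by (intro linear_mapI vectorspace_dual_space vectorspace_field_space V.field_axioms)
      (auto simp: dual_space_iff dual_space_add dual_space_smult dest: linear_mapD(1))
qed

section \<open>Tensor products\<close>

lemma pure_tensor_closed:
  assumes "vectorspace K V" "vectorspace K W" "v \<in> carrier V" "w \<in> carrier W"
  shows "pure_tensor K V W v w \<in> carrier (tensor K V W)"
proof -
  interpret V: vectorspace K V by fact
  show ?thesis using assms(3,4)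
    by (auto simp: pure_tensor_def tensor_def quotient_carrier intro!: imageI free_gen_closed V.field_axioms)
qed

lemma bilinear_mapI:
  assumes "\<And>v. v \<in> carrier V \<Longrightarrow> linear_map K W U (\<lambda>w. \<beta> v w)"
    and "\<And>w. w \<in> carrier W \<Longrightarrow> linear_map K V U (\<lambda>v. \<beta> v w)"
  shows "bilinear_map K V W U \<beta>"
  using assms by (auto simp: bilinear_map_def)

text \<open>The generators of the kernel are the failures of additivity and homogeneity in each
  argument. Each of them lies in the kernel, so the two cosets that it compares coincide.\<close>

lemma pure_tensor_bilinear:
  assumes V: "vectorspace K V" and W: "vectorspace K W"
  shows "bilinear_map K V W (tensor K V W) (pure_tensor K V W)"
proof -
  interpret V: vectorspace K V by fact
  interpret W: vectorspace K W by fact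
  let ?X = "carrier V \<times> carrier W"
  let ?F = "free_space K ?X"
  let ?N = "tensor_kernel K V W"
  let ?e = "\<lambda>v w. free_gen K ?X (v, w)"
  interpret F: vectorspace K ?F by (rule vectorspace_free_space) (rule V.field_axioms)
  have N: "submodule K ?N ?F" by (rule submodule_tensor_kernel[OF assms])
  interpret N: abelian_subgroup ?N ?F by (rule abelian_subgroup_submodule[OF N])
  have rel: "tensor_relations K V W \<subseteq> ?N"
    unfolding tensor_kernel_def by (rule F.in_own_span[OF tensor_relations_subset[OF assms]])
  have e: "?e v w \<in> carrier ?F" if "v \<in> carrier V" "w \<in> carrier W" for v w
    using that by (intro free_gen_closed V.field_axioms) auto
  have rels:
    "v \<in> carrier V \<Longrightarrow> v' \<in> carrier V \<Longrightarrow> w \<in> carrier W \<Longrightarrow>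
      ?e (v \<oplus>\<^bsub>V\<^esub> v') w \<ominus>\<^bsub>?F\<^esub> (?e v w \<oplus>\<^bsub>?F\<^esub> ?e v' w) \<in> tensor_relations K V W"
    "v \<in> carrier V \<Longrightarrow> w \<in> carrier W \<Longrightarrow> w' \<in> carrier W \<Longrightarrow>
      ?e v (w \<oplus>\<^bsub>W\<^esub> w') \<ominus>\<^bsub>?F\<^esub> (?e v w \<oplus>\<^bsub>?F\<^esub> ?e v w') \<in> tensor_relations K V W"
    "c \<in> carrier K \<Longrightarrow> v \<in> carrier V \<Longrightarrow> w \<in> carrier W \<Longrightarrow>
      ?e (c \<odot>\<^bsub>V\<^esub> v) w \<ominus>\<^bsub>?F\<^esub> (c \<odot>\<^bsub>?F\<^esub> ?e v w) \<in> tensor_relations K V W"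
    "c \<in> carrier K \<Longrightarrow> v \<in> carrier V \<Longrightarrow> w \<in> carrier W \<Longrightarrow>
      ?e v (c \<odot>\<^bsub>W\<^esub> w) \<ominus>\<^bsub>?F\<^esub> (c \<odot>\<^bsub>?F\<^esub> ?e v w) \<in> tensor_relations K V W"
    for c v v' w w'
    unfolding tensor_relations_def Let_def
    \<comment> \<open>The four families of relations form a union nested to the left, so each is
      reached by its own chain of \<open>UnI1\<close> and \<open>UnI2\<close>.\<close>
    subgoal by (rule UnI1, rule UnI1, rule UnI1, rule CollectI, intro exI conjI, rule refl)
    subgoal by (rule UnI1, rule UnI1, rule UnI2, rule CollectI, intro exI conjI, rule refl)
    subgoal by (rule UnI1, rule UnI2, rule CollectI, intro exI conjI, rule refl)
    subgoal by (rule UnI2, rule CollectI, intro exI conjI, rule refl)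
    done
  have eq: "?N +>\<^bsub>?F\<^esub> x = ?N +>\<^bsub>?F\<^esub> y"
    if "x \<in> carrier ?F" "y \<in> carrier ?F" "x \<ominus>\<^bsub>?F\<^esub> y \<in> tensor_relations K V W" for x y
  proof -
    have "x = (x \<ominus>\<^bsub>?F\<^esub> y) \<oplus>\<^bsub>?F\<^esub> y" using that by (simp add: F.M.minus_eq F.M.a_assoc F.M.l_neg)
    then have "x \<in> ?N +>\<^bsub>?F\<^esub> y" using that rel by (auto simp: a_r_coset_def')
    then show ?thesis using N.a_repr_independence'[of x y] that by simp
  qed
  note defs = pure_tensor_def tensor_def quotient_add[OF N] quotient_smult[OF N]
  show ?thesis
  proof (intro bilinear_mapI linear_mapI vectorspace_tensor V W pure_tensor_closed)
    fix v w w' assume *: "v \<in> carrier V" "w \<in> carrier W" "w' \<in> carrier W"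
    from * have "?N +>\<^bsub>?F\<^esub> ?e v (w \<oplus>\<^bsub>W\<^esub> w') = ?N +>\<^bsub>?F\<^esub> (?e v w \<oplus>\<^bsub>?F\<^esub> ?e v w')"
      by (intro eq F.M.a_closed e rels) (rule V.M.a_closed W.M.a_closed | assumption)+
    then show "pure_tensor K V W v (w \<oplus>\<^bsub>W\<^esub> w')
      = pure_tensor K V W v w \<oplus>\<^bsub>tensor K V W\<^esub> pure_tensor K V W v w'"
      using * e by (simp add: defs)
  next
    fix v c w assume *: "v \<in> carrier V" "c \<in> carrier K" "w \<in> carrier W"
    from * have "?N +>\<^bsub>?F\<^esub> ?e v (c \<odot>\<^bsub>W\<^esub> w) = ?N +>\<^bsub>?F\<^esub> (c \<odot>\<^bsub>?F\<^esub> ?e v w)"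
      by (intro eq F.smult_closed e rels) (rule V.smult_closed W.smult_closed | assumption)+
    then show "pure_tensor K V W v (c \<odot>\<^bsub>W\<^esub> w) = c \<odot>\<^bsub>tensor K V W\<^esub> pure_tensor K V W v w"
      using * e by (simp add: defs)
  next
    fix w v v' assume *: "w \<in> carrier W" "v \<in> carrier V" "v' \<in> carrier V"
    from * have "?N +>\<^bsub>?F\<^esub> ?e (v \<oplus>\<^bsub>V\<^esub> v') w = ?N +>\<^bsub>?F\<^esub> (?e v w \<oplus>\<^bsub>?F\<^esub> ?e v' w)"
      by (intro eq F.M.a_closed e rels) (rule V.M.a_closed W.M.a_closed | assumption)+
    then show "pure_tensor K V W (v \<oplus>\<^bsub>V\<^esub> v') w
      = pure_tensor K V W v w \<oplus>\<^bsub>tensor K V W\<^esub> pure_tensor K V W v' w"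
      using * e by (simp add: defs)
  next
    fix w c v assume *: "w \<in> carrier W" "c \<in> carrier K" "v \<in> carrier V"
    from * have "?N +>\<^bsub>?F\<^esub> ?e (c \<odot>\<^bsub>V\<^esub> v) w = ?N +>\<^bsub>?F\<^esub> (c \<odot>\<^bsub>?F\<^esub> ?e v w)"
      by (intro eq F.smult_closed e rels) (rule V.smult_closed W.smult_closed | assumption)+
    then show "pure_tensor K V W (c \<odot>\<^bsub>V\<^esub> v) w = c \<odot>\<^bsub>tensor K V W\<^esub> pure_tensor K V W v w"
      using * e by (simp add: defs)
  qed
qed

lemma linear_map_pure_left:
  assumes "linear_map K X V f" "vectorspace K W" "w \<in> carrier W"
  shows "linear_map K X (tensor K V W) (\<lambda>x. pure_tensor K V W (f x) w)"
  using linear_map_comp[OF assms(1) bilinear_mapD(2)[OF pure_tensor_bilinear[OF _ assms(2)] assms(3)]]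
    linear_map.axioms(2)[OF assms(1)] .

lemma linear_map_pure_right:
  assumes "linear_map K X W f" "vectorspace K V" "v \<in> carrier V"
  shows "linear_map K X (tensor K V W) (\<lambda>x. pure_tensor K V W v (f x))"
  using linear_map_comp[OF assms(1) bilinear_mapD(1)[OF pure_tensor_bilinear[OF assms(2)] assms(3)]]
    linear_map.axioms(2)[OF assms(1)] .

text \<open>This is uniqueness in the universal property: both maps lift the same bilinear map. A
  lift is required to be extensional, hence the restrictions to the carrier.\<close>

lemma linear_map_eq_tensor:
  assumes V: "vectorspace K V" and W: "vectorspace K W"
    and f: "linear_map K (tensor K V W) U f" and g: "linear_map K (tensor K V W) U g"
    and eq: "\<And>v w. v \<in> carrier V \<Longrightarrow> w \<in> carrier W \<Longrightarrow>
      f (pure_tensor K V W v w) = g (pure_tensor K V W v w)"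
    and t: "t \<in> carrier (tensor K V W)"
  shows "f t = g t"
proof -
  let ?\<beta> = "\<lambda>v w. f (pure_tensor K V W v w)"
  let ?T = "carrier (tensor K V W)"
  note pb = pure_tensor_bilinear[OF V W]
  have U: "vectorspace K U" by (rule linear_map.axioms(2)[OF f])
  have "bilinear_map K V W U ?\<beta>"
    by (intro bilinear_mapI linear_map_comp[OF bilinear_mapD(1)[OF pb] f]
        linear_map_comp[OF bilinear_mapD(2)[OF pb] f])
  then have "\<exists>!h. is_tensor_lift K V W U ?\<beta> h" by (rule tensor_lift_ex1[OF V W U])
  moreover have "is_tensor_lift K V W U ?\<beta> (restrict f ?T)"
    by (auto simp: is_tensor_lift_def pure_tensor_closed V W intro: linear_map_cong[OF f])
  moreover have "is_tensor_lift K V W U ?\<beta> (restrict g ?T)"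
    by (auto simp: is_tensor_lift_def pure_tensor_closed V W eq intro: linear_map_cong[OF g])
  ultimately have "restrict f ?T = restrict g ?T" by blast
  then show ?thesis using t by (metis restrict_apply')
qed

(* The projection onto the quotient by the sums of pure tensors kills every pure tensor, so is zero. *)
lemma tensor_finsum:
  assumes V: "vectorspace K V" and W: "vectorspace K W" and t: "t \<in> carrier (tensor K V W)"
  obtains v w and n :: nat where "\<And>i. v i \<in> carrier V" "\<And>i. w i \<in> carrier W"
    "t = (\<Oplus>\<^bsub>tensor K V W\<^esub>i\<in>{..<n}. pure_tensor K V W (v i) (w i))"
proof -
  interpret V: vectorspace K V by fact
  interpret W: vectorspace K W by fact
  let ?T = "tensor K V W"
  let ?p = "pure_tensor K V W"
  have T: "vectorspace K ?T" by (rule vectorspace_tensor[OF V W])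
  interpret T: vectorspace K ?T by (rule T)
  note pc [simp] = pure_tensor_closed[OF V W]
  note pb = pure_tensor_bilinear[OF V W]
  let ?s = "\<lambda>n v w. \<Oplus>\<^bsub>?T\<^esub>i\<in>{..<n}. ?p (v i) (w i)"
  \<comment> \<open>All values of v and w, also those beyond n, are asked to lie in the carriers.
    Zero vectors can fill the spare places, and side conditions then need no index bound.\<close>
  define Q where "Q = {?s (n::nat) v w | n v w. (\<forall>i. v i \<in> carrier V) \<and> (\<forall>i. w i \<in> carrier W)}"
  have Qc: "Q \<subseteq> carrier ?T" by (auto simp: Q_def)
  have QI: "?s n v w \<in> Q" if "\<And>i. v i \<in> carrier V" "\<And>i. w i \<in> carrier W" for n :: nat and v w
    unfolding Q_def using that by blast
  have QE: "\<exists>(n::nat) v w. (\<forall>i. v i \<in> carrier V) \<and> (\<forall>i. w i \<in> carrier W) \<and> x = ?s n v w"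
    if "x \<in> Q" for x
    using that unfolding Q_def by blast
  have Q0: "\<zero>\<^bsub>?T\<^esub> \<in> Q" using QI[of "\<lambda>_. \<zero>\<^bsub>V\<^esub>" "\<lambda>_. \<zero>\<^bsub>W\<^esub>" 0] by simp
  have Qp: "?p a b \<oplus>\<^bsub>?T\<^esub> x \<in> Q" if a: "a \<in> carrier V" and b: "b \<in> carrier W" and x: "x \<in> Q" for a b x
  proof -
    obtain n :: nat and v w where vw: "\<forall>i. v i \<in> carrier V" "\<forall>i. w i \<in> carrier W" "x = ?s n v w"
      using QE[OF x] by blast
    \<comment> \<open>The new pure tensor becomes the term of index n.\<close>
    have "?p a b \<oplus>\<^bsub>?T\<^esub> x = ?s (Suc n) (v(n := a)) (w(n := b))"
      using vw a b by (simp add: lessThan_Suc Pi_def cong: T.M.finsum_cong)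
    then show ?thesis using vw a b QI[of "v(n := a)" "w(n := b)" "Suc n"] by simp
  qed
  have Qadd: "?s n v w \<oplus>\<^bsub>?T\<^esub> x \<in> Q"
    if "\<forall>i. v i \<in> carrier V" "\<forall>i. w i \<in> carrier W" "x \<in> Q" for n :: nat and v w x
    using that
  proof (induction n)
    case 0
    then show ?case using Qc by auto
  next
    case (Suc n)
    have "?s (Suc n) v w \<oplus>\<^bsub>?T\<^esub> x = ?p (v n) (w n) \<oplus>\<^bsub>?T\<^esub> (?s n v w \<oplus>\<^bsub>?T\<^esub> x)"
      using Suc.prems Qc by (auto simp: lessThan_Suc T.M.a_assoc)
    then show ?case using Suc by (simp add: Qp)
  qed
  have Qsub: "submodule K Q ?T"
  proof (unfold submodule_def, intro conjI allI impI)
    show "module K ?T" ..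
    show "Q \<subseteq> carrier ?T" by (rule Qc)
    show "\<zero>\<^bsub>?T\<^esub> \<in> Q" by (rule Q0)
  next
    fix x y assume "x \<in> Q" "y \<in> Q"
    then show "x \<oplus>\<^bsub>?T\<^esub> y \<in> Q" using Qadd QE[of x] by blast
  next
    fix c x assume c: "c \<in> carrier K" and x: "x \<in> Q"
    obtain n :: nat and v w where vw: "\<forall>i. v i \<in> carrier V" "\<forall>i. w i \<in> carrier W" "x = ?s n v w"
      using QE[OF x] by blast
    \<comment> \<open>The sums in Q carry no coefficients, so a scalar is absorbed into the left
      factors.\<close>
    have "c \<odot>\<^bsub>?T\<^esub> x = ?s n (\<lambda>i. c \<odot>\<^bsub>V\<^esub> v i) w"
      using linear_map_finsum[OF linear_map_smult_const[OF linear_map_id[OF T] c], of "{..<n}" "\<lambda>i. ?p (v i) (w i)"] vw c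
      by (simp add: linear_mapD(3)[OF bilinear_mapD(2)[OF pb]])
    then show "c \<odot>\<^bsub>?T\<^esub> x \<in> Q" using vw c QI[of "\<lambda>i. c \<odot>\<^bsub>V\<^esub> v i" w n] by simp
  qed
  interpret Qg: abelian_subgroup Q ?T by (rule abelian_subgroup_submodule[OF Qsub])
  have QQ: "vectorspace K (quotient_space ?T Q)" by (rule vectorspace_quotient_space[OF T Qsub])
  have "Q +>\<^bsub>?T\<^esub> t = \<zero>\<^bsub>quotient_space ?T Q\<^esub>"
  proof (rule linear_map_eq_tensor[OF V W linear_map_proj[OF T Qsub] linear_map_zero_fun[OF T QQ] _ t])
    fix v w assume vw: "v \<in> carrier V" "w \<in> carrier W"
    have "?p v w \<in> Q" using Qp[OF vw Q0] vw by simp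
    then show "Q +>\<^bsub>?T\<^esub> ?p v w = \<zero>\<^bsub>quotient_space ?T Q\<^esub>"
      by (simp add: quotient_space_def Qg.a_rcos_const)
  qed
  then have "t \<in> Q" using Qg.a_rcos_self[OF t] by (simp add: quotient_space_def)
  then obtain n :: nat and v w where "\<And>i. v i \<in> carrier V" "\<And>i. w i \<in> carrier W" "t = ?s n v w"
    using QE by blast
  then show thesis by (rule that)
qed

text \<open>This turns an expression defined by linear extension into a sum over a presentation of
  its argument.\<close>

lemma tensor_lift_finsum:
  assumes "vectorspace K V" "vectorspace K W" "vectorspace K U" "bilinear_map K V W U \<beta>"
    "\<And>i. i \<in> I \<Longrightarrow> v i \<in> carrier V" "\<And>i. i \<in> I \<Longrightarrow> w i \<in> carrier W"
  shows "tensor_lift K V W U \<beta> (\<Oplus>\<^bsub>tensor K V W\<^esub>i\<in>I. pure_tensor K V W (v i) (w i))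
    = (\<Oplus>\<^bsub>U\<^esub>i\<in>I. \<beta> (v i) (w i))"
proof -
  interpret U: vectorspace K U by fact
  note \<beta> = tensor_lift[OF assms(1-4)]
  have "tensor_lift K V W U \<beta> (\<Oplus>\<^bsub>tensor K V W\<^esub>i\<in>I. pure_tensor K V W (v i) (w i))
    = (\<Oplus>\<^bsub>U\<^esub>i\<in>I. tensor_lift K V W U \<beta> (pure_tensor K V W (v i) (w i)))"
    using assms by (intro linear_map_finsum[OF \<beta>(1)] pure_tensor_closed)
  also have "\<dots> = (\<Oplus>\<^bsub>U\<^esub>i\<in>I. \<beta> (v i) (w i))"
    using assms(5,6) linear_mapD(1)[OF bilinear_mapD(1)[OF assms(4)]]
    by (intro U.M.finsum_cong') (auto simp: \<beta>(3))
  finally show ?thesis .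
qed

text \<open>A presentation of t makes the lift a finite sum of values of \<beta> x, each linear in
  x. Iterated lifts, as in \<open>assoc_left\<close> or in the products of r with itself, are
  bilinear for this reason.\<close>

lemma linear_map_tensor_lift:
  assumes V: "vectorspace K V" and W: "vectorspace K W" and U: "vectorspace K U"
    and X: "vectorspace K X" and t: "t \<in> carrier (tensor K V W)"
    and bil: "\<And>x. x \<in> carrier X \<Longrightarrow> bilinear_map K V W U (\<beta> x)"
    and lin: "\<And>v w. v \<in> carrier V \<Longrightarrow> w \<in> carrier W \<Longrightarrow> linear_map K X U (\<lambda>x. \<beta> x v w)"
  shows "linear_map K X U (\<lambda>x. tensor_lift K V W U (\<beta> x) t)"
proof -
  obtain v w and n :: nat where *: "\<And>i. v i \<in> carrier V" "\<And>i. w i \<in> carrier W"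
    "t = (\<Oplus>\<^bsub>tensor K V W\<^esub>i\<in>{..<n}. pure_tensor K V W (v i) (w i))"
    by (rule tensor_finsum[OF V W t]) (rule that)
  have "linear_map K X U (\<lambda>x. \<Oplus>\<^bsub>U\<^esub>i\<in>{..<n}. \<beta> x (v i) (w i))"
    using * by (intro linear_map_sum X U lin) auto
  then show ?thesis
    by (rule linear_map_cong) (simp add: *(3) tensor_lift_finsum[OF V W U bil *(1,2)])
qed

section \<open>Separation by functionals\<close>

lemma linear_functional_closed:
  "linear_map K V (field_space K) f \<Longrightarrow> v \<in> carrier V \<Longrightarrow> f v \<in> carrier K"
  using linear_mapD(1)[of K V "field_space K" f] by simp

lemma dual_space_linear:
  "\<phi> \<in> carrier (dual_space K V) \<Longrightarrow> linear_map K V (field_space K) \<phi>"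
  by (simp add: dual_space_iff)

lemma dual_space_closed:
  "\<phi> \<in> carrier (dual_space K V) \<Longrightarrow> v \<in> carrier V \<Longrightarrow> \<phi> v \<in> carrier K"
  by (rule linear_functional_closed[OF dual_space_linear])

text \<open>If x and y differ, \<open>exists_functional\<close> applies to x - y and the zero
  submodule.\<close>

lemma functionals_separate:
  assumes V: "vectorspace K V" and xy: "x \<in> carrier V" "y \<in> carrier V"
    and eq: "\<And>\<phi>. \<phi> \<in> carrier (dual_space K V) \<Longrightarrow> \<phi> x = \<phi> y"
  shows "x = y"
proof (rule ccontr)
  interpret V: vectorspace K V by fact
  assume "x \<noteq> y"
  then have ne: "x \<ominus>\<^bsub>V\<^esub> y \<notin> {\<zero>\<^bsub>V\<^esub>}" using xy by simp
  have "submodule K {\<zero>\<^bsub>V\<^esub>} V" by (auto simp: submodule_def V.module_axioms)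
  then obtain \<phi> where \<phi>: "\<phi> \<in> carrier (dual_space K V)" "\<phi> (x \<ominus>\<^bsub>V\<^esub> y) = \<one>\<^bsub>K\<^esub>"
    by (rule exists_functional[OF V _ _ ne]) (use xy that in auto)
  interpret F: vectorspace K "field_space K" by (rule vectorspace_field_space[OF V.field_axioms])
  have "\<phi> (x \<ominus>\<^bsub>V\<^esub> y) = \<phi> x \<ominus>\<^bsub>field_space K\<^esub> \<phi> y"
    by (rule linear_map_minus[OF dual_space_linear[OF \<phi>(1)] xy])
  also have "\<dots> = \<zero>\<^bsub>K\<^esub>"
    using eq[OF \<phi>(1)] dual_space_closed[OF \<phi>(1)] xy F.M.r_neg[of "\<phi> y"] by (simp add: a_minus_def)
  finally show False using \<phi>(2) by simp
qed

text \<open>The families define a finite-rank operator that fixes every vector of S. It stands in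
  for a dual basis in any dimension. Linear independence of the b i is not asked for, because only
  the fixed vectors matter.\<close>

lemma dual_frame:
  assumes V: "vectorspace K V" and S: "finite S" "S \<subseteq> carrier V"
  obtains n :: nat and b \<beta> where "\<And>i. b i \<in> carrier V" "\<And>i. \<beta> i \<in> carrier (dual_space K V)"
    "\<And>x. x \<in> S \<Longrightarrow> (\<Oplus>\<^bsub>V\<^esub>i\<in>{..<n}. \<beta> i x \<odot>\<^bsub>V\<^esub> b i) = x"
proof -
  interpret V: vectorspace K V by fact
  interpret D: vectorspace K "dual_space K V" by (rule vectorspace_dual_space[OF V])
  have "\<exists>(n::nat) b \<beta>. (\<forall>i. b i \<in> carrier V) \<and> (\<forall>i. \<beta> i \<in> carrier (dual_space K V)) \<and>
    (\<forall>x\<in>S. (\<Oplus>\<^bsub>V\<^esub>i\<in>{..<n}. \<beta> i x \<odot>\<^bsub>V\<^esub> b i) = x)"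
    using S
  proof (induction S rule: finite_induct)
    case empty
    show ?case
      \<comment> \<open>With no terms and no vectors to fix, the zero families only have to lie in
        the carriers.\<close>
      by (rule exI[of _ 0], rule exI[of _ "\<lambda>_. \<zero>\<^bsub>V\<^esub>"], rule exI[of _ "\<lambda>_. \<zero>\<^bsub>dual_space K V\<^esub>"]) simp
  next
    case (insert s S)
    then have "S \<subseteq> carrier V" by simp
    from insert.IH[OF this] obtain n :: nat and b \<beta>
      where IH: "(\<forall>i. b i \<in> carrier V) \<and> (\<forall>i. \<beta> i \<in> carrier (dual_space K V)) \<and>
        (\<forall>x\<in>S. (\<Oplus>\<^bsub>V\<^esub>i\<in>{..<n}. \<beta> i x \<odot>\<^bsub>V\<^esub> b i) = x)"
      by (elim exE) (rule that)
    then have b: "\<And>i. b i \<in> carrier V" and \<beta>: "\<And>i. \<beta> i \<in> carrier (dual_space K V)"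
      and S: "\<And>x. x \<in> S \<Longrightarrow> (\<Oplus>\<^bsub>V\<^esub>i\<in>{..<n}. \<beta> i x \<odot>\<^bsub>V\<^esub> b i) = x"
      by simp_all
    define E where "E x = (\<Oplus>\<^bsub>V\<^esub>i\<in>{..<n}. \<beta> i x \<odot>\<^bsub>V\<^esub> b i)" for x
    have E: "linear_map K V V E" unfolding E_def
      by (intro linear_map_sum linear_map_smult_left V dual_space_linear b \<beta>) simp
    note Ec = linear_mapD(1)[OF E]
    \<comment> \<open>X is the submodule of vectors fixed by E. If s is outside X, a functional
      \<gamma> that vanishes on X and is 1 at s yields the correction \<gamma> x (s - E s). It adds
      nothing on X and makes s a fixed vector.\<close>
    define X where "X = {x \<in> carrier V. E x = x}"
    have X: "submodule K X V"
      by (auto simp: submodule_def X_def linear_mapD[OF E] linear_map_zero[OF E] V.module_axioms)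
    have s: "s \<in> carrier V" using insert by auto
    show ?case
    proof (cases "s \<in> X")
      case True
      then have "(\<Oplus>\<^bsub>V\<^esub>i\<in>{..<n}. \<beta> i x \<odot>\<^bsub>V\<^esub> b i) = x" if "x \<in> insert s S" for x
        using that S by (auto simp: X_def E_def)
      then show ?thesis using b \<beta>
        by (intro exI[of _ n] exI[of _ b] exI[of _ \<beta>]) simp
    next
      case False
      obtain \<gamma> where \<gamma>: "\<gamma> \<in> carrier (dual_space K V)" "\<gamma> s = \<one>\<^bsub>K\<^esub>" "\<And>x. x \<in> X \<Longrightarrow> \<gamma> x = \<zero>\<^bsub>K\<^esub>"
        by (rule exists_functional[OF V X s False]) (rule that)
      define y where "y = s \<ominus>\<^bsub>V\<^esub> E s"
      have y: "y \<in> carrier V" using s Ec by (simp add: y_def)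
      define b' \<beta>' where "b' = b(n := y)" and "\<beta>' = \<beta>(n := \<gamma>)"
      have step: "(\<Oplus>\<^bsub>V\<^esub>i\<in>{..<Suc n}. \<beta>' i x \<odot>\<^bsub>V\<^esub> b' i) = \<gamma> x \<odot>\<^bsub>V\<^esub> y \<oplus>\<^bsub>V\<^esub> E x"
        if x: "x \<in> carrier V" for x
      proof -
        have cl: "\<beta> i x \<odot>\<^bsub>V\<^esub> b i \<in> carrier V" "\<gamma> x \<odot>\<^bsub>V\<^esub> y \<in> carrier V" for i
          using b y dual_space_closed[OF \<beta> x] dual_space_closed[OF \<gamma>(1) x] by auto
        have "(\<Oplus>\<^bsub>V\<^esub>i\<in>{..<Suc n}. \<beta>' i x \<odot>\<^bsub>V\<^esub> b' i)
          = \<beta>' n x \<odot>\<^bsub>V\<^esub> b' n \<oplus>\<^bsub>V\<^esub> (\<Oplus>\<^bsub>V\<^esub>i\<in>{..<n}. \<beta>' i x \<odot>\<^bsub>V\<^esub> b' i)"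
          unfolding lessThan_Suc using cl by (intro V.M.finsum_insert) (auto simp: b'_def \<beta>'_def)
        moreover have "(\<Oplus>\<^bsub>V\<^esub>i\<in>{..<n}. \<beta>' i x \<odot>\<^bsub>V\<^esub> b' i) = E x"
          unfolding E_def using cl by (intro V.M.finsum_cong') (auto simp: b'_def \<beta>'_def)
        ultimately show ?thesis by (simp add: b'_def \<beta>'_def)
      qed
      have "(\<Oplus>\<^bsub>V\<^esub>i\<in>{..<Suc n}. \<beta>' i x \<odot>\<^bsub>V\<^esub> b' i) = x" if "x \<in> insert s S" for x
      proof (cases "x = s")
        case True
        then show ?thesis
          using step[OF s] \<gamma>(2) s Ec y by (simp add: y_def V.M.minus_eq V.M.a_assoc V.M.l_neg)
      next
        case False
        then have "x \<in> S" "x \<in> carrier V" using that insert by auto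
        then have "x \<in> X" "E x = x" using S by (auto simp: X_def E_def)
        then show ?thesis using step \<open>x \<in> carrier V\<close> \<gamma>(3) y by simp
      qed
      moreover have "\<forall>i. b' i \<in> carrier V" "\<forall>i. \<beta>' i \<in> carrier (dual_space K V)"
        using b y \<beta> \<gamma>(1) by (auto simp: b'_def \<beta>'_def)
      ultimately show ?thesis by (intro exI[of _ "Suc n"] exI[of _ b'] exI[of _ \<beta>']) simp
    qed
  qed
  then obtain n :: nat and b \<beta>
    where "(\<forall>i. b i \<in> carrier V) \<and> (\<forall>i. \<beta> i \<in> carrier (dual_space K V)) \<and>
      (\<forall>x\<in>S. (\<Oplus>\<^bsub>V\<^esub>i\<in>{..<n}. \<beta> i x \<odot>\<^bsub>V\<^esub> b i) = x)"
    by (elim exE) (rule that)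
  then show thesis using that[of b \<beta> n] by simp
qed

text \<open>The vectors fixed by a frame operator form a submodule, so a frame for a finite spanning
  set fixes the whole space. This resolution of the identity is all that later proofs use.\<close>

lemma finite_dual_basis:
  assumes V: "vectorspace K V" and fin: "vectorspace.fin_dim K V"
  obtains n :: nat and b \<beta> where "\<And>i. b i \<in> carrier V" "\<And>i. \<beta> i \<in> carrier (dual_space K V)"
    "\<And>x. x \<in> carrier V \<Longrightarrow> (\<Oplus>\<^bsub>V\<^esub>i\<in>{..<n}. \<beta> i x \<odot>\<^bsub>V\<^esub> b i) = x"
proof -
  interpret V: vectorspace K V by fact
  obtain S where S: "finite S" "S \<subseteq> carrier V" "V.span S = carrier V"
    using fin by (auto simp: V.fin_dim_def)
  obtain n :: nat and b \<beta> where b: "\<And>i. b i \<in> carrier V"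
    and \<beta>: "\<And>i. \<beta> i \<in> carrier (dual_space K V)"
    and eq: "\<And>x. x \<in> S \<Longrightarrow> (\<Oplus>\<^bsub>V\<^esub>i\<in>{..<n}. \<beta> i x \<odot>\<^bsub>V\<^esub> b i) = x"
    by (rule dual_frame[OF V S(1,2)]) (rule that)
  define E where "E x = (\<Oplus>\<^bsub>V\<^esub>i\<in>{..<n}. \<beta> i x \<odot>\<^bsub>V\<^esub> b i)" for x
  have E: "linear_map K V V E" unfolding E_def
    by (intro linear_map_sum linear_map_smult_left V dual_space_linear b \<beta>) simp
  have "submodule K {x \<in> carrier V. E x = x} V"
    by (auto simp: submodule_def linear_mapD[OF E] linear_map_zero[OF E] V.module_axioms)
  then have "V.span S \<subseteq> {x \<in> carrier V. E x = x}"
    using S(2) eq by (intro V.span_is_subset) (auto simp: E_def)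
  then have "(\<Oplus>\<^bsub>V\<^esub>i\<in>{..<n}. \<beta> i x \<odot>\<^bsub>V\<^esub> b i) = x" if "x \<in> carrier V" for x
    using that unfolding S(3) by (auto simp: E_def)
  then show thesis using that[of b \<beta> n] b \<beta> by simp
qed

section \<open>Slice maps, product functionals, and separation in tensor products\<close>

definition contract_left ::
  "('k, 'r) ring_scheme \<Rightarrow> ('k, 'v, 'm) module_scheme \<Rightarrow> ('k, 'w, 'n) module_scheme
    \<Rightarrow> ('v \<Rightarrow> 'k) \<Rightarrow> ('v \<times> 'w \<Rightarrow> 'k) set \<Rightarrow> 'w" where
  "contract_left K V W \<phi> = tensor_lift K V W W (\<lambda>v w. \<phi> v \<odot>\<^bsub>W\<^esub> w)"

definition contract_right ::
  "('k, 'r) ring_scheme \<Rightarrow> ('k, 'v, 'm) module_scheme \<Rightarrow> ('k, 'w, 'n) module_scheme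
    \<Rightarrow> ('w \<Rightarrow> 'k) \<Rightarrow> ('v \<times> 'w \<Rightarrow> 'k) set \<Rightarrow> 'v" where
  "contract_right K V W \<psi> = tensor_lift K V W V (\<lambda>v w. \<psi> w \<odot>\<^bsub>V\<^esub> v)"

text \<open>For functionals in the dual spaces this is the value of \<open>dual_tensor\<close> at
  their pure tensor. It is available directly for all linear functionals, extensional or
  not.\<close>

definition tensor_functional ::
  "('k, 'r) ring_scheme \<Rightarrow> ('k, 'v, 'm) module_scheme \<Rightarrow> ('k, 'w, 'n) module_scheme
    \<Rightarrow> ('v \<Rightarrow> 'k) \<Rightarrow> ('w \<Rightarrow> 'k) \<Rightarrow> ('v \<times> 'w \<Rightarrow> 'k) set \<Rightarrow> 'k" where
  "tensor_functional K V W \<phi> \<psi> = tensor_lift K V W (field_space K) (\<lambda>v w. \<phi> v \<otimes>\<^bsub>K\<^esub> \<psi> w)"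

lemma contract_left:
  assumes "vectorspace K V" "vectorspace K W" "linear_map K V (field_space K) \<phi>"
  shows "linear_map K (tensor K V W) W (contract_left K V W \<phi>)"
    and "v \<in> carrier V \<Longrightarrow> w \<in> carrier W \<Longrightarrow>
      contract_left K V W \<phi> (pure_tensor K V W v w) = \<phi> v \<odot>\<^bsub>W\<^esub> w"
proof -
  have "bilinear_map K V W W (\<lambda>v w. \<phi> v \<odot>\<^bsub>W\<^esub> w)"
    by (intro bilinear_mapI linear_map_smult_const linear_map_id linear_map_smult_left assms
        linear_functional_closed[OF assms(3)])
  note * = tensor_lift[OF assms(1,2,2) this]
  show "linear_map K (tensor K V W) W (contract_left K V W \<phi>)"
    and "v \<in> carrier V \<Longrightarrow> w \<in> carrier W \<Longrightarrow>
      contract_left K V W \<phi> (pure_tensor K V W v w) = \<phi> v \<odot>\<^bsub>W\<^esub> w"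
    unfolding contract_left_def by (rule *(1), rule *(3))
qed

lemma contract_right:
  assumes "vectorspace K V" "vectorspace K W" "linear_map K W (field_space K) \<psi>"
  shows "linear_map K (tensor K V W) V (contract_right K V W \<psi>)"
    and "v \<in> carrier V \<Longrightarrow> w \<in> carrier W \<Longrightarrow>
      contract_right K V W \<psi> (pure_tensor K V W v w) = \<psi> w \<odot>\<^bsub>V\<^esub> v"
proof -
  have "bilinear_map K V W V (\<lambda>v w. \<psi> w \<odot>\<^bsub>V\<^esub> v)"
    by (intro bilinear_mapI linear_map_smult_const linear_map_id linear_map_smult_left assms
        linear_functional_closed[OF assms(3)])
  note * = tensor_lift[OF assms(1,2,1) this]
  show "linear_map K (tensor K V W) V (contract_right K V W \<psi>)"
    and "v \<in> carrier V \<Longrightarrow> w \<in> carrier W \<Longrightarrow>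
      contract_right K V W \<psi> (pure_tensor K V W v w) = \<psi> w \<odot>\<^bsub>V\<^esub> v"
    unfolding contract_right_def by (rule *(1), rule *(3))
qed

lemma tensor_functional_bilinear:
  assumes "linear_map K V (field_space K) \<phi>" "linear_map K W (field_space K) \<psi>"
  shows "bilinear_map K V W (field_space K) (\<lambda>v w. \<phi> v \<otimes>\<^bsub>K\<^esub> \<psi> w)"
  by (intro bilinear_mapI linear_map_mult_const linear_map_mult_left assms
      linear_functional_closed[OF assms(1)] linear_functional_closed[OF assms(2)])

lemma tensor_functional:
  assumes V: "vectorspace K V" and W: "vectorspace K W"
    and lin: "linear_map K V (field_space K) \<phi>" "linear_map K W (field_space K) \<psi>"
  shows "tensor_functional K V W \<phi> \<psi> \<in> carrier (dual_space K (tensor K V W))"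
    and "v \<in> carrier V \<Longrightarrow> w \<in> carrier W \<Longrightarrow>
      tensor_functional K V W \<phi> \<psi> (pure_tensor K V W v w) = \<phi> v \<otimes>\<^bsub>K\<^esub> \<psi> w"
proof -
  have F: "vectorspace K (field_space K)" by (rule linear_map.axioms(2)[OF lin(1)])
  note * = tensor_lift[OF V W F tensor_functional_bilinear[OF lin]]
  show "tensor_functional K V W \<phi> \<psi> \<in> carrier (dual_space K (tensor K V W))"
    unfolding tensor_functional_def dual_space_iff using *(1,2) by blast
  show "v \<in> carrier V \<Longrightarrow> w \<in> carrier W \<Longrightarrow>
      tensor_functional K V W \<phi> \<psi> (pure_tensor K V W v w) = \<phi> v \<otimes>\<^bsub>K\<^esub> \<psi> w"
    unfolding tensor_functional_def by (rule *(3))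
qed

text \<open>Testing a slice by \<psi> amounts to testing the whole tensor by \<phi> \<otimes>
  \<psi>, so separation can proceed one factor at a time.\<close>

lemma functional_contract_left:
  assumes "vectorspace K V" "vectorspace K W"
    and lin: "linear_map K V (field_space K) \<phi>" "linear_map K W (field_space K) \<psi>"
    and t: "t \<in> carrier (tensor K V W)"
  shows "\<psi> (contract_left K V W \<phi> t) = tensor_functional K V W \<phi> \<psi> t"
proof (rule linear_map_eq_tensor[OF assms(1,2) _ _ _ t, where f = "\<lambda>t. \<psi> (contract_left K V W \<phi> t)"])
  show "linear_map K (tensor K V W) (field_space K) (\<lambda>t. \<psi> (contract_left K V W \<phi> t))"
    by (rule linear_map_comp[OF contract_left(1)[OF assms(1-3)] lin(2)])
  show "linear_map K (tensor K V W) (field_space K) (tensor_functional K V W \<phi> \<psi>)"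
    by (rule dual_space_linear[OF tensor_functional(1)[OF assms(1-4)]])
qed (simp add: contract_left(2)[OF assms(1-3)] tensor_functional(2)[OF assms(1-4)]
    linear_mapD(3)[OF lin(2)] linear_functional_closed[OF lin(1)])

lemma functional_contract_right:
  assumes "vectorspace K V" "vectorspace K W"
    and lin: "linear_map K V (field_space K) \<phi>" "linear_map K W (field_space K) \<psi>"
    and t: "t \<in> carrier (tensor K V W)"
  shows "\<phi> (contract_right K V W \<psi> t) = tensor_functional K V W \<phi> \<psi> t"
proof (rule linear_map_eq_tensor[OF assms(1,2) _ _ _ t, where f = "\<lambda>t. \<phi> (contract_right K V W \<psi> t)"])
  interpret V: vectorspace K V by fact
  show "linear_map K (tensor K V W) (field_space K) (\<lambda>t. \<phi> (contract_right K V W \<psi> t))"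
    by (rule linear_map_comp[OF contract_right(1)[OF assms(1,2,4)] lin(1)])
  show "linear_map K (tensor K V W) (field_space K) (tensor_functional K V W \<phi> \<psi>)"
    by (rule dual_space_linear[OF tensor_functional(1)[OF assms(1-4)]])
  show "\<phi> (contract_right K V W \<psi> (pure_tensor K V W v w)) = tensor_functional K V W \<phi> \<psi> (pure_tensor K V W v w)"
    if "v \<in> carrier V" "w \<in> carrier W" for v w
    using that by (simp add: contract_right(2)[OF assms(1,2,4)] tensor_functional(2)[OF assms(1-4)]
        linear_mapD(3)[OF lin(1)] linear_functional_closed[OF lin(1)] linear_functional_closed[OF lin(2)] V.R.m_comm)
qed

text \<open>The operator F below fixes every pure tensor in a presentation of t, hence fixes t. It
  is assembled from slices of its argument, so it sends t to zero when all slices of t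
  vanish.\<close>

lemma contract_left_separates:
  assumes V: "vectorspace K V" and W: "vectorspace K W" and t: "t \<in> carrier (tensor K V W)"
    and zero: "\<And>\<phi>. \<phi> \<in> carrier (dual_space K V) \<Longrightarrow> contract_left K V W \<phi> t = \<zero>\<^bsub>W\<^esub>"
  shows "t = \<zero>\<^bsub>tensor K V W\<^esub>"
proof -
  have T: "vectorspace K (tensor K V W)" by (rule vectorspace_tensor[OF V W])
  interpret W: vectorspace K W by fact
  interpret T: vectorspace K "tensor K V W" by (rule T)
  obtain v w and n :: nat where v: "\<And>i. v i \<in> carrier V" and w: "\<And>i. w i \<in> carrier W"
    and t_eq: "t = (\<Oplus>\<^bsub>tensor K V W\<^esub>i\<in>{..<n}. pure_tensor K V W (v i) (w i))"
    by (rule tensor_finsum[OF V W t]) (rule that)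
  \<comment> \<open>The frame has to fix only the finitely many left factors of t, so V may have any
    dimension.\<close>
  obtain m :: nat and b \<beta> where b: "\<And>j. b j \<in> carrier V" and \<beta>: "\<And>j. \<beta> j \<in> carrier (dual_space K V)"
    and eq: "\<And>x. x \<in> v ` {..<n} \<Longrightarrow> (\<Oplus>\<^bsub>V\<^esub>j\<in>{..<m}. \<beta> j x \<odot>\<^bsub>V\<^esub> b j) = x"
  proof (rule dual_frame[OF V, of "v ` {..<n}"])
    show "finite (v ` {..<n})" "v ` {..<n} \<subseteq> carrier V" using v by auto
  qed (rule that)
  \<comment> \<open>F is the frame operator on V tensored with the identity of W, written through
    slices.\<close>
  define F where
    "F t = (\<Oplus>\<^bsub>tensor K V W\<^esub>j\<in>{..<m}. pure_tensor K V W (b j) (contract_left K V W (\<beta> j) t))" for t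
  have lin: "linear_map K (tensor K V W) W (contract_left K V W (\<beta> j))" for j
    by (rule contract_left(1)[OF V W dual_space_linear[OF \<beta>]])
  have F: "linear_map K (tensor K V W) (tensor K V W) F"
    unfolding F_def by (intro linear_map_sum T linear_map_pure_right lin V b) simp
  have Fp: "F (pure_tensor K V W x y) = pure_tensor K V W x y" if x: "x \<in> v ` {..<n}" and y: "y \<in> carrier W" for x y
  proof -
    have xc: "x \<in> carrier V" using x v by auto
    note pl = bilinear_mapD(2)[OF pure_tensor_bilinear[OF V W] y]
    note pr = bilinear_mapD(1)[OF pure_tensor_bilinear[OF V W] b]
    note \<beta>c = dual_space_closed[OF \<beta> xc]
    interpret V: vectorspace K V by (rule V)
    have "pure_tensor K V W x y = pure_tensor K V W (\<Oplus>\<^bsub>V\<^esub>j\<in>{..<m}. \<beta> j x \<odot>\<^bsub>V\<^esub> b j) y"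
      using eq[OF x] by simp
    also have "\<dots> = (\<Oplus>\<^bsub>tensor K V W\<^esub>j\<in>{..<m}. pure_tensor K V W (\<beta> j x \<odot>\<^bsub>V\<^esub> b j) y)"
      by (rule linear_map_finsum[OF pl]) (simp add: \<beta>c b)
    also have "\<dots> = F (pure_tensor K V W x y)"
      unfolding F_def
      by (rule T.M.finsum_cong')
        (auto simp: linear_mapD(3)[OF pl] linear_mapD(3)[OF pr] contract_left(2)[OF V W dual_space_linear[OF \<beta>]]
          xc y b \<beta>c intro!: pure_tensor_closed[OF V W])
    finally show ?thesis by simp
  qed
  have "t = (\<Oplus>\<^bsub>tensor K V W\<^esub>i\<in>{..<n}. F (pure_tensor K V W (v i) (w i)))"
    unfolding t_eq by (rule T.M.finsum_cong') (auto simp: Fp v w pure_tensor_closed[OF V W])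
  also have "\<dots> = F t"
    unfolding t_eq
    by (rule linear_map_finsum[OF F, symmetric]) (simp add: v w pure_tensor_closed[OF V W])
  also have "\<dots> = \<zero>\<^bsub>tensor K V W\<^esub>"
    using linear_map_zero[OF bilinear_mapD(1)[OF pure_tensor_bilinear[OF V W] b]]
    by (simp add: F_def zero[OF \<beta>])
  finally show ?thesis .
qed

text \<open>Slicing by \<phi> leaves vectors of W, which functionals on W separate. The slices in
  turn separate tensors.\<close>

lemma tensor_functionals_separate:
  assumes V: "vectorspace K V" and W: "vectorspace K W"
    and xy: "x \<in> carrier (tensor K V W)" "y \<in> carrier (tensor K V W)"
    and eq: "\<And>\<phi> \<psi>. \<phi> \<in> carrier (dual_space K V) \<Longrightarrow> \<psi> \<in> carrier (dual_space K W) \<Longrightarrow>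
      tensor_functional K V W \<phi> \<psi> x = tensor_functional K V W \<phi> \<psi> y"
  shows "x = y"
proof -
  interpret T: vectorspace K "tensor K V W" by (rule vectorspace_tensor[OF V W])
  interpret W: vectorspace K W by fact
  have "x \<ominus>\<^bsub>tensor K V W\<^esub> y = \<zero>\<^bsub>tensor K V W\<^esub>"
  proof (rule contract_left_separates[OF V W])
    fix \<phi> assume \<phi>: "\<phi> \<in> carrier (dual_space K V)"
    note c = contract_left(1)[OF V W dual_space_linear[OF \<phi>]]
    have "contract_left K V W \<phi> x = contract_left K V W \<phi> y"
      using \<phi> xy
      by (intro functionals_separate[OF W] linear_mapD(1)[OF c])
        (simp_all add: functional_contract_left[OF V W] dual_space_linear eq)
    then show "contract_left K V W \<phi> (x \<ominus>\<^bsub>tensor K V W\<^esub> y) = \<zero>\<^bsub>W\<^esub>"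
      using xy linear_mapD(1)[OF c] by (simp add: linear_map_minus[OF c] W.M.minus_eq W.M.r_neg)
  qed (use xy in simp)
  then show ?thesis using xy by simp
qed

text \<open>Separation with two factors would test with every functional on U \<otimes> V. Slicing
  off the third factor shows that products \<phi> \<otimes> \<psi> are enough there.\<close>

lemma tensor3_functionals_separate:
  assumes U: "vectorspace K U" and V: "vectorspace K V" and W: "vectorspace K W"
    and xy: "x \<in> carrier (tensor K (tensor K U V) W)" "y \<in> carrier (tensor K (tensor K U V) W)"
    and eq: "\<And>\<phi> \<psi> \<chi>. \<phi> \<in> carrier (dual_space K U) \<Longrightarrow> \<psi> \<in> carrier (dual_space K V) \<Longrightarrow>
      \<chi> \<in> carrier (dual_space K W) \<Longrightarrow>
      tensor_functional K (tensor K U V) W (tensor_functional K U V \<phi> \<psi>) \<chi> x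
        = tensor_functional K (tensor K U V) W (tensor_functional K U V \<phi> \<psi>) \<chi> y"
  shows "x = y"
proof (rule tensor_functionals_separate[OF vectorspace_tensor[OF U V] W xy])
  fix \<Phi> \<chi> assume \<Phi>: "\<Phi> \<in> carrier (dual_space K (tensor K U V))" and \<chi>: "\<chi> \<in> carrier (dual_space K W)"
  note UV = vectorspace_tensor[OF U V]
  note c = contract_right(1)[OF UV W dual_space_linear[OF \<chi>]]
  note fc = functional_contract_right[OF UV W _ dual_space_linear[OF \<chi>]]
  have "contract_right K (tensor K U V) W \<chi> x = contract_right K (tensor K U V) W \<chi> y"
    using xy eq[OF _ _ \<chi>]
    by (intro tensor_functionals_separate[OF U V] linear_mapD(1)[OF c])
      (simp_all add: fc dual_space_linear tensor_functional(1)[OF U V])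
  then show "tensor_functional K (tensor K U V) W \<Phi> \<chi> x = tensor_functional K (tensor K U V) W \<Phi> \<chi> y"
    using fc[OF dual_space_linear[OF \<Phi>]] xy by metis
qed

section \<open>Canonical maps\<close>

lemma tensor_map:
  assumes V: "vectorspace K V" and W: "vectorspace K W"
    and f: "linear_map K V V' f" and g: "linear_map K W W' g"
  shows "linear_map K (tensor K V W) (tensor K V' W') (tensor_map K V W V' W' f g)"
    and "v \<in> carrier V \<Longrightarrow> w \<in> carrier W \<Longrightarrow>
      tensor_map K V W V' W' f g (pure_tensor K V W v w) = pure_tensor K V' W' (f v) (g w)"
proof -
  note V' = linear_map.axioms(2)[OF f] and W' = linear_map.axioms(2)[OF g]
  have "bilinear_map K V W (tensor K V' W') (\<lambda>v w. pure_tensor K V' W' (f v) (g w))"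
    by (intro bilinear_mapI linear_map_pure_left linear_map_pure_right f g V' W'
        linear_mapD(1)[OF f] linear_mapD(1)[OF g])
  note * = tensor_lift[OF V W vectorspace_tensor[OF V' W'] this]
  show "linear_map K (tensor K V W) (tensor K V' W') (tensor_map K V W V' W' f g)"
    and "v \<in> carrier V \<Longrightarrow> w \<in> carrier W \<Longrightarrow>
      tensor_map K V W V' W' f g (pure_tensor K V W v w) = pure_tensor K V' W' (f v) (g w)"
    unfolding tensor_map_def by (rule *(1), rule *(3))
qed

lemma twist:
  assumes V: "vectorspace K V" and W: "vectorspace K W"
  shows "linear_map K (tensor K V W) (tensor K W V) (twist K V W)"
    and "v \<in> carrier V \<Longrightarrow> w \<in> carrier W \<Longrightarrow>
      twist K V W (pure_tensor K V W v w) = pure_tensor K W V w v"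
proof -
  have "bilinear_map K V W (tensor K W V) (\<lambda>v w. pure_tensor K W V w v)"
    by (intro bilinear_mapI linear_map_pure_left linear_map_pure_right linear_map_id V W)
  note * = tensor_lift[OF V W vectorspace_tensor[OF W V] this]
  show "linear_map K (tensor K V W) (tensor K W V) (twist K V W)"
    and "v \<in> carrier V \<Longrightarrow> w \<in> carrier W \<Longrightarrow>
      twist K V W (pure_tensor K V W v w) = pure_tensor K W V w v"
    unfolding twist_def by (rule *(1), rule *(3))
qed

text \<open>This is the inner lift of \<open>assoc_left\<close>: tensoring with u on the left,
  followed by rebracketing. It has a name because its values at tensors that are not given as pure
  ones, such as coproducts, are needed.\<close>

definition pure_tensor_left_assoc ::
  "('k, 'r) ring_scheme \<Rightarrow> ('k, 'u, 'l) module_scheme \<Rightarrow> ('k, 'v, 'm) module_scheme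
    \<Rightarrow> ('k, 'w, 'n) module_scheme \<Rightarrow> 'u
    \<Rightarrow> ('v \<times> 'w \<Rightarrow> 'k) set \<Rightarrow> (('u \<times> 'v \<Rightarrow> 'k) set \<times> 'w \<Rightarrow> 'k) set" where
  "pure_tensor_left_assoc K U V W u = tensor_lift K V W (tensor K (tensor K U V) W)
     (\<lambda>v w. pure_tensor K (tensor K U V) W (pure_tensor K U V u v) w)"

lemma pure_tensor_left_assoc:
  assumes U: "vectorspace K U" and V: "vectorspace K V" and W: "vectorspace K W"
    and u: "u \<in> carrier U"
  shows "linear_map K (tensor K V W) (tensor K (tensor K U V) W) (pure_tensor_left_assoc K U V W u)"
    and "v \<in> carrier V \<Longrightarrow> w \<in> carrier W \<Longrightarrow>
      pure_tensor_left_assoc K U V W u (pure_tensor K V W v w)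
        = pure_tensor K (tensor K U V) W (pure_tensor K U V u v) w"
    and "bilinear_map K V W (tensor K (tensor K U V) W)
      (\<lambda>v w. pure_tensor K (tensor K U V) W (pure_tensor K U V u v) w)"
proof -
  note UV = vectorspace_tensor[OF U V]
  show b: "bilinear_map K V W (tensor K (tensor K U V) W)
      (\<lambda>v w. pure_tensor K (tensor K U V) W (pure_tensor K U V u v) w)"
    by (intro bilinear_mapI linear_map_pure_left linear_map_pure_right linear_map_id U V W UV
        pure_tensor_closed u)
  note * = tensor_lift[OF V W vectorspace_tensor[OF UV W] b]
  show "linear_map K (tensor K V W) (tensor K (tensor K U V) W) (pure_tensor_left_assoc K U V W u)"
    and "v \<in> carrier V \<Longrightarrow> w \<in> carrier W \<Longrightarrow>
      pure_tensor_left_assoc K U V W u (pure_tensor K V W v w)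
        = pure_tensor K (tensor K U V) W (pure_tensor K U V u v) w"
    unfolding pure_tensor_left_assoc_def by (rule *(1), rule *(3))
qed

text \<open>The delicate point is linearity in u of a lift evaluated at a fixed t that need not be
  pure. It comes from \<open>linear_map_tensor_lift\<close>.\<close>

lemma assoc_left:
  assumes U: "vectorspace K U" and V: "vectorspace K V" and W: "vectorspace K W"
  shows "linear_map K (tensor K U (tensor K V W)) (tensor K (tensor K U V) W) (assoc_left K U V W)"
    and "u \<in> carrier U \<Longrightarrow> t \<in> carrier (tensor K V W) \<Longrightarrow>
      assoc_left K U V W (pure_tensor K U (tensor K V W) u t) = pure_tensor_left_assoc K U V W u t"
proof -
  note UV = vectorspace_tensor[OF U V] and VW = vectorspace_tensor[OF V W]
  note T = vectorspace_tensor[OF UV W]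
  have "bilinear_map K U (tensor K V W) (tensor K (tensor K U V) W) (pure_tensor_left_assoc K U V W)"
  proof (rule bilinear_mapI)
    fix t assume t: "t \<in> carrier (tensor K V W)"
    show "linear_map K U (tensor K (tensor K U V) W) (\<lambda>u. pure_tensor_left_assoc K U V W u t)"
      unfolding pure_tensor_left_assoc_def
      by (intro linear_map_tensor_lift V W T U t pure_tensor_left_assoc(3) linear_map_pure_left
          linear_map_id)
  qed (rule pure_tensor_left_assoc(1)[OF U V W])
  note * = tensor_lift[OF U VW T this, unfolded pure_tensor_left_assoc_def]
  show "linear_map K (tensor K U (tensor K V W)) (tensor K (tensor K U V) W) (assoc_left K U V W)"
    and "u \<in> carrier U \<Longrightarrow> t \<in> carrier (tensor K V W) \<Longrightarrow>
      assoc_left K U V W (pure_tensor K U (tensor K V W) u t) = pure_tensor_left_assoc K U V W u t"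
    unfolding assoc_left_def pure_tensor_left_assoc_def by (rule *(1), rule *(3))
qed

section \<open>The canonical map from the tensor product of duals to the dual of the tensor
  product\<close>

lemma dual_space_eqI:
  assumes "\<phi> \<in> carrier (dual_space K V)" "\<psi> \<in> carrier (dual_space K V)"
    "\<And>v. v \<in> carrier V \<Longrightarrow> \<phi> v = \<psi> v"
  shows "\<phi> = \<psi>"
  using assms by (auto simp: dual_space_iff intro: extensionalityI[of _ "carrier V"])

text \<open>Linearity in each functional is reduced by \<open>linear_map_dualI\<close> to evaluation
  at a fixed t, and then by \<open>linear_map_tensor_lift\<close> to pure tensors.\<close>

lemma dual_tensor:
  assumes V: "vectorspace K V" and W: "vectorspace K W"
  shows "linear_map K (tensor K (dual_space K V) (dual_space K W)) (dual_space K (tensor K V W))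
      (dual_tensor K V W)"
    and "\<phi> \<in> carrier (dual_space K V) \<Longrightarrow> \<psi> \<in> carrier (dual_space K W) \<Longrightarrow>
      dual_tensor K V W (pure_tensor K (dual_space K V) (dual_space K W) \<phi> \<psi>)
        = tensor_functional K V W \<phi> \<psi>"
proof -
  note D = vectorspace_dual_space[OF V] vectorspace_dual_space[OF W]
  note T = vectorspace_tensor[OF V W]
  interpret V: vectorspace K V by (rule V)
  have F: "vectorspace K (field_space K)" by (rule vectorspace_field_space[OF V.field_axioms])
  have "bilinear_map K (dual_space K V) (dual_space K W) (dual_space K (tensor K V W))
    (tensor_functional K V W)"
  proof (intro bilinear_mapI linear_map_dualI D T)
    fix \<phi> t assume \<phi>: "\<phi> \<in> carrier (dual_space K V)" and t: "t \<in> carrier (tensor K V W)"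
    show "linear_map K (dual_space K W) (field_space K) (\<lambda>\<psi>. tensor_functional K V W \<phi> \<psi> t)"
      unfolding tensor_functional_def
    proof (rule linear_map_tensor_lift[OF V W F D(2) t])
      fix v w assume "v \<in> carrier V" "w \<in> carrier W"
      then show "linear_map K (dual_space K W) (field_space K) (\<lambda>\<psi>. \<phi> v \<otimes>\<^bsub>K\<^esub> \<psi> w)"
        by (intro linear_map_mult_const linear_map_eval W dual_space_closed[OF \<phi>])
    qed (rule tensor_functional_bilinear[OF dual_space_linear[OF \<phi>] dual_space_linear])
  next
    fix \<psi> t assume \<psi>: "\<psi> \<in> carrier (dual_space K W)" and t: "t \<in> carrier (tensor K V W)"
    show "linear_map K (dual_space K V) (field_space K) (\<lambda>\<phi>. tensor_functional K V W \<phi> \<psi> t)"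
      unfolding tensor_functional_def
    proof (rule linear_map_tensor_lift[OF V W F D(1) t])
      fix v w assume "v \<in> carrier V" "w \<in> carrier W"
      then show "linear_map K (dual_space K V) (field_space K) (\<lambda>\<phi>. \<phi> v \<otimes>\<^bsub>K\<^esub> \<psi> w)"
        by (intro linear_map_mult_left linear_map_eval V dual_space_closed[OF \<psi>])
    qed (rule tensor_functional_bilinear[OF dual_space_linear dual_space_linear[OF \<psi>]])
  qed (rule tensor_functional(1)[OF V W dual_space_linear dual_space_linear]; assumption)+
  note * = tensor_lift[OF D vectorspace_dual_space[OF T] this, unfolded tensor_functional_def]
  show "linear_map K (tensor K (dual_space K V) (dual_space K W)) (dual_space K (tensor K V W))
      (dual_tensor K V W)"
    and "\<phi> \<in> carrier (dual_space K V) \<Longrightarrow> \<psi> \<in> carrier (dual_space K W) \<Longrightarrow>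
      dual_tensor K V W (pure_tensor K (dual_space K V) (dual_space K W) \<phi> \<psi>)
        = tensor_functional K V W \<phi> \<psi>"
    unfolding dual_tensor_def tensor_functional_def by (rule *(1), rule *(3))
qed

lemma linear_map_dual_tensor_eval:
  assumes V: "vectorspace K V" and W: "vectorspace K W" and x: "x \<in> carrier (tensor K V W)"
  shows "linear_map K (tensor K (dual_space K V) (dual_space K W)) (field_space K)
    (\<lambda>t. dual_tensor K V W t x)"
  by (rule linear_map_comp[OF dual_tensor(1)[OF V W] linear_map_eval[OF vectorspace_tensor[OF V W] x]])

text \<open>The slices of t by evaluations are thus determined by the functional
  \<open>dual_tensor K V W t\<close>, and injectivity of \<open>dual_tensor\<close> rests on
  this.\<close>

lemma contract_left_eval:
  assumes V: "vectorspace K V" and W: "vectorspace K W"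
    and t: "t \<in> carrier (tensor K (dual_space K V) (dual_space K W))"
    and v: "v \<in> carrier V" and w: "w \<in> carrier W"
  shows "contract_left K (dual_space K V) (dual_space K W) (\<lambda>\<phi>. \<phi> v) t w
    = dual_tensor K V W t (pure_tensor K V W v w)"
proof (rule linear_map_eq_tensor[OF _ _ _ _ _ t,
      where f = "\<lambda>t. contract_left K (dual_space K V) (dual_space K W) (\<lambda>\<phi>. \<phi> v) t w"])
  note D = vectorspace_dual_space[OF V] vectorspace_dual_space[OF W]
  note c = contract_left[OF D linear_map_eval[OF V v]]
  show "vectorspace K (dual_space K V)" "vectorspace K (dual_space K W)" by (rule D)+
  show "linear_map K (tensor K (dual_space K V) (dual_space K W)) (field_space K)
    (\<lambda>t. contract_left K (dual_space K V) (dual_space K W) (\<lambda>\<phi>. \<phi> v) t w)"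
    by (rule linear_map_comp[OF c(1) linear_map_eval[OF W w]])
  show "linear_map K (tensor K (dual_space K V) (dual_space K W)) (field_space K)
    (\<lambda>t. dual_tensor K V W t (pure_tensor K V W v w))"
    by (rule linear_map_dual_tensor_eval[OF V W pure_tensor_closed[OF V W v w]])
  fix \<phi> \<psi> assume *: "\<phi> \<in> carrier (dual_space K V)" "\<psi> \<in> carrier (dual_space K W)"
  show "contract_left K (dual_space K V) (dual_space K W) (\<lambda>\<phi>. \<phi> v)
      (pure_tensor K (dual_space K V) (dual_space K W) \<phi> \<psi>) w
    = dual_tensor K V W (pure_tensor K (dual_space K V) (dual_space K W) \<phi> \<psi>) (pure_tensor K V W v w)"
    using * v w
    by (simp add: c(2) dual_tensor(2)[OF V W] dual_space_smult[OF W]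
        tensor_functional(2)[OF V W] dual_space_linear)
qed

text \<open>The operator F below sends t to the sum of the \<beta> i tensored with the slices of t
  by evaluation at b i. It is the identity, and by \<open>contract_left_eval\<close> its value
  depends on t only through \<open>dual_tensor\<close>.\<close>

lemma dual_tensor_inj:
  assumes V: "vectorspace K V" and W: "vectorspace K W" and fin: "vectorspace.fin_dim K V"
    and st: "s \<in> carrier (tensor K (dual_space K V) (dual_space K W))"
      "t \<in> carrier (tensor K (dual_space K V) (dual_space K W))"
    and eq: "dual_tensor K V W s = dual_tensor K V W t"
  shows "s = t"
proof -
  let ?V = "dual_space K V" and ?W = "dual_space K W"
  let ?T = "tensor K ?V ?W"
  note D = vectorspace_dual_space[OF V] vectorspace_dual_space[OF W]
  have T: "vectorspace K ?T" by (rule vectorspace_tensor[OF D])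
  interpret V: vectorspace K V by (rule V)
  interpret DV: vectorspace K ?V by (rule D)
  interpret T: vectorspace K ?T by (rule T)
  obtain n :: nat and b \<beta> where b: "\<And>i. b i \<in> carrier V" and \<beta>: "\<And>i. \<beta> i \<in> carrier ?V"
    and basis: "\<And>x. x \<in> carrier V \<Longrightarrow> (\<Oplus>\<^bsub>V\<^esub>i\<in>{..<n}. \<beta> i x \<odot>\<^bsub>V\<^esub> b i) = x"
    by (rule finite_dual_basis[OF V fin]) (rule that)
  define c where "c i = contract_left K ?V ?W (\<lambda>\<phi>. \<phi> (b i))" for i
  have c: "linear_map K ?T ?W (c i)" for i
    unfolding c_def by (rule contract_left(1)[OF D linear_map_eval[OF V b]])
  define F where "F t = (\<Oplus>\<^bsub>?T\<^esub>i\<in>{..<n}. pure_tensor K ?V ?W (\<beta> i) (c i t))" for t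
  have F: "linear_map K ?T ?T F"
    unfolding F_def by (intro linear_map_sum T linear_map_pure_right c D \<beta>) simp
  have F_id: "F t = t" if "t \<in> carrier ?T" for t
  proof (rule linear_map_eq_tensor[OF D F linear_map_id[OF T] _ that])
    fix \<phi> \<psi> assume \<phi>: "\<phi> \<in> carrier ?V" and \<psi>: "\<psi> \<in> carrier ?W"
    note pl = bilinear_mapD(2)[OF pure_tensor_bilinear[OF D] \<psi>]
    note pr = bilinear_mapD(1)[OF pure_tensor_bilinear[OF D] \<beta>]
    note \<phi>b = dual_space_closed[OF \<phi> b]
    \<comment> \<open>The \<beta> i span the dual: expand v in the b i and apply \<phi>.\<close>
    have sum: "(\<Oplus>\<^bsub>?V\<^esub>i\<in>{..<n}. \<phi> (b i) \<odot>\<^bsub>?V\<^esub> \<beta> i) = \<phi>"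
    proof (rule dual_space_eqI[OF _ \<phi>])
      show "(\<Oplus>\<^bsub>?V\<^esub>i\<in>{..<n}. \<phi> (b i) \<odot>\<^bsub>?V\<^esub> \<beta> i) \<in> carrier ?V"
        using \<phi>b \<beta> by (intro DV.M.finsum_closed) auto
      fix v assume v: "v \<in> carrier V"
      have F: "vectorspace K (field_space K)" by (rule vectorspace_field_space[OF V.field_axioms])
      interpret F: vectorspace K "field_space K" by (rule F)
      have "(\<Oplus>\<^bsub>?V\<^esub>i\<in>{..<n}. \<phi> (b i) \<odot>\<^bsub>?V\<^esub> \<beta> i) v
        = (\<Oplus>\<^bsub>field_space K\<^esub>i\<in>{..<n}. (\<phi> (b i) \<odot>\<^bsub>?V\<^esub> \<beta> i) v)"
        by (rule linear_map_finsum[OF linear_map_eval[OF V v]]) (simp add: \<phi>b \<beta>)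
      also have "\<dots> = (\<Oplus>\<^bsub>field_space K\<^esub>i\<in>{..<n}. \<phi> (\<beta> i v \<odot>\<^bsub>V\<^esub> b i))"
        using dual_space_closed[OF \<beta> v] v b \<phi>b
        by (intro F.M.finsum_cong')
          (auto simp: dual_space_smult[OF V] linear_mapD(3)[OF dual_space_linear[OF \<phi>]] V.R.m_comm)
      also have "\<dots> = \<phi> (\<Oplus>\<^bsub>V\<^esub>i\<in>{..<n}. \<beta> i v \<odot>\<^bsub>V\<^esub> b i)"
        by (rule linear_map_finsum[OF dual_space_linear[OF \<phi>], symmetric])
          (simp add: dual_space_closed[OF \<beta> v] b)
      finally show "(\<Oplus>\<^bsub>?V\<^esub>i\<in>{..<n}. \<phi> (b i) \<odot>\<^bsub>?V\<^esub> \<beta> i) v = \<phi> v" by (simp add: basis[OF v])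
    qed
    have "F (pure_tensor K ?V ?W \<phi> \<psi>) = (\<Oplus>\<^bsub>?T\<^esub>i\<in>{..<n}. pure_tensor K ?V ?W (\<phi> (b i) \<odot>\<^bsub>?V\<^esub> \<beta> i) \<psi>)"
      unfolding F_def c_def
      by (rule T.M.finsum_cong')
        (auto simp: linear_mapD(3)[OF pl] linear_mapD(3)[OF pr] contract_left(2)[OF D linear_map_eval[OF V b]]
          \<phi> \<psi> \<phi>b \<beta> pure_tensor_closed[OF D])
    also have "\<dots> = pure_tensor K ?V ?W (\<Oplus>\<^bsub>?V\<^esub>i\<in>{..<n}. \<phi> (b i) \<odot>\<^bsub>?V\<^esub> \<beta> i) \<psi>"
      by (rule linear_map_finsum[OF pl, symmetric]) (simp add: \<phi>b \<beta>)
    finally show "F (pure_tensor K ?V ?W \<phi> \<psi>) = pure_tensor K ?V ?W \<phi> \<psi>" by (simp add: sum)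
  qed
  have c_eval: "c i t w = dual_tensor K V W t (pure_tensor K V W (b i) w)"
    if "t \<in> carrier ?T" "w \<in> carrier W" for i t w
    unfolding c_def by (rule contract_left_eval[OF V W that(1) b that(2)])
  have "c i s = c i t" for i
    by (rule dual_space_eqI[OF linear_mapD(1)[OF c] linear_mapD(1)[OF c]])
      (simp_all add: c_eval st eq)
  then have "F s = F t" by (simp add: F_def)
  then show ?thesis by (simp add: F_id st)
qed

text \<open>Expanding v as the sum of the \<beta> i v times b i inside f (v \<otimes> w) exhibits
  the preimage: the sum of the \<beta> i tensored with the functionals f (b i \<otimes> -).\<close>

lemma dual_tensor_surj:
  assumes V: "vectorspace K V" and W: "vectorspace K W" and fin: "vectorspace.fin_dim K V"
    and f: "f \<in> carrier (dual_space K (tensor K V W))"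
  obtains t where "t \<in> carrier (tensor K (dual_space K V) (dual_space K W))" "dual_tensor K V W t = f"
proof -
  let ?V = "dual_space K V" and ?W = "dual_space K W"
  let ?T = "tensor K ?V ?W"
  note D = vectorspace_dual_space[OF V] vectorspace_dual_space[OF W]
  have T: "vectorspace K ?T" by (rule vectorspace_tensor[OF D])
  note VW = vectorspace_tensor[OF V W]
  interpret V: vectorspace K V by (rule V)
  interpret T: vectorspace K ?T by (rule T)
  have F: "vectorspace K (field_space K)" by (rule vectorspace_field_space[OF V.field_axioms])
  interpret F: vectorspace K "field_space K" by (rule F)
  obtain n :: nat and b \<beta> where b: "\<And>i. b i \<in> carrier V" and \<beta>: "\<And>i. \<beta> i \<in> carrier ?V"
    and basis: "\<And>x. x \<in> carrier V \<Longrightarrow> (\<Oplus>\<^bsub>V\<^esub>i\<in>{..<n}. \<beta> i x \<odot>\<^bsub>V\<^esub> b i) = x"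
    by (rule finite_dual_basis[OF V fin]) (rule that)
  note fl = dual_space_linear[OF f]
  define g where "g i = (\<lambda>w\<in>carrier W. f (pure_tensor K V W (b i) w))" for i
  have g: "g i \<in> carrier ?W" for i
    unfolding g_def
    by (intro restrict_in_dual_space linear_map_comp[OF linear_map_pure_right[OF linear_map_id[OF W] V b] fl])
  have g_eval: "g i w = f (pure_tensor K V W (b i) w)" if "w \<in> carrier W" for i w
    using that by (simp add: g_def)
  define t where "t = (\<Oplus>\<^bsub>?T\<^esub>i\<in>{..<n}. pure_tensor K ?V ?W (\<beta> i) (g i))"
  have t: "t \<in> carrier ?T" unfolding t_def
    by (intro T.M.finsum_closed) (auto intro: pure_tensor_closed[OF D] \<beta> g)
  note tl = dual_space_linear[OF linear_mapD(1)[OF dual_tensor(1)[OF V W] t]]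
  have "dual_tensor K V W t = f"
  proof (rule dual_space_eqI[OF linear_mapD(1)[OF dual_tensor(1)[OF V W] t] f])
    fix x assume x: "x \<in> carrier (tensor K V W)"
    show "dual_tensor K V W t x = f x"
    proof (rule linear_map_eq_tensor[OF V W tl fl _ x])
      fix v w assume v: "v \<in> carrier V" and w: "w \<in> carrier W"
      note vw = pure_tensor_closed[OF V W v w]
      note pl = linear_map_comp[OF bilinear_mapD(2)[OF pure_tensor_bilinear[OF V W] w] fl]
      have "dual_tensor K V W t (pure_tensor K V W v w)
        = (\<Oplus>\<^bsub>field_space K\<^esub>i\<in>{..<n}. dual_tensor K V W (pure_tensor K ?V ?W (\<beta> i) (g i)) (pure_tensor K V W v w))"
        unfolding t_def
        by (rule linear_map_finsum[OF linear_map_dual_tensor_eval[OF V W vw]])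
          (simp add: pure_tensor_closed[OF D] \<beta> g)
      also have "\<dots> = (\<Oplus>\<^bsub>field_space K\<^esub>i\<in>{..<n}. f (pure_tensor K V W (\<beta> i v \<odot>\<^bsub>V\<^esub> b i) w))"
        using dual_space_closed[OF \<beta> v] v w b linear_functional_closed[OF fl] pure_tensor_closed[OF V W]
        by (intro F.M.finsum_cong')
          (auto simp: linear_mapD(3)[OF pl] dual_tensor(2)[OF V W \<beta> g] g_eval
            tensor_functional(2)[OF V W dual_space_linear[OF \<beta>] dual_space_linear[OF g]])
      also have "\<dots> = f (pure_tensor K V W (\<Oplus>\<^bsub>V\<^esub>i\<in>{..<n}. \<beta> i v \<odot>\<^bsub>V\<^esub> b i) w)"
        by (rule linear_map_finsum[OF pl, symmetric]) (simp add: dual_space_closed[OF \<beta> v] b)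
      finally show "dual_tensor K V W t (pure_tensor K V W v w) = f (pure_tensor K V W v w)"
        by (simp add: basis[OF v])
    qed
  qed
  then show thesis by (rule that[OF t])
qed

text \<open>Bijectivity of \<open>dual_tensor\<close> makes the \<open>THE\<close> in
  \<open>mul_dual\<close> denote. The element is in general not pure and is accessible only through
  its pairings with A \<otimes> A.\<close>

lemma mul_dual:
  assumes A: "vectorspace K A" and fin: "vectorspace.fin_dim K A"
    and \<mu>: "linear_map K (tensor2 K A) A \<mu>" and \<phi>: "\<phi> \<in> carrier (dual_space K A)"
  shows "mul_dual K A \<mu> \<phi> \<in> carrier (tensor2 K (dual_space K A))"
    and "x \<in> carrier (tensor2 K A) \<Longrightarrow> dual_tensor K A A (mul_dual K A \<mu> \<phi>) x = \<phi> (\<mu> x)"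
proof -
  let ?f = "\<lambda>x\<in>carrier (tensor2 K A). \<phi> (\<mu> x)"
  let ?P = "\<lambda>t. t \<in> carrier (tensor2 K (dual_space K A)) \<and> dual_tensor K A A t = ?f"
  have f: "?f \<in> carrier (dual_space K (tensor2 K A))"
    by (rule restrict_in_dual_space[OF linear_map_comp[OF \<mu> dual_space_linear[OF \<phi>]]])
  obtain t where t: "?P t" by (rule dual_tensor_surj[OF A A fin f]) (rule that, rule conjI)
  have "?P (THE t. ?P t)"
    using t dual_tensor_inj[OF A A fin] by (intro theI[of ?P t]) auto
  then have P: "?P (mul_dual K A \<mu> \<phi>)" by (simp add: mul_dual_def)
  then show "mul_dual K A \<mu> \<phi> \<in> carrier (tensor2 K (dual_space K A))" by blast
  show "x \<in> carrier (tensor2 K A) \<Longrightarrow> dual_tensor K A A (mul_dual K A \<mu> \<phi>) x = \<phi> (\<mu> x)"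
    using P by simp
qed

section \<open>Sums in vector spaces\<close>

text \<open>The rules on sums here take the space as a premise, so that they apply to tensor powers
  and to \<open>field_space K\<close> without a separate interpretation of each.\<close>

lemma vectorspace_finsum_cong:
  assumes "vectorspace K V" "\<And>i. i \<in> I \<Longrightarrow> f i = g i" "\<And>i. i \<in> I \<Longrightarrow> g i \<in> carrier V"
  shows "finsum V f I = finsum V g I"
proof -
  interpret V: vectorspace K V by fact
  show ?thesis using assms(2,3) by (intro V.M.finsum_cong') auto
qed

lemma vectorspace_finsum_closed:
  assumes "vectorspace K V" "\<And>i. i \<in> I \<Longrightarrow> f i \<in> carrier V"
  shows "finsum V f I \<in> carrier V"
proof -
  interpret V: vectorspace K V by fact
  show ?thesis using assms(2) by (intro V.M.finsum_closed) auto
qed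

lemma vectorspace_finsum_diff:
  assumes "vectorspace K V" "\<And>i. i \<in> I \<Longrightarrow> f i \<in> carrier V" "\<And>i. i \<in> I \<Longrightarrow> g i \<in> carrier V"
  shows "(\<Oplus>\<^bsub>V\<^esub>i\<in>I. f i \<ominus>\<^bsub>V\<^esub> g i) = (\<Oplus>\<^bsub>V\<^esub>i\<in>I. f i) \<ominus>\<^bsub>V\<^esub> (\<Oplus>\<^bsub>V\<^esub>i\<in>I. g i)"
proof -
  interpret V: vectorspace K V by fact
  note cl = vectorspace_finsum_closed[OF assms(1)]
  have "(\<Oplus>\<^bsub>V\<^esub>i\<in>I. f i \<ominus>\<^bsub>V\<^esub> g i) \<oplus>\<^bsub>V\<^esub> (\<Oplus>\<^bsub>V\<^esub>i\<in>I. g i) = (\<Oplus>\<^bsub>V\<^esub>i\<in>I. (f i \<ominus>\<^bsub>V\<^esub> g i) \<oplus>\<^bsub>V\<^esub> g i)"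
    using assms by (intro V.M.finsum_addf[symmetric]) auto
  also have "\<dots> = (\<Oplus>\<^bsub>V\<^esub>i\<in>I. f i)"
    using assms by (intro V.M.finsum_cong') (auto simp: V.M.minus_eq V.M.a_assoc V.M.l_neg)
  finally have "(\<Oplus>\<^bsub>V\<^esub>i\<in>I. f i) = (\<Oplus>\<^bsub>V\<^esub>i\<in>I. f i \<ominus>\<^bsub>V\<^esub> g i) \<oplus>\<^bsub>V\<^esub> (\<Oplus>\<^bsub>V\<^esub>i\<in>I. g i)" ..
  moreover have "d = s \<ominus>\<^bsub>V\<^esub> t" if "s = d \<oplus>\<^bsub>V\<^esub> t" "d \<in> carrier V" "t \<in> carrier V" for s d t
    using that by (simp add: V.M.minus_eq V.M.a_assoc V.M.r_neg)
  ultimately show ?thesis using cl[of I g] cl[of I "\<lambda>i. f i \<ominus>\<^bsub>V\<^esub> g i"] assms by simp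
qed

lemma vectorspace_finsum_swap:
  assumes "vectorspace K V" "finite I" "finite J"
    "\<And>i j. i \<in> I \<Longrightarrow> j \<in> J \<Longrightarrow> f i j \<in> carrier V"
  shows "(\<Oplus>\<^bsub>V\<^esub>i\<in>I. \<Oplus>\<^bsub>V\<^esub>j\<in>J. f i j) = (\<Oplus>\<^bsub>V\<^esub>j\<in>J. \<Oplus>\<^bsub>V\<^esub>i\<in>I. f i j)"
proof -
  interpret V: vectorspace K V by fact
  show ?thesis using assms(2-4) by (rule V.M.finsum_swap)
qed

lemma bilinear_map_finsum:
  assumes \<beta>: "bilinear_map K V W U \<beta>" and U: "vectorspace K U" and W: "vectorspace K W"
    and x: "\<And>i. i \<in> I \<Longrightarrow> x i \<in> carrier V" and y: "\<And>j. j \<in> J \<Longrightarrow> y j \<in> carrier W"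
  shows "\<beta> (\<Oplus>\<^bsub>V\<^esub>i\<in>I. x i) (\<Oplus>\<^bsub>W\<^esub>j\<in>J. y j) = (\<Oplus>\<^bsub>U\<^esub>i\<in>I. \<Oplus>\<^bsub>U\<^esub>j\<in>J. \<beta> (x i) (y j))"
proof -
  have yc: "(\<Oplus>\<^bsub>W\<^esub>j\<in>J. y j) \<in> carrier W" by (rule vectorspace_finsum_closed[OF W y])
  have "\<beta> (\<Oplus>\<^bsub>V\<^esub>i\<in>I. x i) (\<Oplus>\<^bsub>W\<^esub>j\<in>J. y j) = (\<Oplus>\<^bsub>U\<^esub>i\<in>I. \<beta> (x i) (\<Oplus>\<^bsub>W\<^esub>j\<in>J. y j))"
    by (rule linear_map_finsum[OF bilinear_mapD(2)[OF \<beta> yc] x])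
  also have "\<dots> = (\<Oplus>\<^bsub>U\<^esub>i\<in>I. \<Oplus>\<^bsub>U\<^esub>j\<in>J. \<beta> (x i) (y j))"
    using x y linear_mapD(1)[OF bilinear_mapD(1)[OF \<beta>]]
    by (intro vectorspace_finsum_cong[OF U] linear_map_finsum[OF bilinear_mapD(1)[OF \<beta>]]
        vectorspace_finsum_closed[OF U]) simp_all
  finally show ?thesis .
qed

section \<open>Coboundary structures in terms of a presentation of \<open>r\<close>\<close>

text \<open>A presentation of r is fixed once. The expressions in r are defined without one, and
  each becomes a sum over the same index range, so that equations can be compared term by
  term.\<close>

locale presented_coboundary = coboundary_eps_hom_bialgebra K A \<mu> \<Delta> \<alpha> r
  for K :: "('k, 'r) ring_scheme" (structure)
    and A :: "('k, 'a, 'm) module_scheme" (structure)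
    and \<mu> \<Delta> \<alpha> r +
  fixes u v :: "nat \<Rightarrow> 'a" and n :: nat
  assumes u_closed: "u i \<in> carrier A" and v_closed: "v i \<in> carrier A"
    and r_eq: "r = (\<Oplus>\<^bsub>tensor2 K A\<^esub>i\<in>{..<n}. pure2 K A (u i) (v i))"
begin

lemmas A1 = vectorspace_axioms
lemmas A2 = vectorspace_tensor[OF A1 A1]
lemmas A3 = vectorspace_tensor[OF A2 A1]
lemmas FK = vectorspace_field_space[OF field_axioms]
lemmas DA = vectorspace_dual_space[OF A1]

abbreviation mul (infixl \<open>\<star>\<close> 70) where "a \<star> b \<equiv> \<mu> (pure2 K A a b)"

lemmas p2_closed = pure_tensor_closed[OF A1 A1]
lemmas p3_closed = pure_tensor_closed[OF A2 A1 p2_closed]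
lemmas alpha_closed = linear_mapD(1)[OF alpha_linear]
lemmas comul_closed = linear_mapD(1)[OF comul_linear]

lemma mul_closed: "a \<in> carrier A \<Longrightarrow> b \<in> carrier A \<Longrightarrow> a \<star> b \<in> carrier A"
  by (rule linear_mapD(1)[OF mul_linear p2_closed])

lemmas closed = p2_closed p3_closed alpha_closed mul_closed u_closed v_closed

lemma linear_mul_left:
  "linear_map K X A f \<Longrightarrow> b \<in> carrier A \<Longrightarrow> linear_map K X A (\<lambda>x. f x \<star> b)"
  by (rule linear_map_comp[OF linear_map_pure_left[OF _ A1] mul_linear])

lemma linear_mul_right:
  "linear_map K X A f \<Longrightarrow> a \<in> carrier A \<Longrightarrow> linear_map K X A (\<lambda>x. a \<star> f x)"
  by (rule linear_map_comp[OF linear_map_pure_right[OF _ A1] mul_linear])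

lemma linear_alpha: "linear_map K X A f \<Longrightarrow> linear_map K X A (\<lambda>x. \<alpha> (f x))"
  by (rule linear_map_comp[OF _ alpha_linear])

lemmas linear_intros = linear_map_id[OF A1] linear_map_pure_left linear_map_pure_right
  linear_mul_left linear_mul_right linear_alpha linear_map_diff A1 A2

lemma lift_r:
  assumes "vectorspace K U" "bilinear_map K A A U \<beta>"
  shows "tensor_lift K A A U \<beta> r = (\<Oplus>\<^bsub>U\<^esub>i\<in>{..<n}. \<beta> (u i) (v i))"
  unfolding r_eq by (rule tensor_lift_finsum[OF A1 A1 assms u_closed v_closed])

text \<open>The lift over the inner copy of r has to be bilinear in the outer pair. Hence the second
  bilinearity hypothesis, which holds the inner pair fixed.\<close>

lemma lift_r_r:
  assumes U: "vectorspace K U"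
    and inner: "\<And>a b. a \<in> carrier A \<Longrightarrow> b \<in> carrier A \<Longrightarrow> bilinear_map K A A U (\<beta> a b)"
    and outer: "\<And>a b. a \<in> carrier A \<Longrightarrow> b \<in> carrier A \<Longrightarrow> bilinear_map K A A U (\<lambda>c d. \<beta> c d a b)"
  shows "tensor_lift K A A U (\<lambda>a b. tensor_lift K A A U (\<beta> a b) r) r
    = (\<Oplus>\<^bsub>U\<^esub>i\<in>{..<n}. \<Oplus>\<^bsub>U\<^esub>j\<in>{..<n}. \<beta> (u i) (v i) (u j) (v j))"
proof -
  have "bilinear_map K A A U (\<lambda>a b. tensor_lift K A A U (\<beta> a b) r)"
    by (intro bilinear_mapI linear_map_tensor_lift A1 U r_closed inner
        bilinear_mapD(1)[OF outer] bilinear_mapD(2)[OF outer])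
  then show ?thesis
    using inner linear_mapD(1)[OF bilinear_mapD(1)[OF inner]] u_closed v_closed
    by (simp add: lift_r[OF U])
qed

lemma comul_sum:
  assumes a: "a \<in> carrier A"
  shows "\<Delta> a = (\<Oplus>\<^bsub>tensor2 K A\<^esub>i\<in>{..<n}. pure2 K A (a \<star> u i) (\<alpha> (v i))
    \<ominus>\<^bsub>tensor2 K A\<^esub> pure2 K A (\<alpha> (u i)) (v i \<star> a))"
  unfolding comul_eq[OF a] star_bracket_def
  by (rule lift_r[OF A2]) (intro bilinear_mapI linear_intros closed a)

lemma r13_r12_sum:
  "r13_r12 K A \<mu> \<alpha> r = (\<Oplus>\<^bsub>tensor3 K A\<^esub>i\<in>{..<n}. \<Oplus>\<^bsub>tensor3 K A\<^esub>j\<in>{..<n}.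
    pure3 K A (u i \<star> u j) (\<alpha> (v j)) (\<alpha> (v i)))"
  unfolding r13_r12_def
  by (rule lift_r_r[OF A3]; intro bilinear_mapI linear_intros closed; assumption)

lemma r12_r23_sum:
  "r12_r23 K A \<mu> \<alpha> r = (\<Oplus>\<^bsub>tensor3 K A\<^esub>i\<in>{..<n}. \<Oplus>\<^bsub>tensor3 K A\<^esub>j\<in>{..<n}.
    pure3 K A (\<alpha> (u i)) (v i \<star> u j) (\<alpha> (v j)))"
  unfolding r12_r23_def
  by (rule lift_r_r[OF A3]; intro bilinear_mapI linear_intros closed; assumption)

lemma r23_r13_sum:
  "r23_r13 K A \<mu> \<alpha> r = (\<Oplus>\<^bsub>tensor3 K A\<^esub>i\<in>{..<n}. \<Oplus>\<^bsub>tensor3 K A\<^esub>j\<in>{..<n}.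
    pure3 K A (\<alpha> (u j)) (\<alpha> (u i)) (v i \<star> v j))"
  unfolding r23_r13_def
  by (rule lift_r_r[OF A3]; intro bilinear_mapI linear_intros closed; assumption)

lemma comul_left_sum:
  "comul_left K A \<Delta> \<alpha> r = (\<Oplus>\<^bsub>tensor3 K A\<^esub>i\<in>{..<n}. pure_tensor K (tensor2 K A) A (\<Delta> (u i)) (\<alpha> (v i)))"
  unfolding comul_left_def r_eq
  by (subst linear_map_finsum[OF tensor_map(1)[OF A1 A1 comul_linear alpha_linear]])
    (simp_all add: closed tensor_map(2)[OF A1 A1 comul_linear alpha_linear])

lemma comul_right_sum:
  "comul_right K A \<alpha> \<Delta> r
    = (\<Oplus>\<^bsub>tensor3 K A\<^esub>i\<in>{..<n}. pure_tensor_left_assoc K A A A (\<alpha> (u i)) (\<Delta> (v i)))"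
proof -
  note tm = tensor_map[OF A1 A1 alpha_linear comul_linear]
  have "comul_right K A \<alpha> \<Delta> r = (\<Oplus>\<^bsub>tensor3 K A\<^esub>i\<in>{..<n}.
    assoc_left K A A A (tensor_map K A A A (tensor2 K A) \<alpha> \<Delta> (pure2 K A (u i) (v i))))"
    unfolding comul_right_def r_eq
    by (rule linear_map_finsum[OF linear_map_comp[OF tm(1) assoc_left(1)[OF A1 A1 A1]]])
      (simp add: closed)
  then show ?thesis
    by (simp add: tm(2) closed assoc_left(2)[OF A1 A1 A1] comul_closed)
qed

text \<open>Expanding \<Delta> (u i) over j gives u i \<star> u j \<otimes> \<alpha> (v j) minus
  \<alpha> (u j) \<otimes> v j \<star> u i, each followed by \<alpha> (v i). The first terms are
  those of r13 r12, the subtracted ones those of r12 r23 with i and j exchanged.\<close>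

lemma comul_left_r:
  "comul_left K A \<Delta> \<alpha> r = r13_r12 K A \<mu> \<alpha> r \<ominus>\<^bsub>tensor3 K A\<^esub> r12_r23 K A \<mu> \<alpha> r"
proof -
  let ?p = "\<lambda>i j. pure3 K A (u i \<star> u j) (\<alpha> (v j)) (\<alpha> (v i))"
  let ?q = "\<lambda>i j. pure3 K A (\<alpha> (u j)) (v j \<star> u i) (\<alpha> (v i))"
  have "pure_tensor K (tensor2 K A) A (\<Delta> (u i)) (\<alpha> (v i))
    = (\<Oplus>\<^bsub>tensor3 K A\<^esub>j\<in>{..<n}. ?p i j) \<ominus>\<^bsub>tensor3 K A\<^esub> (\<Oplus>\<^bsub>tensor3 K A\<^esub>j\<in>{..<n}. ?q i j)" for i
  proof -
    have pl: "linear_map K (tensor2 K A) (tensor3 K A) (\<lambda>x. pure_tensor K (tensor2 K A) A x (\<alpha> (v i)))"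
      by (intro linear_map_pure_left linear_map_id A2 A1 closed)
    show ?thesis
      unfolding comul_sum[OF u_closed]
      by (subst linear_map_finsum[OF pl])
        (simp_all add: linear_map_minus[OF pl] vectorspace_finsum_diff[OF A3] closed
          abelian_group.minus_closed[OF vectorspace.axioms(1)[THEN module.axioms(2), OF A2]])
  qed
  then have "comul_left K A \<Delta> \<alpha> r = (\<Oplus>\<^bsub>tensor3 K A\<^esub>i\<in>{..<n}. \<Oplus>\<^bsub>tensor3 K A\<^esub>j\<in>{..<n}. ?p i j)
    \<ominus>\<^bsub>tensor3 K A\<^esub> (\<Oplus>\<^bsub>tensor3 K A\<^esub>i\<in>{..<n}. \<Oplus>\<^bsub>tensor3 K A\<^esub>j\<in>{..<n}. ?q i j)"
    unfolding comul_left_sum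
    by (simp add: vectorspace_finsum_diff[OF A3] vectorspace_finsum_closed[OF A3] closed)
  also have "(\<Oplus>\<^bsub>tensor3 K A\<^esub>i\<in>{..<n}. \<Oplus>\<^bsub>tensor3 K A\<^esub>j\<in>{..<n}. ?q i j) = r12_r23 K A \<mu> \<alpha> r"
    unfolding r12_r23_sum by (rule vectorspace_finsum_swap[OF A3]) (simp_all add: closed)
  finally show ?thesis by (simp add: r13_r12_sum)
qed

text \<open>Now \<Delta> (v i) stands behind \<alpha> (u i). The first terms are those of r12 r23 as
  they stand. The subtracted ones, \<alpha> (u i) \<otimes> \<alpha> (u j) \<otimes> v j \<star> v
  i, are those of r23 r13 with i and j exchanged.\<close>

lemma comul_right_r:
  "comul_right K A \<alpha> \<Delta> r = r12_r23 K A \<mu> \<alpha> r \<ominus>\<^bsub>tensor3 K A\<^esub> r23_r13 K A \<mu> \<alpha> r"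
proof -
  let ?p = "\<lambda>i j. pure3 K A (\<alpha> (u i)) (v i \<star> u j) (\<alpha> (v j))"
  let ?q = "\<lambda>i j. pure3 K A (\<alpha> (u i)) (\<alpha> (u j)) (v j \<star> v i)"
  have "pure_tensor_left_assoc K A A A (\<alpha> (u i)) (\<Delta> (v i))
    = (\<Oplus>\<^bsub>tensor3 K A\<^esub>j\<in>{..<n}. ?p i j) \<ominus>\<^bsub>tensor3 K A\<^esub> (\<Oplus>\<^bsub>tensor3 K A\<^esub>j\<in>{..<n}. ?q i j)" for i
  proof -
    have au: "\<alpha> (u i) \<in> carrier A" by (intro closed)
    note pl = pure_tensor_left_assoc(1)[OF A1 A1 A1 au]
    show ?thesis
      unfolding comul_sum[OF v_closed]
      by (subst linear_map_finsum[OF pl])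
        (simp_all add: linear_map_minus[OF pl] pure_tensor_left_assoc(2)[OF A1 A1 A1 au]
          vectorspace_finsum_diff[OF A3] closed
          abelian_group.minus_closed[OF vectorspace.axioms(1)[THEN module.axioms(2), OF A2]])
  qed
  then have "comul_right K A \<alpha> \<Delta> r = (\<Oplus>\<^bsub>tensor3 K A\<^esub>i\<in>{..<n}. \<Oplus>\<^bsub>tensor3 K A\<^esub>j\<in>{..<n}. ?p i j)
    \<ominus>\<^bsub>tensor3 K A\<^esub> (\<Oplus>\<^bsub>tensor3 K A\<^esub>i\<in>{..<n}. \<Oplus>\<^bsub>tensor3 K A\<^esub>j\<in>{..<n}. ?q i j)"
    unfolding comul_right_sum
    by (simp add: vectorspace_finsum_diff[OF A3] vectorspace_finsum_closed[OF A3] closed)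
  also have "(\<Oplus>\<^bsub>tensor3 K A\<^esub>i\<in>{..<n}. \<Oplus>\<^bsub>tensor3 K A\<^esub>j\<in>{..<n}. ?q i j) = r23_r13 K A \<mu> \<alpha> r"
    unfolding r23_r13_sum by (rule vectorspace_finsum_swap[OF A3]) (simp_all add: closed)
  finally show ?thesis by (simp add: r12_r23_sum)
qed

section \<open>Quasi-triangularity in terms of the coproducts of the legs of r\<close>

lemma r_products_closed:
  "r13_r12 K A \<mu> \<alpha> r \<in> carrier (tensor3 K A)"
  "r12_r23 K A \<mu> \<alpha> r \<in> carrier (tensor3 K A)"
  "r23_r13 K A \<mu> \<alpha> r \<in> carrier (tensor3 K A)"
  unfolding r13_r12_sum r12_r23_sum r23_r13_sum
  by (intro vectorspace_finsum_closed[OF A3] closed)+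

lemma quasi_triangular_iff_yang_baxter:
  "quasi_triangular_eps_hom_bialgebra K A \<mu> \<Delta> \<alpha> r \<longleftrightarrow> yang_baxter K A \<mu> \<alpha> r = \<zero>\<^bsub>tensor3 K A\<^esub>"
  by (simp add: quasi_triangular_eps_hom_bialgebra_def quasi_triangular_eps_hom_bialgebra_axioms_def
      coboundary_eps_hom_bialgebra_axioms)

text \<open>A(r) = r13 r12 - (r12 r23 - r23 r13), and the bracket is (\<alpha> \<otimes>
  \<Delta>)(r).\<close>

lemma quasi_triangular_iff_comul_right:
  "quasi_triangular_eps_hom_bialgebra K A \<mu> \<Delta> \<alpha> r \<longleftrightarrow>
    comul_right K A \<alpha> \<Delta> r = r13_r12 K A \<mu> \<alpha> r"
proof -
  interpret A3: vectorspace K "tensor3 K A" by (rule A3)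
  let ?x = "r13_r12 K A \<mu> \<alpha> r" and ?y = "r12_r23 K A \<mu> \<alpha> r" and ?z = "r23_r13 K A \<mu> \<alpha> r"
  note cl = r_products_closed
  have "yang_baxter K A \<mu> \<alpha> r = ?x \<ominus>\<^bsub>tensor3 K A\<^esub> (?y \<ominus>\<^bsub>tensor3 K A\<^esub> ?z)"
    using cl by (simp add: yang_baxter_def A3.M.minus_eq A3.M.minus_add A3.M.a_assoc)
  then show ?thesis
    using cl unfolding quasi_triangular_iff_yang_baxter comul_right_r by auto
qed

text \<open>A(r) = (r13 r12 - r12 r23) - (- r23 r13), and the first bracket is (\<Delta> \<otimes>
  \<alpha>)(r).\<close>

lemma quasi_triangular_iff_comul_left:
  "quasi_triangular_eps_hom_bialgebra K A \<mu> \<Delta> \<alpha> r \<longleftrightarrow>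
    comul_left K A \<Delta> \<alpha> r = \<ominus>\<^bsub>tensor3 K A\<^esub> r23_r13 K A \<mu> \<alpha> r"
proof -
  interpret A3: vectorspace K "tensor3 K A" by (rule A3)
  let ?x = "r13_r12 K A \<mu> \<alpha> r" and ?y = "r12_r23 K A \<mu> \<alpha> r" and ?z = "r23_r13 K A \<mu> \<alpha> r"
  note cl = r_products_closed
  have "yang_baxter K A \<mu> \<alpha> r = (?x \<ominus>\<^bsub>tensor3 K A\<^esub> ?y) \<ominus>\<^bsub>tensor3 K A\<^esub> (\<ominus>\<^bsub>tensor3 K A\<^esub> ?z)"
    using cl by (simp add: yang_baxter_def A3.M.minus_eq)
  then show ?thesis
    using cl unfolding quasi_triangular_iff_yang_baxter comul_left_r by auto
qed

end

section \<open>The dual conditions\<close>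

context presented_coboundary
begin

abbreviation dual where "dual \<equiv> dual_space K A"
abbreviation fun2 where "fun2 \<phi> \<psi> \<equiv> tensor_functional K A A \<phi> \<psi>"
abbreviation fun3 where "fun3 \<phi> \<psi> \<chi> \<equiv> tensor_functional K (tensor2 K A) A (fun2 \<phi> \<psi>) \<chi>"

lemmas dual_closed = dual_space_closed[where V = A and K = K]
lemmas dual_linear = dual_space_linear[where V = A and K = K]
lemmas D2 = vectorspace_tensor[OF DA DA]

lemma fun2:
  assumes "\<phi> \<in> carrier dual" "\<psi> \<in> carrier dual"
  shows "fun2 \<phi> \<psi> \<in> carrier (dual_space K (tensor2 K A))"
    and "a \<in> carrier A \<Longrightarrow> b \<in> carrier A \<Longrightarrow> fun2 \<phi> \<psi> (pure2 K A a b) = \<phi> a \<otimes>\<^bsub>K\<^esub> \<psi> b"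
  using tensor_functional[OF A1 A1 dual_linear[OF assms(1)] dual_linear[OF assms(2)]] by blast+

lemma fun2_closed:
  "\<phi> \<in> carrier dual \<Longrightarrow> \<psi> \<in> carrier dual \<Longrightarrow> x \<in> carrier (tensor2 K A) \<Longrightarrow> fun2 \<phi> \<psi> x \<in> carrier K"
  by (rule dual_space_closed[OF fun2(1)])

lemma fun3:
  assumes "\<phi> \<in> carrier dual" "\<psi> \<in> carrier dual" "\<chi> \<in> carrier dual"
  shows "linear_map K (tensor3 K A) (field_space K) (fun3 \<phi> \<psi> \<chi>)"
    and "x \<in> carrier (tensor2 K A) \<Longrightarrow> c \<in> carrier A \<Longrightarrow>
      fun3 \<phi> \<psi> \<chi> (pure_tensor K (tensor2 K A) A x c) = fun2 \<phi> \<psi> x \<otimes>\<^bsub>K\<^esub> \<chi> c"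
  using dual_space_linear tensor_functional[OF A2 A1 dual_space_linear[OF fun2(1)[OF assms(1,2)]]
      dual_linear[OF assms(3)]] by blast+

text \<open>Coproducts in the last two places enter \<open>tensor3 K A\<close> by rebracketing, so
  \<open>fun3\<close> must be known at a \<otimes> x for every x in A \<otimes> A. On pure x the
  formula is associativity in K.\<close>

lemma fun3_left_assoc:
  assumes d: "\<phi> \<in> carrier dual" "\<psi> \<in> carrier dual" "\<chi> \<in> carrier dual"
    and a: "a \<in> carrier A" and x: "x \<in> carrier (tensor2 K A)"
  shows "fun3 \<phi> \<psi> \<chi> (pure_tensor_left_assoc K A A A a x) = \<phi> a \<otimes>\<^bsub>K\<^esub> fun2 \<psi> \<chi> x"
proof (rule linear_map_eq_tensor[OF A1 A1 _ _ _ x,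
      where f = "\<lambda>x. fun3 \<phi> \<psi> \<chi> (pure_tensor_left_assoc K A A A a x)"])
  note pl = pure_tensor_left_assoc[OF A1 A1 A1 a]
  show "linear_map K (tensor2 K A) (field_space K)
      (\<lambda>x. fun3 \<phi> \<psi> \<chi> (pure_tensor_left_assoc K A A A a x))"
    by (rule linear_map_comp[OF pl(1) fun3(1)[OF d]])
  show "linear_map K (tensor2 K A) (field_space K) (\<lambda>x. \<phi> a \<otimes>\<^bsub>K\<^esub> fun2 \<psi> \<chi> x)"
    by (rule linear_map_mult_const[OF dual_space_linear[OF fun2(1)[OF d(2,3)]] dual_closed[OF d(1) a]])
  fix b c assume "b \<in> carrier A" "c \<in> carrier A"
  then show "fun3 \<phi> \<psi> \<chi> (pure_tensor_left_assoc K A A A a (pure2 K A b c))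
      = \<phi> a \<otimes>\<^bsub>K\<^esub> fun2 \<psi> \<chi> (pure2 K A b c)"
    using d a by (simp add: pl(2) fun3(2) fun2(2) closed dual_closed R.m_assoc)
qed

lemma fun3_comul_left:
  assumes d: "\<phi> \<in> carrier dual" "\<psi> \<in> carrier dual" "\<chi> \<in> carrier dual"
  shows "fun3 \<phi> \<psi> \<chi> (comul_left K A \<Delta> \<alpha> r)
    = (\<Oplus>\<^bsub>field_space K\<^esub>i\<in>{..<n}. fun2 \<phi> \<psi> (\<Delta> (u i)) \<otimes>\<^bsub>K\<^esub> \<chi> (\<alpha> (v i)))"
  unfolding comul_left_sum
  by (subst linear_map_finsum[OF fun3(1)[OF d]])
    (simp_all add: fun3(2)[OF d] closed comul_closed pure_tensor_closed[OF A2 A1])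

lemma fun3_comul_right:
  assumes d: "\<phi> \<in> carrier dual" "\<psi> \<in> carrier dual" "\<chi> \<in> carrier dual"
  shows "fun3 \<phi> \<psi> \<chi> (comul_right K A \<alpha> \<Delta> r)
    = (\<Oplus>\<^bsub>field_space K\<^esub>i\<in>{..<n}. \<phi> (\<alpha> (u i)) \<otimes>\<^bsub>K\<^esub> fun2 \<psi> \<chi> (\<Delta> (v i)))"
  unfolding comul_right_sum
  by (subst linear_map_finsum[OF fun3(1)[OF d]])
    (simp_all add: fun3_left_assoc[OF d] closed comul_closed
      linear_mapD(1)[OF pure_tensor_left_assoc(1)[OF A1 A1 A1]])

lemma fun3_double_sum:
  assumes d: "\<phi> \<in> carrier dual" "\<psi> \<in> carrier dual" "\<chi> \<in> carrier dual"
    and cl: "\<And>i j. a i j \<in> carrier A" "\<And>i j. b i j \<in> carrier A" "\<And>i j. c i j \<in> carrier A"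
  shows "fun3 \<phi> \<psi> \<chi> (\<Oplus>\<^bsub>tensor3 K A\<^esub>i\<in>{..<n}. \<Oplus>\<^bsub>tensor3 K A\<^esub>j\<in>{..<n}. pure3 K A (a i j) (b i j) (c i j))
    = (\<Oplus>\<^bsub>field_space K\<^esub>i\<in>{..<n}. \<Oplus>\<^bsub>field_space K\<^esub>j\<in>{..<n}.
        (\<phi> (a i j) \<otimes>\<^bsub>K\<^esub> \<psi> (b i j)) \<otimes>\<^bsub>K\<^esub> \<chi> (c i j))"
  by (simp add: linear_map_finsum[OF fun3(1)[OF d]] vectorspace_finsum_closed[OF A3] closed cl
      fun3(2)[OF d] fun2(2)[OF d(1,2)])

section \<open>Equations between tensors and between maps as families of scalar equations\<close>

lemma comul_closed_r:
  "comul_left K A \<Delta> \<alpha> r \<in> carrier (tensor3 K A)" "comul_right K A \<alpha> \<Delta> r \<in> carrier (tensor3 K A)"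
  "\<ominus>\<^bsub>tensor3 K A\<^esub> r23_r13 K A \<mu> \<alpha> r \<in> carrier (tensor3 K A)"
proof -
  interpret A3: vectorspace K "tensor3 K A" by (rule A3)
  show "comul_left K A \<Delta> \<alpha> r \<in> carrier (tensor3 K A)" "comul_right K A \<alpha> \<Delta> r \<in> carrier (tensor3 K A)"
    "\<ominus>\<^bsub>tensor3 K A\<^esub> r23_r13 K A \<mu> \<alpha> r \<in> carrier (tensor3 K A)"
    using r_products_closed by (simp_all add: comul_left_r comul_right_r)
qed

lemma tensor3_eq_iff:
  assumes "x \<in> carrier (tensor3 K A)" "y \<in> carrier (tensor3 K A)"
  shows "x = y \<longleftrightarrow> (\<forall>\<phi>\<in>carrier dual. \<forall>\<psi>\<in>carrier dual. \<forall>\<chi>\<in>carrier dual.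
    fun3 \<phi> \<psi> \<chi> x = fun3 \<phi> \<psi> \<chi> y)"
  using tensor3_functionals_separate[OF A1 A1 A1 assms] by blast

text \<open>By linearity pure tensors suffice, and their values in A are separated by \<chi>. Three
  free functionals remain, just as in \<open>tensor3_eq_iff\<close>.\<close>

lemma dual_tensor_maps_eq_iff:
  assumes f: "linear_map K (tensor2 K dual) A f" and g: "linear_map K (tensor2 K dual) A g"
  shows "(\<forall>x\<in>carrier (tensor2 K dual). f x = g x) \<longleftrightarrow>
    (\<forall>\<phi>\<in>carrier dual. \<forall>\<psi>\<in>carrier dual. \<forall>\<chi>\<in>carrier dual.
      \<chi> (f (pure2 K dual \<phi> \<psi>)) = \<chi> (g (pure2 K dual \<phi> \<psi>)))" (is "?L \<longleftrightarrow> ?R")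
proof
  assume ?L
  then show ?R using pure_tensor_closed[OF DA DA] by simp
next
  assume R: ?R
  show ?L
  proof
    fix x assume x: "x \<in> carrier (tensor2 K dual)"
    show "f x = g x"
    proof (rule linear_map_eq_tensor[OF DA DA f g _ x])
      fix \<phi> \<psi> assume d: "\<phi> \<in> carrier dual" "\<psi> \<in> carrier dual"
      note p = pure_tensor_closed[OF DA DA d]
      show "f (pure2 K dual \<phi> \<psi>) = g (pure2 K dual \<phi> \<psi>)"
        using R d by (intro functionals_separate[OF A1 linear_mapD(1)[OF f p] linear_mapD(1)[OF g p]]) simp
    qed
  qed
qed

text \<open>Here \<phi> is the argument while \<psi> and \<chi> test the value in A \<otimes> A,
  which again makes three functionals.\<close>

lemma dual_maps_eq_iff:
  assumes "\<And>\<phi>. \<phi> \<in> carrier dual \<Longrightarrow> f \<phi> \<in> carrier (tensor2 K A)"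
    "\<And>\<phi>. \<phi> \<in> carrier dual \<Longrightarrow> g \<phi> \<in> carrier (tensor2 K A)"
  shows "(\<forall>\<phi>\<in>carrier dual. f \<phi> = g \<phi>) \<longleftrightarrow>
    (\<forall>\<phi>\<in>carrier dual. \<forall>\<psi>\<in>carrier dual. \<forall>\<chi>\<in>carrier dual. fun2 \<psi> \<chi> (f \<phi>) = fun2 \<psi> \<chi> (g \<phi>))"
    (is "?L \<longleftrightarrow> ?R")
proof
  assume ?L
  then show ?R by simp
next
  assume R: ?R
  show ?L
  proof
    fix \<phi> assume \<phi>: "\<phi> \<in> carrier dual"
    show "f \<phi> = g \<phi>"
      using R \<phi> by (intro tensor_functionals_separate[OF A1 A1 assms(1,2)[OF \<phi>]]) simp
  qed
qed

lemma comul_dual_linear: "linear_map K (tensor2 K dual) dual (comul_dual K A \<Delta>)"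
proof (rule linear_map_dualI[OF D2 A1])
  fix x assume x: "x \<in> carrier (tensor2 K dual)"
  note dt = dual_space_linear[OF linear_mapD(1)[OF dual_tensor(1)[OF A1 A1] x]]
  show "comul_dual K A \<Delta> x \<in> carrier dual"
    unfolding comul_dual_def by (rule restrict_in_dual_space[OF linear_map_comp[OF comul_linear dt]])
next
  fix a assume a: "a \<in> carrier A"
  show "linear_map K (tensor2 K dual) (field_space K) (\<lambda>x. comul_dual K A \<Delta> x a)"
    using linear_map_dual_tensor_eval[OF A1 A1 comul_closed[OF a]] a by (simp add: comul_dual_def)
qed

lemma comul_dual_pure:
  "\<phi> \<in> carrier dual \<Longrightarrow> \<psi> \<in> carrier dual \<Longrightarrow> a \<in> carrier A \<Longrightarrow>
    comul_dual K A \<Delta> (pure2 K dual \<phi> \<psi>) a = fun2 \<phi> \<psi> (\<Delta> a)"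
  by (simp add: comul_dual_def dual_tensor(2)[OF A1 A1])

end

(* Covers all four of the maps lambda1, lambda2, rho1, rho2. *)
locale presented_dual_map = presented_coboundary K A \<mu> \<Delta> \<alpha> r u v n
  for K :: "('k, 'r) ring_scheme" (structure)
    and A :: "('k, 'a, 'm) module_scheme" (structure)
    and \<mu> \<Delta> \<alpha> r u v n +
  fixes p q :: "nat \<Rightarrow> 'a" and M :: "('a \<Rightarrow> 'k) \<Rightarrow> 'a"
  assumes p_closed: "p i \<in> carrier A" and q_closed: "q i \<in> carrier A"
    and M_eq: "\<phi> \<in> carrier (dual_space K A) \<Longrightarrow> M \<phi> = (\<Oplus>\<^bsub>A\<^esub>i\<in>{..<n}. \<phi> (p i) \<odot>\<^bsub>A\<^esub> q i)"
begin

lemma M_linear: "linear_map K dual A M"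
proof (rule linear_map_cong)
  show "linear_map K dual A (\<lambda>\<phi>. \<Oplus>\<^bsub>A\<^esub>i\<in>{..<n}. \<phi> (p i) \<odot>\<^bsub>A\<^esub> q i)"
    by (intro linear_map_sum linear_map_smult_left linear_map_eval A1 DA p_closed q_closed) simp
qed (simp add: M_eq)

lemmas M_closed = linear_mapD(1)[OF M_linear]

lemma functional_M:
  assumes d: "\<phi> \<in> carrier dual" and f: "linear_map K A (field_space K) f"
  shows "f (M \<phi>) = (\<Oplus>\<^bsub>field_space K\<^esub>i\<in>{..<n}. \<phi> (p i) \<otimes>\<^bsub>K\<^esub> f (q i))"
  unfolding M_eq[OF d]
  by (subst linear_map_finsum[OF f])
    (simp_all add: linear_mapD(3)[OF f] dual_closed[OF d] p_closed q_closed)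

lemma functional_M_comul_dual:
  assumes d: "\<phi> \<in> carrier dual" "\<psi> \<in> carrier dual" "\<chi> \<in> carrier dual"
  shows "\<chi> (M (comul_dual K A \<Delta> (pure2 K dual \<phi> \<psi>)))
    = (\<Oplus>\<^bsub>field_space K\<^esub>i\<in>{..<n}. fun2 \<phi> \<psi> (\<Delta> (p i)) \<otimes>\<^bsub>K\<^esub> \<chi> (q i))"
  using linear_mapD(1)[OF comul_dual_linear pure_tensor_closed[OF DA DA d(1,2)]]
  by (simp add: functional_M dual_linear[OF d(3)] comul_dual_pure d p_closed)

lemma functional_comul_M:
  assumes d: "\<phi> \<in> carrier dual" "\<psi> \<in> carrier dual" "\<chi> \<in> carrier dual"
  shows "fun2 \<psi> \<chi> (\<Delta> (M \<phi>)) = (\<Oplus>\<^bsub>field_space K\<^esub>i\<in>{..<n}. \<phi> (p i) \<otimes>\<^bsub>K\<^esub> fun2 \<psi> \<chi> (\<Delta> (q i)))"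
  by (rule functional_M[OF d(1) linear_map_comp[OF comul_linear dual_space_linear[OF fun2(1)[OF d(2,3)]]]])

lemma mul_op_dual_map2_linear: "linear_map K (tensor2 K dual) A (\<lambda>x. mul_op K A \<mu> (dual_map2 K A M x))"
  unfolding mul_op_def dual_map2_def
  by (rule linear_map_comp[OF tensor_map(1)[OF DA DA M_linear M_linear]
        linear_map_comp[OF twist(1)[OF A1 A1] mul_linear]])

text \<open>The twist in \<open>mul_op\<close> yields the product M \<psi> \<star> M \<phi>, so the
  outer index i goes with \<psi>. In this order the terms match those of r23 r13 and r13 r12 without
  exchanging indices.\<close>

lemma functional_mul_op_dual_map2:
  assumes d: "\<phi> \<in> carrier dual" "\<psi> \<in> carrier dual" "\<chi> \<in> carrier dual"
  shows "\<chi> (mul_op K A \<mu> (dual_map2 K A M (pure2 K dual \<phi> \<psi>)))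
    = (\<Oplus>\<^bsub>field_space K\<^esub>i\<in>{..<n}. \<Oplus>\<^bsub>field_space K\<^esub>j\<in>{..<n}.
        \<psi> (p i) \<otimes>\<^bsub>K\<^esub> (\<phi> (p j) \<otimes>\<^bsub>K\<^esub> \<chi> (q i \<star> q j)))"
proof -
  have bil: "bilinear_map K A A (field_space K) (\<lambda>a b. \<chi> (a \<star> b))"
    by (intro bilinear_mapI linear_map_comp[OF _ dual_linear[OF d(3)]] linear_intros)
  note b1 = linear_mapD(3)[OF bilinear_mapD(1)[OF bil]] and b2 = linear_mapD(3)[OF bilinear_mapD(2)[OF bil]]
  have "mul_op K A \<mu> (dual_map2 K A M (pure2 K dual \<phi> \<psi>)) = M \<psi> \<star> M \<phi>"
    using d M_closed
    by (simp add: mul_op_def dual_map2_def tensor_map(2)[OF DA DA M_linear M_linear] twist(2)[OF A1 A1])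
  then have "\<chi> (mul_op K A \<mu> (dual_map2 K A M (pure2 K dual \<phi> \<psi>)))
    = \<chi> ((\<Oplus>\<^bsub>A\<^esub>i\<in>{..<n}. \<psi> (p i) \<odot>\<^bsub>A\<^esub> q i) \<star> (\<Oplus>\<^bsub>A\<^esub>j\<in>{..<n}. \<phi> (p j) \<odot>\<^bsub>A\<^esub> q j))"
    by (simp add: M_eq d)
  also have "\<dots> = (\<Oplus>\<^bsub>field_space K\<^esub>i\<in>{..<n}. \<Oplus>\<^bsub>field_space K\<^esub>j\<in>{..<n}.
      \<chi> ((\<psi> (p i) \<odot>\<^bsub>A\<^esub> q i) \<star> (\<phi> (p j) \<odot>\<^bsub>A\<^esub> q j)))"
    by (rule bilinear_map_finsum[OF bil FK A1]) (simp_all add: dual_closed d p_closed q_closed)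
  also have "\<dots> = (\<Oplus>\<^bsub>field_space K\<^esub>i\<in>{..<n}. \<Oplus>\<^bsub>field_space K\<^esub>j\<in>{..<n}.
        \<psi> (p i) \<otimes>\<^bsub>K\<^esub> (\<phi> (p j) \<otimes>\<^bsub>K\<^esub> \<chi> (q i \<star> q j)))"
    by (simp add: b1 b2 dual_closed d p_closed q_closed mul_closed R.m_lcomm)
  finally show ?thesis .
qed

lemma dual_map2_twist_closed:
  "t \<in> carrier (tensor2 K dual) \<Longrightarrow> dual_map2 K A M (twist K dual dual t) \<in> carrier (tensor2 K A)"
  unfolding dual_map2_def
  by (rule linear_mapD(1)[OF linear_map_comp[OF twist(1)[OF DA DA] tensor_map(1)[OF DA DA M_linear M_linear]]])

text \<open>The formula refers to t only through its pairings, because it is meant for the dual of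
  \<mu> applied to a functional, of which nothing else is known. Both sides are linear in t, which
  reduces the proof to pure tensors.\<close>

lemma functional_dual_map2_twist:
  assumes d: "\<psi> \<in> carrier dual" "\<chi> \<in> carrier dual" and t: "t \<in> carrier (tensor2 K dual)"
  shows "fun2 \<psi> \<chi> (dual_map2 K A M (twist K dual dual t))
    = (\<Oplus>\<^bsub>field_space K\<^esub>i\<in>{..<n}. \<Oplus>\<^bsub>field_space K\<^esub>j\<in>{..<n}.
        dual_tensor K A A t (pure2 K A (p i) (p j)) \<otimes>\<^bsub>K\<^esub> (\<psi> (q j) \<otimes>\<^bsub>K\<^esub> \<chi> (q i)))"
proof (rule linear_map_eq_tensor[OF DA DA _ _ _ t,
      where f = "\<lambda>t. fun2 \<psi> \<chi> (dual_map2 K A M (twist K dual dual t))"])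
  show "linear_map K (tensor2 K dual) (field_space K) (\<lambda>t. fun2 \<psi> \<chi> (dual_map2 K A M (twist K dual dual t)))"
    unfolding dual_map2_def
    by (rule linear_map_comp[OF linear_map_comp[OF twist(1)[OF DA DA]
          tensor_map(1)[OF DA DA M_linear M_linear]] dual_space_linear[OF fun2(1)[OF d]]])
  show "linear_map K (tensor2 K dual) (field_space K) (\<lambda>t.
      \<Oplus>\<^bsub>field_space K\<^esub>i\<in>{..<n}. \<Oplus>\<^bsub>field_space K\<^esub>j\<in>{..<n}.
        dual_tensor K A A t (pure2 K A (p i) (p j)) \<otimes>\<^bsub>K\<^esub> (\<psi> (q j) \<otimes>\<^bsub>K\<^esub> \<chi> (q i)))"
    by (intro linear_map_sum linear_map_mult_left linear_map_dual_tensor_eval D2 FK A1 p2_closed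
        p_closed q_closed R.m_closed dual_closed d) simp_all
  fix \<phi>1 \<phi>2 assume d': "\<phi>1 \<in> carrier dual" "\<phi>2 \<in> carrier dual"
  \<comment> \<open>The arguments are reversed because \<open>bilinear_map_finsum\<close> puts the
    index of the first argument outside, and the outer index i belongs to \<phi>1, which sits in the
    second factor of the product.\<close>
  have bil: "bilinear_map K (field_space K) (field_space K) (field_space K) (\<lambda>a b. b \<otimes>\<^bsub>K\<^esub> a)"
    by (intro bilinear_mapI linear_map_mult_left linear_map_mult_const linear_map_id FK) simp_all
  have "fun2 \<psi> \<chi> (dual_map2 K A M (twist K dual dual (pure2 K dual \<phi>1 \<phi>2))) = \<psi> (M \<phi>2) \<otimes>\<^bsub>K\<^esub> \<chi> (M \<phi>1)"
    using d d' M_closed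
    by (simp add: dual_map2_def tensor_map(2)[OF DA DA M_linear M_linear] twist(2)[OF DA DA] fun2(2))
  also have "\<dots> = (\<Oplus>\<^bsub>field_space K\<^esub>j\<in>{..<n}. \<phi>2 (p j) \<otimes>\<^bsub>K\<^esub> \<psi> (q j))
      \<otimes>\<^bsub>K\<^esub> (\<Oplus>\<^bsub>field_space K\<^esub>i\<in>{..<n}. \<phi>1 (p i) \<otimes>\<^bsub>K\<^esub> \<chi> (q i))"
    by (simp add: functional_M[OF d'(1) dual_linear[OF d(2)]] functional_M[OF d'(2) dual_linear[OF d(1)]])
  also have "\<dots> = (\<Oplus>\<^bsub>field_space K\<^esub>i\<in>{..<n}. \<Oplus>\<^bsub>field_space K\<^esub>j\<in>{..<n}.
      (\<phi>2 (p j) \<otimes>\<^bsub>K\<^esub> \<psi> (q j)) \<otimes>\<^bsub>K\<^esub> (\<phi>1 (p i) \<otimes>\<^bsub>K\<^esub> \<chi> (q i)))"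
    by (rule bilinear_map_finsum[OF bil FK FK]) (simp_all add: dual_closed d d' p_closed q_closed)
  also have "\<dots> = (\<Oplus>\<^bsub>field_space K\<^esub>i\<in>{..<n}. \<Oplus>\<^bsub>field_space K\<^esub>j\<in>{..<n}.
        dual_tensor K A A (pure2 K dual \<phi>1 \<phi>2) (pure2 K A (p i) (p j)) \<otimes>\<^bsub>K\<^esub> (\<psi> (q j) \<otimes>\<^bsub>K\<^esub> \<chi> (q i)))"
    by (simp add: dual_tensor(2)[OF A1 A1] d' d fun2(2) p_closed q_closed dual_closed R.m_ac)
  finally show "fun2 \<psi> \<chi> (dual_map2 K A M (twist K dual dual (pure2 K dual \<phi>1 \<phi>2)))
    = (\<Oplus>\<^bsub>field_space K\<^esub>i\<in>{..<n}. \<Oplus>\<^bsub>field_space K\<^esub>j\<in>{..<n}.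
        dual_tensor K A A (pure2 K dual \<phi>1 \<phi>2) (pure2 K A (p i) (p j)) \<otimes>\<^bsub>K\<^esub> (\<psi> (q j) \<otimes>\<^bsub>K\<^esub> \<chi> (q i)))" .
qed

lemma functional_dual_map2_mul_dual_op:
  assumes fin: "fin_dim" and d: "\<phi> \<in> carrier dual" "\<psi> \<in> carrier dual" "\<chi> \<in> carrier dual"
  shows "fun2 \<psi> \<chi> (dual_map2 K A M (mul_dual_op K A \<mu> \<phi>))
    = (\<Oplus>\<^bsub>field_space K\<^esub>i\<in>{..<n}. \<Oplus>\<^bsub>field_space K\<^esub>j\<in>{..<n}.
        \<phi> (p i \<star> p j) \<otimes>\<^bsub>K\<^esub> (\<psi> (q j) \<otimes>\<^bsub>K\<^esub> \<chi> (q i)))"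
  by (simp add: mul_dual_op_def functional_dual_map2_twist[OF d(2,3)] mul_dual[OF A1 fin mul_linear d(1)]
      closed p_closed)

lemma dual_map2_mul_dual_op_closed:
  assumes "fin_dim" "\<phi> \<in> carrier dual"
  shows "dual_map2 K A M (mul_dual_op K A \<mu> \<phi>) \<in> carrier (tensor2 K A)"
  unfolding mul_dual_op_def by (rule dual_map2_twist_closed[OF mul_dual(1)[OF A1 assms(1) mul_linear assms(2)]])

end

section \<open>The four maps and their equations\<close>

context presented_coboundary
begin

lemma functional_comp: "\<phi> \<in> carrier dual \<Longrightarrow> linear_map K A A f \<Longrightarrow> linear_map K A (field_space K) (\<lambda>x. \<phi> (f x))"
  by (rule linear_map_comp[OF _ dual_linear])

text \<open>In this and the next three lemmas, p lists the legs of r paired with the functional and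
  q the legs returned, with \<alpha> on the leg where the map puts it.\<close>

lemma presented_lambda1: "presented_dual_map K A \<mu> \<Delta> \<alpha> r u v n (\<lambda>i. \<alpha> (u i)) v (lambda1 K A \<alpha> r)"
proof unfold_locales
  fix \<phi> assume \<phi>: "\<phi> \<in> carrier dual"
  show "lambda1 K A \<alpha> r \<phi> = (\<Oplus>\<^bsub>A\<^esub>i\<in>{..<n}. \<phi> (\<alpha> (u i)) \<odot>\<^bsub>A\<^esub> v i)"
    unfolding lambda1_def
    by (rule lift_r[OF A1], intro bilinear_mapI linear_map_smult_const linear_map_smult_left
        linear_map_id functional_comp[OF \<phi>] alpha_linear A1 dual_closed[OF \<phi>] closed)
qed (rule closed u_closed)+

lemma presented_lambda2: "presented_dual_map K A \<mu> \<Delta> \<alpha> r u v n u (\<lambda>i. \<alpha> (v i)) (lambda2 K A \<alpha> r)"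
proof unfold_locales
  fix \<phi> assume \<phi>: "\<phi> \<in> carrier dual"
  show "lambda2 K A \<alpha> r \<phi> = (\<Oplus>\<^bsub>A\<^esub>i\<in>{..<n}. \<phi> (u i) \<odot>\<^bsub>A\<^esub> \<alpha> (v i))"
    unfolding lambda2_def
    by (rule lift_r[OF A1], intro bilinear_mapI linear_map_smult_const linear_map_smult_left
        alpha_linear dual_linear[OF \<phi>] A1 dual_closed[OF \<phi>] closed)
qed (rule closed u_closed)+

lemma presented_rho1: "presented_dual_map K A \<mu> \<Delta> \<alpha> r u v n (\<lambda>i. \<alpha> (v i)) u (rho1 K A \<alpha> r)"
proof unfold_locales
  fix \<phi> assume \<phi>: "\<phi> \<in> carrier dual"
  show "rho1 K A \<alpha> r \<phi> = (\<Oplus>\<^bsub>A\<^esub>i\<in>{..<n}. \<phi> (\<alpha> (v i)) \<odot>\<^bsub>A\<^esub> u i)"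
    unfolding rho1_def
    by (rule lift_r[OF A1], intro bilinear_mapI linear_map_smult_const linear_map_smult_left
        linear_map_id functional_comp[OF \<phi>] alpha_linear A1 dual_closed[OF \<phi>] closed)
qed (rule closed u_closed)+

lemma presented_rho2: "presented_dual_map K A \<mu> \<Delta> \<alpha> r u v n v (\<lambda>i. \<alpha> (u i)) (rho2 K A \<alpha> r)"
proof unfold_locales
  fix \<phi> assume \<phi>: "\<phi> \<in> carrier dual"
  show "rho2 K A \<alpha> r \<phi> = (\<Oplus>\<^bsub>A\<^esub>i\<in>{..<n}. \<phi> (v i) \<odot>\<^bsub>A\<^esub> \<alpha> (u i))"
    unfolding rho2_def
    by (rule lift_r[OF A1], intro bilinear_mapI linear_map_smult_const linear_map_smult_left
        alpha_linear dual_linear[OF \<phi>] A1 dual_closed[OF \<phi>] closed)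
qed (rule closed u_closed)+

lemma fun3_r13_r12:
  assumes d: "\<phi> \<in> carrier dual" "\<psi> \<in> carrier dual" "\<chi> \<in> carrier dual"
  shows "fun3 \<phi> \<psi> \<chi> (r13_r12 K A \<mu> \<alpha> r) = (\<Oplus>\<^bsub>field_space K\<^esub>i\<in>{..<n}. \<Oplus>\<^bsub>field_space K\<^esub>j\<in>{..<n}.
    \<phi> (u i \<star> u j) \<otimes>\<^bsub>K\<^esub> (\<psi> (\<alpha> (v j)) \<otimes>\<^bsub>K\<^esub> \<chi> (\<alpha> (v i))))"
  unfolding r13_r12_sum
  by (subst fun3_double_sum[OF d]) (simp_all add: closed dual_closed d R.m_assoc)

lemma fun3_r23_r13:
  assumes d: "\<phi> \<in> carrier dual" "\<psi> \<in> carrier dual" "\<chi> \<in> carrier dual"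
  shows "fun3 \<phi> \<psi> \<chi> (r23_r13 K A \<mu> \<alpha> r) = (\<Oplus>\<^bsub>field_space K\<^esub>i\<in>{..<n}. \<Oplus>\<^bsub>field_space K\<^esub>j\<in>{..<n}.
    \<phi> (\<alpha> (u j)) \<otimes>\<^bsub>K\<^esub> (\<psi> (\<alpha> (u i)) \<otimes>\<^bsub>K\<^esub> \<chi> (v i \<star> v j)))"
  unfolding r23_r13_sum
  by (subst fun3_double_sum[OF d]) (simp_all add: closed dual_closed d R.m_assoc)

text \<open>With \<open>lambda2\<close>, the functionals \<phi> and \<psi> test \<Delta> (u i), and
  \<chi> tests the returned leg \<alpha> (v i). The places keep the order \<phi>, \<psi>,
  \<chi>.\<close>

lemma quasi_triangular_iff_lambda_comul_dual:
  "quasi_triangular_eps_hom_bialgebra K A \<mu> \<Delta> \<alpha> r \<longleftrightarrow>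
    (\<forall>x\<in>carrier (tensor2 K dual).
      lambda2 K A \<alpha> r (comul_dual K A \<Delta> x)
        = \<ominus>\<^bsub>A\<^esub> mul_op K A \<mu> (dual_map2 K A (lambda1 K A \<alpha> r) x))"
proof -
  interpret L1: presented_dual_map K A \<mu> \<Delta> \<alpha> r u v n "\<lambda>i. \<alpha> (u i)" v "lambda1 K A \<alpha> r"
    by (rule presented_lambda1)
  interpret L2: presented_dual_map K A \<mu> \<Delta> \<alpha> r u v n u "\<lambda>i. \<alpha> (v i)" "lambda2 K A \<alpha> r"
    by (rule presented_lambda2)
  have lhs: "\<chi> (lambda2 K A \<alpha> r (comul_dual K A \<Delta> (pure2 K dual \<phi> \<psi>)))
      = fun3 \<phi> \<psi> \<chi> (comul_left K A \<Delta> \<alpha> r)"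
    if d: "\<phi> \<in> carrier dual" "\<psi> \<in> carrier dual" "\<chi> \<in> carrier dual" for \<phi> \<psi> \<chi>
    by (simp add: L2.functional_M_comul_dual[OF d] fun3_comul_left[OF d])
  have rhs: "\<chi> (\<ominus>\<^bsub>A\<^esub> mul_op K A \<mu> (dual_map2 K A (lambda1 K A \<alpha> r) (pure2 K dual \<phi> \<psi>)))
      = fun3 \<phi> \<psi> \<chi> (\<ominus>\<^bsub>tensor3 K A\<^esub> r23_r13 K A \<mu> \<alpha> r)"
    if d: "\<phi> \<in> carrier dual" "\<psi> \<in> carrier dual" "\<chi> \<in> carrier dual" for \<phi> \<psi> \<chi>
    using linear_mapD(1)[OF L1.mul_op_dual_map2_linear pure_tensor_closed[OF DA DA d(1,2)]]
    by (simp add: linear_map_uminus[OF dual_linear[OF d(3)]] linear_map_uminus[OF fun3(1)[OF d]]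
        L1.functional_mul_op_dual_map2[OF d] fun3_r23_r13[OF d] r_products_closed
        closed dual_closed d R.m_lcomm)
  show ?thesis
    unfolding quasi_triangular_iff_comul_left tensor3_eq_iff[OF comul_closed_r(1,3)]
      dual_tensor_maps_eq_iff[OF linear_map_comp[OF comul_dual_linear L2.M_linear]
        linear_map_neg[OF L1.mul_op_dual_map2_linear]]
    by (simp add: lhs rhs)
qed

text \<open>As \<open>rho2\<close> returns \<alpha> (u i), the functional \<chi> tests the first
  place and the order becomes \<chi>, \<phi>, \<psi>.\<close>

lemma quasi_triangular_iff_rho_comul_dual:
  "quasi_triangular_eps_hom_bialgebra K A \<mu> \<Delta> \<alpha> r \<longleftrightarrow>
    (\<forall>x\<in>carrier (tensor2 K dual).
      rho2 K A \<alpha> r (comul_dual K A \<Delta> x) = mul_op K A \<mu> (dual_map2 K A (rho1 K A \<alpha> r) x))"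
proof -
  interpret R1: presented_dual_map K A \<mu> \<Delta> \<alpha> r u v n "\<lambda>i. \<alpha> (v i)" u "rho1 K A \<alpha> r"
    by (rule presented_rho1)
  interpret R2: presented_dual_map K A \<mu> \<Delta> \<alpha> r u v n v "\<lambda>i. \<alpha> (u i)" "rho2 K A \<alpha> r"
    by (rule presented_rho2)
  have lhs: "\<chi> (rho2 K A \<alpha> r (comul_dual K A \<Delta> (pure2 K dual \<phi> \<psi>)))
      = fun3 \<chi> \<phi> \<psi> (comul_right K A \<alpha> \<Delta> r)"
    if d: "\<phi> \<in> carrier dual" "\<psi> \<in> carrier dual" "\<chi> \<in> carrier dual" for \<phi> \<psi> \<chi>
    by (simp add: R2.functional_M_comul_dual[OF d] fun3_comul_right d fun2_closed comul_closed
        dual_closed closed R.m_comm)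
  have rhs: "\<chi> (mul_op K A \<mu> (dual_map2 K A (rho1 K A \<alpha> r) (pure2 K dual \<phi> \<psi>)))
      = fun3 \<chi> \<phi> \<psi> (r13_r12 K A \<mu> \<alpha> r)"
    if d: "\<phi> \<in> carrier dual" "\<psi> \<in> carrier dual" "\<chi> \<in> carrier dual" for \<phi> \<psi> \<chi>
    by (simp add: R1.functional_mul_op_dual_map2[OF d] fun3_r13_r12 d
        closed dual_closed R.m_ac)
  show ?thesis
    unfolding quasi_triangular_iff_comul_right tensor3_eq_iff[OF comul_closed_r(2) r_products_closed(1)]
      dual_tensor_maps_eq_iff[OF linear_map_comp[OF comul_dual_linear R2.M_linear]
        R1.mul_op_dual_map2_linear]
    \<comment> \<open>The two families of scalar equations differ by a cyclic renaming of the
      functionals, so the quantifiers still have to be reordered.\<close>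
    by (simp add: lhs rhs) blast
qed

text \<open>As \<open>lambda1\<close> pairs \<phi> with \<alpha> (u i) and returns v i, the
  coproduct of v i is tested by \<psi> and \<chi>, and the order \<phi>, \<psi>, \<chi> is
  kept.\<close>

lemma quasi_triangular_iff_comul_lambda:
  assumes fin: "fin_dim"
  shows "quasi_triangular_eps_hom_bialgebra K A \<mu> \<Delta> \<alpha> r \<longleftrightarrow>
    (\<forall>\<phi>\<in>carrier dual.
      \<Delta> (lambda1 K A \<alpha> r \<phi>) = dual_map2 K A (lambda2 K A \<alpha> r) (mul_dual_op K A \<mu> \<phi>))"
proof -
  interpret L1: presented_dual_map K A \<mu> \<Delta> \<alpha> r u v n "\<lambda>i. \<alpha> (u i)" v "lambda1 K A \<alpha> r"
    by (rule presented_lambda1)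
  interpret L2: presented_dual_map K A \<mu> \<Delta> \<alpha> r u v n u "\<lambda>i. \<alpha> (v i)" "lambda2 K A \<alpha> r"
    by (rule presented_lambda2)
  have lhs: "fun2 \<psi> \<chi> (\<Delta> (lambda1 K A \<alpha> r \<phi>)) = fun3 \<phi> \<psi> \<chi> (comul_right K A \<alpha> \<Delta> r)"
    if d: "\<phi> \<in> carrier dual" "\<psi> \<in> carrier dual" "\<chi> \<in> carrier dual" for \<phi> \<psi> \<chi>
    by (simp add: L1.functional_comul_M[OF d] fun3_comul_right[OF d])
  have rhs: "fun2 \<psi> \<chi> (dual_map2 K A (lambda2 K A \<alpha> r) (mul_dual_op K A \<mu> \<phi>))
      = fun3 \<phi> \<psi> \<chi> (r13_r12 K A \<mu> \<alpha> r)"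
    if d: "\<phi> \<in> carrier dual" "\<psi> \<in> carrier dual" "\<chi> \<in> carrier dual" for \<phi> \<psi> \<chi>
    by (simp add: L2.functional_dual_map2_mul_dual_op[OF fin d] fun3_r13_r12[OF d])
  have "(\<forall>\<phi>\<in>carrier dual. \<Delta> (lambda1 K A \<alpha> r \<phi>) = dual_map2 K A (lambda2 K A \<alpha> r) (mul_dual_op K A \<mu> \<phi>)) \<longleftrightarrow>
      (\<forall>\<phi>\<in>carrier dual. \<forall>\<psi>\<in>carrier dual. \<forall>\<chi>\<in>carrier dual.
        fun2 \<psi> \<chi> (\<Delta> (lambda1 K A \<alpha> r \<phi>)) = fun2 \<psi> \<chi> (dual_map2 K A (lambda2 K A \<alpha> r) (mul_dual_op K A \<mu> \<phi>)))"
    by (rule dual_maps_eq_iff) (intro comul_closed[OF L1.M_closed] L2.dual_map2_mul_dual_op_closed[OF fin]; assumption)+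
  then show ?thesis
    unfolding quasi_triangular_iff_comul_right tensor3_eq_iff[OF comul_closed_r(2) r_products_closed(1)]
    by (simp add: lhs rhs)
qed

text \<open>As \<open>rho1\<close> pairs \<phi> with \<alpha> (v i) and returns u i, the functional
  \<phi> tests the third place and the order becomes \<psi>, \<chi>, \<phi>.\<close>

lemma quasi_triangular_iff_comul_rho:
  assumes fin: "fin_dim"
  shows "quasi_triangular_eps_hom_bialgebra K A \<mu> \<Delta> \<alpha> r \<longleftrightarrow>
    (\<forall>\<phi>\<in>carrier dual.
      \<ominus>\<^bsub>tensor2 K A\<^esub> \<Delta> (rho1 K A \<alpha> r \<phi>) = dual_map2 K A (rho2 K A \<alpha> r) (mul_dual_op K A \<mu> \<phi>))"
proof -
  interpret R1: presented_dual_map K A \<mu> \<Delta> \<alpha> r u v n "\<lambda>i. \<alpha> (v i)" u "rho1 K A \<alpha> r"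
    by (rule presented_rho1)
  interpret R2: presented_dual_map K A \<mu> \<Delta> \<alpha> r u v n v "\<lambda>i. \<alpha> (u i)" "rho2 K A \<alpha> r"
    by (rule presented_rho2)
  interpret FK: vectorspace K "field_space K" by (rule FK)
  interpret A2: vectorspace K "tensor2 K A" by (rule A2)
  have lhs: "fun2 \<psi> \<chi> (\<ominus>\<^bsub>tensor2 K A\<^esub> \<Delta> (rho1 K A \<alpha> r \<phi>))
      = \<ominus>\<^bsub>field_space K\<^esub> fun3 \<psi> \<chi> \<phi> (comul_left K A \<Delta> \<alpha> r)"
    if d: "\<phi> \<in> carrier dual" "\<psi> \<in> carrier dual" "\<chi> \<in> carrier dual" for \<phi> \<psi> \<chi>
    by (simp add: linear_map_uminus[OF dual_space_linear[OF fun2(1)[OF d(2,3)]]] comul_closed R1.M_closed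
        R1.functional_comul_M[OF d] fun3_comul_left d fun2_closed dual_closed closed R.m_comm)
  have rhs: "fun2 \<psi> \<chi> (dual_map2 K A (rho2 K A \<alpha> r) (mul_dual_op K A \<mu> \<phi>))
      = fun3 \<psi> \<chi> \<phi> (r23_r13 K A \<mu> \<alpha> r)"
    if d: "\<phi> \<in> carrier dual" "\<psi> \<in> carrier dual" "\<chi> \<in> carrier dual" for \<phi> \<psi> \<chi>
    by (simp add: R2.functional_dual_map2_mul_dual_op[OF fin d] fun3_r23_r13 d closed dual_closed R.m_ac)
  \<comment> \<open>The sign stands at the coproduct here but at r23 r13 in the equation for
    (\<Delta> \<otimes> \<alpha>)(r), so it is moved across in K.\<close>
  have neg: "\<ominus>\<^bsub>field_space K\<^esub> fun3 \<psi> \<chi> \<phi> (comul_left K A \<Delta> \<alpha> r) = fun3 \<psi> \<chi> \<phi> (r23_r13 K A \<mu> \<alpha> r)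
      \<longleftrightarrow> fun3 \<psi> \<chi> \<phi> (comul_left K A \<Delta> \<alpha> r) = fun3 \<psi> \<chi> \<phi> (\<ominus>\<^bsub>tensor3 K A\<^esub> r23_r13 K A \<mu> \<alpha> r)"
    if d: "\<phi> \<in> carrier dual" "\<psi> \<in> carrier dual" "\<chi> \<in> carrier dual" for \<phi> \<psi> \<chi>
    using linear_mapD(1)[OF fun3(1)[OF d(2,3,1)]] comul_closed_r(1) r_products_closed(3)
    by (metis linear_map_uminus[OF fun3(1)[OF d(2,3,1)]] FK.M.minus_minus)
  have cl: "\<ominus>\<^bsub>tensor2 K A\<^esub> \<Delta> (rho1 K A \<alpha> r \<phi>) \<in> carrier (tensor2 K A)" if "\<phi> \<in> carrier dual" for \<phi>
    using that by (intro A2.M.a_inv_closed comul_closed R1.M_closed)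
  have "(\<forall>\<phi>\<in>carrier dual. \<ominus>\<^bsub>tensor2 K A\<^esub> \<Delta> (rho1 K A \<alpha> r \<phi>) = dual_map2 K A (rho2 K A \<alpha> r) (mul_dual_op K A \<mu> \<phi>)) \<longleftrightarrow>
      (\<forall>\<phi>\<in>carrier dual. \<forall>\<psi>\<in>carrier dual. \<forall>\<chi>\<in>carrier dual.
        fun2 \<psi> \<chi> (\<ominus>\<^bsub>tensor2 K A\<^esub> \<Delta> (rho1 K A \<alpha> r \<phi>)) = fun2 \<psi> \<chi> (dual_map2 K A (rho2 K A \<alpha> r) (mul_dual_op K A \<mu> \<phi>)))"
    by (rule dual_maps_eq_iff) (intro cl R2.dual_map2_mul_dual_op_closed[OF fin]; assumption)+
  then show ?thesis
    unfolding quasi_triangular_iff_comul_left tensor3_eq_iff[OF comul_closed_r(1,3)]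
    by (simp add: lhs rhs neg) blast
qed

end

lemma coboundary_presentation:
  assumes "coboundary_eps_hom_bialgebra K A \<mu> \<Delta> \<alpha> r"
  obtains u v and n :: nat where "presented_coboundary K A \<mu> \<Delta> \<alpha> r u v n"
proof -
  interpret coboundary_eps_hom_bialgebra K A \<mu> \<Delta> \<alpha> r by fact
  obtain u v and n :: nat where uv: "\<And>i. u i \<in> carrier A" "\<And>i. v i \<in> carrier A"
    "r = (\<Oplus>\<^bsub>tensor2 K A\<^esub>i\<in>{..<n}. pure2 K A (u i) (v i))"
    by (rule tensor_finsum[OF vectorspace_axioms vectorspace_axioms r_closed]) (rule that)
  show thesis by (rule that[of u v n]) (unfold_locales; rule uv)
qed

theorem theorem5p11:
  fixes K :: "('k, 'r) ring_scheme"
    and A :: "('k, 'a, 'm) module_scheme"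
    and \<mu> :: "('a \<times> 'a \<Rightarrow> 'k) set \<Rightarrow> 'a"
    and \<Delta> :: "'a \<Rightarrow> ('a \<times> 'a \<Rightarrow> 'k) set"
    and \<alpha> :: "'a \<Rightarrow> 'a"
    and r :: "('a \<times> 'a \<Rightarrow> 'k) set"
  assumes "char_zero K"
    and "coboundary_eps_hom_bialgebra K A \<mu> \<Delta> \<alpha> r"
  shows
    "(quasi_triangular_eps_hom_bialgebra K A \<mu> \<Delta> \<alpha> r \<longleftrightarrow>
        comul_right K A \<alpha> \<Delta> r = r13_r12 K A \<mu> \<alpha> r) \<and>
     (quasi_triangular_eps_hom_bialgebra K A \<mu> \<Delta> \<alpha> r \<longleftrightarrow>
        comul_left K A \<Delta> \<alpha> r = \<ominus>\<^bsub>tensor3 K A\<^esub> r23_r13 K A \<mu> \<alpha> r) \<and>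
     (quasi_triangular_eps_hom_bialgebra K A \<mu> \<Delta> \<alpha> r \<longleftrightarrow>
        (\<forall>x \<in> carrier (tensor2 K (dual_space K A)).
          lambda2 K A \<alpha> r (comul_dual K A \<Delta> x)
            = \<ominus>\<^bsub>A\<^esub> mul_op K A \<mu> (dual_map2 K A (lambda1 K A \<alpha> r) x))) \<and>
     (quasi_triangular_eps_hom_bialgebra K A \<mu> \<Delta> \<alpha> r \<longleftrightarrow>
        (\<forall>x \<in> carrier (tensor2 K (dual_space K A)).
          rho2 K A \<alpha> r (comul_dual K A \<Delta> x)
            = mul_op K A \<mu> (dual_map2 K A (rho1 K A \<alpha> r) x))) \<and>
     (vectorspace.fin_dim K A \<longrightarrow>
       (quasi_triangular_eps_hom_bialgebra K A \<mu> \<Delta> \<alpha> r \<longleftrightarrow>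
          (\<forall>\<phi> \<in> carrier (dual_space K A).
            \<Delta> (lambda1 K A \<alpha> r \<phi>)
              = dual_map2 K A (lambda2 K A \<alpha> r) (mul_dual_op K A \<mu> \<phi>))) \<and>
       (quasi_triangular_eps_hom_bialgebra K A \<mu> \<Delta> \<alpha> r \<longleftrightarrow>
          (\<forall>\<phi> \<in> carrier (dual_space K A).
            \<ominus>\<^bsub>tensor2 K A\<^esub> \<Delta> (rho1 K A \<alpha> r \<phi>)
              = dual_map2 K A (rho2 K A \<alpha> r) (mul_dual_op K A \<mu> \<phi>))))"
proof -
  \<comment> \<open>The claims do not mention a presentation of r, so an arbitrary one may be
    chosen.\<close>
  obtain u v and n :: nat where "presented_coboundary K A \<mu> \<Delta> \<alpha> r u v n"
    by (rule coboundary_presentation[OF assms(2)]) (rule that)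
  then interpret presented_coboundary K A \<mu> \<Delta> \<alpha> r u v n .
  show ?thesis
    by (intro conjI impI quasi_triangular_iff_comul_right quasi_triangular_iff_comul_left
        quasi_triangular_iff_lambda_comul_dual quasi_triangular_iff_rho_comul_dual
        quasi_triangular_iff_comul_lambda quasi_triangular_iff_comul_rho)
qed

end
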